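(* Let $d\ge 1$ be an integer and $\alpha\in(0,2)$ with $\alpha\le d$. Let $Z$ be the symmetric stable Lévy process of index $\alpha$ in $\mathbb{R}^d$ with $\mathbb{E}_0[\exp\{i\langle\lambda,Z_t\rangle\}]=\exp\{-t\|\lambda\|^\alpha\}$, and let $R_t=\|Z_t\|$, $t\ge 0$. Let $g:\mathbb{R}_+\to\mathbb{R}$ be such that $g\in C^2_0(\mathbb{R}_+)$. Then the infinitesimal generator $M$ of $R=(R_t,t\ge0)$ acts as follows: for $a>0$, \[ Mg(a)=a^{-\alpha}\int_0^\infty\big(g(ya)-g(a)-g'(a)\,\ell(\log y)\big)\frac{y^{d-1}}{(1+y^2)^{(\alpha+d)/2}}\,\overline{F}\left(\left(\frac{2y}{1+y^2}\right)^2\right)dy, \] where \[ \overline{F}(z)=\frac{2^\alpha\,\alpha\,(d/2)_{\alpha/2}}{\Gamma(1-\alpha/2)}\;{}_2\mathcal{F}_1\left(\frac{\alpha+d}{4},\frac{\alpha+d}{4}+\frac12;\frac d2;z\right),\qquad z\in(-1,1), \] and the function $\ell$ is given by \[ \ell(y)=\frac{y}{1+y^2}\,e^{(1-d)y}\left(1+e^{2y}\right)^{(\alpha+d)/2-1}\mathbf{1}_{\{|y|<1\}}. \]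
   Context: $\|\cdot\|$ and $\langle\cdot,\cdot\rangle$ are the Euclidean norm and inner product on $\mathbb{R}^d$; under $\mathbb{P}_z$ (expectation $\mathbb{E}_z$), $Z$ starts from $z\in\mathbb{R}^d$. Since $Z$ is isotropic, $R$ is a strong Markov process, and $M$ denotes its infinitesimal generator. $C^2_0(\mathbb{R}_+)$ is the usual notation for a class of twice continuously differentiable functions on $\mathbb{R}_+$ vanishing at infinity; the source uses the notation without further specification. The Pochhammer symbol is $(z)_s=\Gamma(z+s)/\Gamma(z)$, and the Gauss hypergeometric function is ${}_2\mathcal{F}_1(a,b;c;z)=\sum_{k\ge0}\frac{(a)_k(b)_k}{(c)_k\,k!}z^k$ for $|z|<1$.
   Formalization: The integral is a Cauchy principal value at y=1 (also an ordinary Lebesgue integral for α<1), as for α≥1 it generally does not converge absolutely with the compensator ℓ; the generator Mg(a) is the pointwise limit of (E_a g(R_t)−g(a))/t as t→0+ for each a>0. *)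

theory Defs
  imports "HOL-Probability.Probability"
begin

subsection \<open>The symmetric stable process\<close>

definition levy_process ::
    "'w measure \<Rightarrow> (real \<Rightarrow> 'w \<Rightarrow> 'a::euclidean_space) \<Rightarrow> bool" where
  "levy_process P Z \<longleftrightarrow>
     prob_space P \<and>
     (\<forall>t\<ge>0. Z t \<in> borel_measurable P) \<and>
     (AE \<omega> in P. Z 0 \<omega> = 0) \<and>
     (\<forall>(s :: nat \<Rightarrow> real) n. 0 \<le> s 0 \<and> (\<forall>i<n. s i \<le> s (Suc i)) \<longrightarrow>
        prob_space.indep_vars P (\<lambda>_. borel) (\<lambda>i \<omega>. Z (s (Suc i)) \<omega> - Z (s i) \<omega>) {..<n}) \<and>
     (\<forall>s\<ge>0. \<forall>t\<ge>0. distr P borel (\<lambda>\<omega>. Z (s + t) \<omega> - Z s \<omega>) = distr P borel (Z t)) \<and>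
     (AE \<omega> in P. \<forall>t\<ge>0.
        ((\<lambda>s. Z s \<omega>) \<longlongrightarrow> Z t \<omega>) (at_right t) \<and>
        (t > 0 \<longrightarrow> (\<exists>l. ((\<lambda>s. Z s \<omega>) \<longlongrightarrow> l) (at_left t))))"

text \<open>
  Here \<open>P z\<close> is the law under which the process starts from \<open>z\<close>: under \<open>P z\<close> the process
  has the law of \<open>z + Z\<close> under \<open>P 0\<close>, as a random element of the product space over all times.
\<close>

definition symmetric_stable_process ::
    "real \<Rightarrow> ('a::euclidean_space \<Rightarrow> 'w measure) \<Rightarrow> (real \<Rightarrow> 'w \<Rightarrow> 'a) \<Rightarrow> bool" where
  "symmetric_stable_process \<alpha> P Z \<longleftrightarrow>
     (\<forall>z. levy_process (P z) (\<lambda>t \<omega>. Z t \<omega> - z)) \<and>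
     (\<forall>z. distr (P z) (Pi\<^sub>M {0..} (\<lambda>_. borel)) (\<lambda>\<omega>. \<lambda>t\<in>{0..}. Z t \<omega>) =
          distr (P 0) (Pi\<^sub>M {0..} (\<lambda>_. borel)) (\<lambda>\<omega>. \<lambda>t\<in>{0..}. z + Z t \<omega>)) \<and>
     (\<forall>t\<ge>0. \<forall>\<xi>. (LINT \<omega>|P 0. exp (\<i> * complex_of_real (\<xi> \<bullet> Z t \<omega>))) =
          complex_of_real (exp (- t * norm \<xi> powr \<alpha>)))"

definition radial_part :: "(real \<Rightarrow> 'w \<Rightarrow> 'a::real_normed_vector) \<Rightarrow> real \<Rightarrow> 'w \<Rightarrow> real" where
  "radial_part Z t \<omega> = norm (Z t \<omega>)"

text \<open>
  A choice of laws \<open>Q a\<close> under which the radial part starts from \<open>a \<ge> 0\<close>. By isotropy the law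
  of the radial part under \<open>P z\<close> depends on \<open>z\<close> only through its norm, so the choice is immaterial.
\<close>

definition radial_laws ::
    "('a::real_normed_vector \<Rightarrow> 'w measure) \<Rightarrow> (real \<Rightarrow> 'w measure) \<Rightarrow> bool" where
  "radial_laws P Q \<longleftrightarrow> (\<forall>a\<ge>0. \<exists>z. norm z = a \<and> Q a = P z)"

subsection \<open>Infinitesimal generator\<close>

text \<open>
  \<open>has_generator_at Q X g x m\<close>: the infinitesimal generator of the Markov process \<open>X\<close>, which
  starts from \<open>x\<close> under \<open>Q x\<close>, applied to \<open>g\<close> and evaluated at \<open>x\<close>, exists and equals \<open>m\<close>.
  The limit is the pointwise one. Convergence in the supremum norm over all starting points is not
  required: for the radial part it can fail for a \<open>g\<close> as below, since \<open>x \<mapsto> g (norm x)\<close> need not be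
  differentiable at the origin.
\<close>

definition has_generator_at ::
    "('x \<Rightarrow> 'w measure) \<Rightarrow> (real \<Rightarrow> 'w \<Rightarrow> 'x) \<Rightarrow> ('x \<Rightarrow> real) \<Rightarrow> 'x \<Rightarrow> real \<Rightarrow> bool" where
  "has_generator_at Q X g x m \<longleftrightarrow>
     (\<forall>t\<ge>0. integrable (Q x) (\<lambda>\<omega>. g (X t \<omega>))) \<and>
     ((\<lambda>t. ((LINT \<omega>|Q x. g (X t \<omega>)) - g x) / t) \<longlongrightarrow> m) (at_right 0)"

text \<open>
  Twice continuously differentiable functions on \<open>{0..}\<close> (one-sided at 0) vanishing at infinity.
  Only the function itself, not its derivatives, is required to vanish at infinity.
\<close>

definition C2_0 :: "(real \<Rightarrow> real) \<Rightarrow> bool" where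
  "C2_0 g \<longleftrightarrow>
     (\<exists>g' g''.
        (\<forall>x\<ge>0. (g has_real_derivative g' x) (at x within {0..})) \<and>
        (\<forall>x\<ge>0. (g' has_real_derivative g'' x) (at x within {0..})) \<and>
        continuous_on {0..} g'') \<and>
     (g \<longlongrightarrow> 0) at_top"

subsection \<open>The integral formula\<close>

text \<open>
  \<open>gen_pochhammer z s\<close> is the symbol \<open>(z)\<^sub>s\<close> for real \<open>s\<close>; the library's \<^const>\<open>pochhammer\<close> covers
  natural \<open>s\<close>.
\<close>

definition gen_pochhammer :: "real \<Rightarrow> real \<Rightarrow> real" where
  "gen_pochhammer z s = Gamma (z + s) / Gamma z"

lemma gen_pochhammer_of_nat:
  assumes "z > 0"
  shows "gen_pochhammer z (real n) = pochhammer z n"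
proof -
  have "z \<notin> \<int>\<^sub>\<le>\<^sub>0"
    using assms by (auto simp: nonpos_Ints_def)
  then show ?thesis
    by (simp add: gen_pochhammer_def pochhammer_Gamma)
qed

definition hyp2F1 :: "real \<Rightarrow> real \<Rightarrow> real \<Rightarrow> real \<Rightarrow> real" where
  "hyp2F1 a b c z = (\<Sum>k. pochhammer a k * pochhammer b k / (pochhammer c k * fact k) * z ^ k)"

definition Fbar :: "nat \<Rightarrow> real \<Rightarrow> real \<Rightarrow> real" where
  "Fbar d \<alpha> z =
     2 powr \<alpha> * \<alpha> * gen_pochhammer (real d / 2) (\<alpha> / 2) / Gamma (1 - \<alpha> / 2) *
     hyp2F1 ((\<alpha> + real d) / 4) ((\<alpha> + real d) / 4 + 1 / 2) (real d / 2) z"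

definition ell :: "nat \<Rightarrow> real \<Rightarrow> real \<Rightarrow> real" where
  "ell d \<alpha> y =
     y / (1 + y\<^sup>2) * exp ((1 - real d) * y) * (1 + exp (2 * y)) powr ((\<alpha> + real d) / 2 - 1) *
     indicator {u. \<bar>u\<bar> < 1} y"

definition radial_integrand :: "nat \<Rightarrow> real \<Rightarrow> (real \<Rightarrow> real) \<Rightarrow> real \<Rightarrow> real \<Rightarrow> real" where
  "radial_integrand d \<alpha> g a y =
     (g (y * a) - g a - deriv g a * ell d \<alpha> (ln y)) *
     (y ^ (d - 1) / (1 + y\<^sup>2) powr ((\<alpha> + real d) / 2)) *
     Fbar d \<alpha> ((2 * y / (1 + y\<^sup>2))\<^sup>2)"

text \<open>
  \<open>has_pv_integral f c S I\<close>: the Cauchy principal value at \<open>c\<close> of the Lebesgue integral of \<open>f\<close>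
  over \<open>S\<close> is \<open>I\<close>. The principal value is needed for the integral of \<^const>\<open>radial_integrand\<close>, with
  \<open>c = 1\<close>. There \<^const>\<open>Fbar\<close> contributes a singularity of order \<open>\<bar>y - 1\<bar> powr (- 1 - \<alpha>)\<close>, while the
  other factor is in general only of first order, because
  \<open>deriv g a * ell d \<alpha> (ln y)\<close> differs from \<open>a * deriv g a * (y - 1)\<close> to first order. So for
  \<open>\<alpha> \<ge> 1\<close> the Lebesgue integral does not exist in general. The compensator is nevertheless
  the correct one in the sense of principal values: after the substitution \<open>y = exp u\<close> its
  product with the density is odd in \<open>u\<close>.
\<close>

definition has_pv_integral :: "(real \<Rightarrow> real) \<Rightarrow> real \<Rightarrow> real set \<Rightarrow> real \<Rightarrow> bool" where
  "has_pv_integral f c S I \<longleftrightarrow>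
     (\<forall>\<epsilon>>0. set_integrable lborel (S - cball c \<epsilon>) f) \<and>
     ((\<lambda>\<epsilon>. LINT y:S - cball c \<epsilon>|lborel. f y) \<longlongrightarrow> I) (at_right 0)"

end

theory Submission
  imports Defs
begin

text \<open>
  The proof evaluates the generator on functions of \<open>\<phi> = exp (- r\<^sup>2)\<close>, where \<open>r\<close> is the radius, and
  reaches every \<open>g\<close> from there by approximation.

  \<^bold>\<open>Gaussian functions.\<close> The function \<open>w \<mapsto> exp (- s (norm w)\<^sup>2)\<close> is the characteristic function of a
  Gaussian variable \<open>x\<close>. By Fubini, its expectation at time \<open>t\<close> is the Gaussian average of
  \<open>cos (sqrt (2 s) z \<bullet> x) exp (- t (2 s (norm x)\<^sup>2) powr (\<alpha>/2))\<close>, whose derivative at \<open>t = 0\<close> is clear.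
  Subordination, \<open>y powr \<beta> = c \<integral> (1 - exp (- y v)) v powr (- 1 - \<beta>) dv\<close> with \<open>\<beta> = \<alpha>/2\<close>, expresses this
  derivative by the increments of the heat semigroup (\<open>stable_generator_gaussian\<close>).

  \<^bold>\<open>The kernel.\<close> In the variables \<open>r = a exp u\<close> and \<open>v = a\<^sup>2 exp \<tau> / 4\<close>, the radial heat kernel times
  \<open>v powr (- 1 - \<beta>)\<close> is, up to a constant, the function \<open>kern \<tau> u\<close>, given by the power series of a Bessel function.
  Integration over \<open>u\<close> recovers the heat semigroup (\<open>nn_integral_kern_right\<close>), integration over \<open>\<tau>\<close> gives,
  up to a constant, the hypergeometric density of the theorem (\<open>density_eq_jker\<close>). As a function of \<open>\<tau> - u\<close> and \<open>u\<close>, \<open>kern\<close>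
  is \<open>exp ((h - \<beta>) u)\<close>, where \<open>h\<close> is half the dimension, times a function that is even in \<open>u\<close> and
  decreasing in \<open>\<bar>u\<bar>\<close>.

  \<^bold>\<open>Second-order part.\<close> Write \<open>x0 = exp (- a\<^sup>2)\<close>. By Taylor's theorem
  \<open>g r - g a = b (\<phi> - x0) + (\<phi> - x0)\<^sup>2 \<eta>(\<phi>)\<close> with \<open>\<eta>\<close> continuous on \<open>[0, 1]\<close> (\<open>exp_square_decomposition\<close>).
  The function \<open>(\<phi> - x0)\<^sup>2\<close> is nonnegative and the formula for Gaussian functions shows that its integral
  against \<open>kern\<close> is finite. So Tonelli and Fubini apply to \<open>(\<phi> - x0)\<^sup>2 \<eta>(\<phi>)\<close> for polynomial \<open>\<eta>\<close>, and for general
  \<open>\<eta>\<close> a polynomial within \<open>e\<close> changes both sides by at most \<open>e\<close> times their values at \<open>(\<phi> - x0)\<^sup>2\<close>.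
  The same finiteness replaces all asymptotics of the hypergeometric function: with the monotonicity in
  \<open>\<bar>u\<bar>\<close> it bounds the density near its singularity.

  \<^bold>\<open>First-order part.\<close> For \<open>\<phi> - x0\<close> the double integral need not converge absolutely. Cutting off in
  \<open>\<tau>\<close> yields the generator in the limit; cutting off in \<open>\<tau> - u\<close> preserves the evenness and yields the
  principal value. With cut-off functions of Lipschitz constant \<open>1/n\<close> the two differ by at most \<open>1/n\<close> times
  the integral of \<open>\<bar>u\<bar> \<bar>\<phi> - x0\<bar>\<close>, which is of second order and hence finite (\<open>symmetrization\<close>).
  The compensator becomes an odd function of \<open>u\<close>, so its principal value is zero. Finally, the window
  \<open>\<bar>y - 1\<bar> \<le> \<epsilon>\<close> is not symmetric in \<open>u = ln y\<close>, but the excess has length \<open>O(\<epsilon>\<^sup>2)\<close> and contributes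
  \<open>o(1)\<close> (\<open>truncated_tendsto_pvint\<close>).
\<close>

section \<open>Integrals in logarithmic coordinates\<close>

lemma nn_integral_exp_substitution:
  fixes f :: "real \<Rightarrow> ennreal"
  assumes [measurable]: "f \<in> borel_measurable borel"
  shows "(\<integral>\<^sup>+y. f y * indicator {0<..} y \<partial>lborel) = (\<integral>\<^sup>+u. f (exp u) * ennreal (exp u) \<partial>lborel)"
proof (rule LIMSEQ_unique)
  let ?F = "\<lambda>n y. f y * indicator {exp (- real (Suc n))..exp (real (Suc n))} y"
  let ?G = "\<lambda>n u. f (exp u) * ennreal (exp u) * indicator {- real (Suc n)..real (Suc n)} u"
  have "(\<lambda>n. \<integral>\<^sup>+y. ?F n y \<partial>lborel) \<longlonglongrightarrow> (\<integral>\<^sup>+y. f y * indicator {0<..} y \<partial>lborel)"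
  proof (rule nn_integral_LIMSEQ)
    show "incseq ?F"
      unfolding incseq_def le_fun_def
    proof (intro allI impI)
      fix m n :: nat and y :: real assume "m \<le> n"
      then have "exp (- real (Suc n)) \<le> exp (- real (Suc m))" "exp (real (Suc m)) \<le> exp (real (Suc n))" by auto
      then show "?F m y \<le> ?F n y" by (auto simp: indicator_def simp del: exp_le_cancel_iff)
    qed
    fix y :: real
    have "\<forall>\<^sub>F n in sequentially. ?F n y = f y * indicator {0<..} y"
    proof (cases "y > 0")
      case True
      obtain N :: nat where N: "\<bar>ln y\<bar> \<le> real N"
        using real_arch_simple by blast
      show ?thesis
      proof (rule eventually_sequentiallyI[of N])
        fix n assume "N \<le> n"
        then have "- real (Suc n) \<le> ln y" "ln y \<le> real (Suc n)" using N by auto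
        then have "exp (- real (Suc n)) \<le> y" "y \<le> exp (real (Suc n))"
          using True by (metis exp_le_cancel_iff exp_ln)+
        then show "?F n y = f y * indicator {0<..} y" using True by simp
      qed
    next
      case False
      have "\<And>n. \<not> exp (- real (Suc n)) \<le> y"
        using False by (meson exp_gt_zero less_le_trans)
      then show ?thesis using False by (auto simp: indicator_def)
    qed
    then show "(\<lambda>n. ?F n y) \<longlonglongrightarrow> f y * indicator {0<..} y"
      by (rule tendsto_eventually)
  qed auto
  moreover have "(\<integral>\<^sup>+y. ?F n y \<partial>lborel) = (\<integral>\<^sup>+u. ?G n u \<partial>lborel)" for n
    by (rule nn_integral_substitution_aux)
      (auto intro!: derivative_eq_intros continuous_intros)
  ultimately show "(\<lambda>n. \<integral>\<^sup>+u. ?G n u \<partial>lborel) \<longlonglongrightarrow> (\<integral>\<^sup>+y. f y * indicator {0<..} y \<partial>lborel)"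
    by simp
  show "(\<lambda>n. \<integral>\<^sup>+u. ?G n u \<partial>lborel) \<longlonglongrightarrow> (\<integral>\<^sup>+u. f (exp u) * ennreal (exp u) \<partial>lborel)"
  proof (rule nn_integral_LIMSEQ)
    show "incseq ?G"
      by (auto simp: incseq_def le_fun_def indicator_def intro: order_trans)
    fix u :: real
    obtain N :: nat where N: "\<bar>u\<bar> \<le> real N"
      using real_arch_simple by blast
    have "\<forall>\<^sub>F n in sequentially. ?G n u = f (exp u) * ennreal (exp u)"
      by (rule eventually_sequentiallyI[of N]) (use N in \<open>auto simp: indicator_def\<close>)
    then show "(\<lambda>n. ?G n u) \<longlonglongrightarrow> f (exp u) * ennreal (exp u)"
      by (rule tendsto_eventually)
  qed auto
qed

text \<open>The same substitution as an identity of measures; it transfers integrability and signed integrals.\<close>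

lemma distr_exp_lborel:
  "distr (density lborel (\<lambda>u. ennreal (exp u))) borel exp = density lborel (indicator {0<..} :: real \<Rightarrow> ennreal)"
proof (rule measure_eqI)
  fix A assume "A \<in> sets (distr (density lborel (\<lambda>u::real. ennreal (exp u))) borel exp)"
  then have [measurable]: "A \<in> sets borel" by simp
  have "emeasure (distr (density lborel (\<lambda>u. ennreal (exp u))) borel exp) A =
      (\<integral>\<^sup>+y. indicator A y \<partial>distr (density lborel (\<lambda>u::real. ennreal (exp u))) borel exp)"
    by simp
  also have "\<dots> = (\<integral>\<^sup>+u. indicator A (exp u) * ennreal (exp u) \<partial>lborel)"
    by (subst nn_integral_distr) (auto simp: nn_integral_density mult.commute simp del: nn_integral_indicator)
  also have "\<dots> = (\<integral>\<^sup>+y. indicator A y * indicator {0<..} y \<partial>lborel)"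
    by (rule nn_integral_exp_substitution[symmetric]) auto
  also have "\<dots> = emeasure (density lborel (indicator {0<..} :: real \<Rightarrow> ennreal)) A"
    by (simp add: emeasure_density mult.commute)
  finally show "emeasure (distr (density lborel (\<lambda>u. ennreal (exp u))) borel exp) A = \<dots>" .
qed simp

lemma
  fixes f :: "real \<Rightarrow> real"
  assumes [measurable]: "f \<in> borel_measurable borel"
  shows set_integrable_exp_substitution:
      "set_integrable lborel {0<..} f \<longleftrightarrow> integrable lborel (\<lambda>u. f (exp u) * exp u)"
    and set_integral_exp_substitution:
      "(LINT y:{0<..}|lborel. f y) = (LINT u|lborel. f (exp u) * exp u)"
proof -
  let ?M = "distr (density lborel (\<lambda>u::real. ennreal (exp u))) borel exp"
  have d: "density lborel (indicator {0<..} :: real \<Rightarrow> ennreal) =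
      density lborel (\<lambda>y. ennreal (indicat_real {0<..} y))"
    by (rule density_cong) (auto simp: indicator_def)
  have "integrable ?M f \<longleftrightarrow> integrable lborel (\<lambda>u. exp u * f (exp u))"
    by (subst integrable_distr_eq) (auto simp: integrable_density)
  moreover have "integrable ?M f \<longleftrightarrow> set_integrable lborel {0<..} f"
    unfolding distr_exp_lborel d set_integrable_def by (subst integrable_density) auto
  ultimately show "set_integrable lborel {0<..} f \<longleftrightarrow> integrable lborel (\<lambda>u. f (exp u) * exp u)"
    by (simp add: mult.commute)
  have "integral\<^sup>L ?M f = (LINT u|lborel. exp u * f (exp u))"
    by (subst integral_distr) (auto simp: integral_density)
  moreover have "integral\<^sup>L ?M f = (LINT y:{0<..}|lborel. f y)"
    unfolding distr_exp_lborel d set_lebesgue_integral_def by (subst integral_density) auto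
  ultimately show "(LINT y:{0<..}|lborel. f y) = (LINT u|lborel. f (exp u) * exp u)"
    by (simp add: mult.commute)
qed

text \<open>Euler's integral for the Gamma function in the variable \<open>u = ln t\<close>.\<close>

lemma nn_integral_Gamma_exp:
  assumes "b > 0" "x > 0"
  shows "(\<integral>\<^sup>+u. ennreal (exp (b * u) * exp (- (x * exp u))) \<partial>lborel) = ennreal (Gamma b * x powr - b)"
proof -
  have "ennreal (Gamma b) = (\<integral>\<^sup>+t. ennreal (indicat_real {0..} t * t powr (b - 1) / exp t) \<partial>lborel)"
    using assms(1) by (rule Gamma_conv_nn_integral_real)
  also have "\<dots> = (\<integral>\<^sup>+t. ennreal (t powr (b - 1) / exp t) * indicator {0<..} t \<partial>lborel)"
    by (intro nn_integral_cong) (auto simp: indicator_def)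
  also have "\<dots> = (\<integral>\<^sup>+u. ennreal (exp u powr (b - 1) / exp (exp u)) * ennreal (exp u) \<partial>lborel)"
    by (rule nn_integral_exp_substitution) auto
  also have "\<dots> = (\<integral>\<^sup>+u. ennreal (exp (b * u) * exp (- exp u)) \<partial>lborel)"
    by (intro nn_integral_cong)
      (simp add: ennreal_mult[symmetric] powr_def exp_minus field_simps exp_diff[symmetric] exp_add[symmetric])
  also have "\<dots> = (\<integral>\<^sup>+u. ennreal (exp (b * (ln x + 1 * u)) * exp (- exp (ln x + 1 * u))) \<partial>lborel)"
    by (subst nn_integral_real_affine[where t="ln x" and c=1]) auto
  also have "\<dots> = (\<integral>\<^sup>+u. ennreal (x powr b) * ennreal (exp (b * u) * exp (- (x * exp u))) \<partial>lborel)"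
    using assms by (intro nn_integral_cong)
      (simp add: ennreal_mult[symmetric] powr_def exp_add distrib_left)
  also have "\<dots> = ennreal (x powr b) * (\<integral>\<^sup>+u. ennreal (exp (b * u) * exp (- (x * exp u))) \<partial>lborel)"
    by (rule nn_integral_cmult) auto
  finally have "ennreal (x powr - b) * ennreal (Gamma b) = ennreal (x powr - b) * ennreal (x powr b) *
      (\<integral>\<^sup>+u. ennreal (exp (b * u) * exp (- (x * exp u))) \<partial>lborel)"
    by (simp add: mult.assoc)
  moreover have "ennreal (x powr - b) * ennreal (x powr b) = 1"
    using assms by (simp add: ennreal_mult[symmetric] powr_add[symmetric])
  ultimately show ?thesis
    using assms by (simp add: ennreal_mult mult.commute)
qed

lemma integral_exp_neg_interval:
  fixes y :: real
  assumes "y \<ge> 0"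
  shows "(\<integral>\<^sup>+\<theta>. ennreal (y * exp (- \<theta> * y)) * indicator {0..1} \<theta> \<partial>lborel) = ennreal (1 - exp (- y))"
proof -
  have "(\<integral>\<^sup>+\<theta>. ennreal (y * exp (- \<theta> * y)) * indicator {0..1} \<theta> \<partial>lborel) =
      ennreal ((- exp (- 1 * y)) - (- exp (- 0 * y)))"
    by (rule nn_integral_FTC_Icc) (use assms in \<open>auto intro!: derivative_eq_intros\<close>)
  then show ?thesis by simp
qed

text \<open>The subordination formula for the power \<open>x powr \<beta>\<close>, with \<open>v = exp \<tau>\<close>. Since
  \<open>1 - exp (- y)\<close> is the integral of \<open>y exp (- \<theta> y)\<close> over \<open>\<theta> \<in> [0, 1]\<close>, Tonelli's theorem reduces it to
  Euler's integral.\<close>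

lemma nn_integral_subordination:
  fixes x \<beta> :: real
  assumes "0 < \<beta>" "\<beta> < 1" "x \<ge> 0"
  shows "(\<integral>\<^sup>+\<tau>. ennreal ((1 - exp (- (x * exp \<tau>))) * exp (- \<beta> * \<tau>)) \<partial>lborel) =
    ennreal (Gamma (1 - \<beta>) / \<beta> * x powr \<beta>)"
proof (cases "x = 0")
  case True
  then show ?thesis by simp
next
  case False
  with assms have x: "x > 0" by simp
  have "(\<integral>\<^sup>+\<tau>. ennreal ((1 - exp (- (x * exp \<tau>))) * exp (- \<beta> * \<tau>)) \<partial>lborel) =
    (\<integral>\<^sup>+\<tau>. ennreal (1 - exp (- (x * exp \<tau>))) * ennreal (exp (- \<beta> * \<tau>)) \<partial>lborel)"
    using x by (intro nn_integral_cong) (simp add: ennreal_mult[symmetric])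
  also have "\<dots> = (\<integral>\<^sup>+\<tau>. (\<integral>\<^sup>+\<theta>. ennreal (x * exp \<tau> * exp (- \<theta> * (x * exp \<tau>))) * indicator {0..1} \<theta> *
        ennreal (exp (- \<beta> * \<tau>)) \<partial>lborel) \<partial>lborel)"
    using x by (intro nn_integral_cong)
      (simp add: nn_integral_multc integral_exp_neg_interval[symmetric])
  also have "\<dots> = (\<integral>\<^sup>+\<theta>. (\<integral>\<^sup>+\<tau>. ennreal (x * exp \<tau> * exp (- \<theta> * (x * exp \<tau>))) * indicator {0..1} \<theta> *
        ennreal (exp (- \<beta> * \<tau>)) \<partial>lborel) \<partial>lborel)"
    by (rule lborel_pair.Fubini') measurable
  also have "\<dots> = (\<integral>\<^sup>+\<theta>. ennreal (x powr \<beta> * Gamma (1 - \<beta>)) * ennreal (\<theta> powr (\<beta> - 1) * indicator {0<..1} \<theta>) \<partial>lborel)"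
  proof (rule nn_integral_cong_AE)
    have "AE \<theta> in lborel. \<theta> \<noteq> (0::real)"
      by (rule AE_lborel_singleton)
    then show "AE \<theta> in lborel. (\<integral>\<^sup>+\<tau>. ennreal (x * exp \<tau> * exp (- \<theta> * (x * exp \<tau>))) * indicator {0..1} \<theta> *
        ennreal (exp (- \<beta> * \<tau>)) \<partial>lborel) = ennreal (x powr \<beta> * Gamma (1 - \<beta>)) * ennreal (\<theta> powr (\<beta> - 1) * indicator {0<..1} \<theta>)"
    proof eventually_elim
      case (elim \<theta>)
      show ?case
      proof (cases "\<theta> \<in> {0<..1}")
        case True
        then have \<theta>: "0 < \<theta>" "\<theta> \<le> 1" by auto
        have "(\<integral>\<^sup>+\<tau>. ennreal (x * exp \<tau> * exp (- \<theta> * (x * exp \<tau>))) * indicator {0..1} \<theta> *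
            ennreal (exp (- \<beta> * \<tau>)) \<partial>lborel) =
          (\<integral>\<^sup>+\<tau>. ennreal x * ennreal (exp ((1 - \<beta>) * \<tau>) * exp (- (\<theta> * x * exp \<tau>))) \<partial>lborel)"
          using \<theta> x by (intro nn_integral_cong)
            (simp add: ennreal_mult[symmetric] exp_diff exp_minus field_simps)
        also have "\<dots> = ennreal x * (\<integral>\<^sup>+\<tau>. ennreal (exp ((1 - \<beta>) * \<tau>) * exp (- (\<theta> * x * exp \<tau>))) \<partial>lborel)"
          by (rule nn_integral_cmult) auto
        also have "\<dots> = ennreal x * ennreal (Gamma (1 - \<beta>) * (\<theta> * x) powr - (1 - \<beta>))"
          using assms \<theta> x by (subst nn_integral_Gamma_exp) auto
        also have "x * (Gamma (1 - \<beta>) * (\<theta> * x) powr - (1 - \<beta>)) = x powr \<beta> * Gamma (1 - \<beta>) * \<theta> powr (\<beta> - 1)"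
          using \<theta> x by (simp add: powr_mult powr_diff)
        then have "ennreal x * ennreal (Gamma (1 - \<beta>) * (\<theta> * x) powr - (1 - \<beta>)) =
            ennreal (x powr \<beta> * Gamma (1 - \<beta>)) * ennreal (\<theta> powr (\<beta> - 1))"
          using assms x \<theta> by (subst (1 2) ennreal_mult[symmetric]) (auto intro!: mult_nonneg_nonneg less_imp_le)
        finally show ?thesis using True by simp
      qed (use elim in \<open>auto simp: indicator_def\<close>)
    qed
  qed
  also have "\<dots> = ennreal (x powr \<beta> * Gamma (1 - \<beta>)) * (\<integral>\<^sup>+\<theta>. ennreal (\<theta> powr (\<beta> - 1) * indicator {0<..1} \<theta>) \<partial>lborel)"
    by (rule nn_integral_cmult) auto
  also have "(\<integral>\<^sup>+\<theta>. ennreal (\<theta> powr (\<beta> - 1) * indicator {0<..1} \<theta>) \<partial>lborel) = ennreal (1 / \<beta>)"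
  proof -
    have "((\<lambda>\<theta>. \<theta> powr (\<beta> - 1)) has_integral (1 powr (\<beta> - 1 + 1) / (\<beta> - 1 + 1))) {0..1::real}"
      using assms by (intro has_integral_powr_from_0) auto
    then have "((\<lambda>\<theta>. \<theta> powr (\<beta> - 1)) has_integral (1 / \<beta>)) {0..1::real}" by simp
    then have "(\<integral>\<^sup>+\<theta>. ennreal (\<theta> powr (\<beta> - 1)) * indicator {0..1} \<theta> \<partial>lborel) = ennreal (1 / \<beta>)"
      by (intro nn_integral_has_integral_lebesgue') auto
    also have "(\<integral>\<^sup>+\<theta>. ennreal (\<theta> powr (\<beta> - 1)) * indicator {0..1} \<theta> \<partial>lborel) =
        (\<integral>\<^sup>+\<theta>. ennreal (\<theta> powr (\<beta> - 1) * indicator {0<..1::real} \<theta>) \<partial>lborel)"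
      by (intro nn_integral_cong) (auto simp: indicator_def)
    finally show ?thesis .
  qed
  finally show ?thesis
    using assms x by (simp add: ennreal_mult[symmetric] mult_ac)
qed

lemma min_one_le_exp:
  fixes y :: real
  assumes "y \<ge> 0"
  shows "min 1 y \<le> 2 * (1 - exp (- y))"
proof -
  have "exp (- y) \<le> 1 / (1 + y)"
    using exp_ge_add_one_self[of y] assms by (simp add: exp_minus field_simps)
  moreover have "min 1 y \<le> 2 * (1 - 1 / (1 + y))"
    using assms by (auto simp: min_def field_simps intro: mult_left_le_one_le)
  ultimately show ?thesis by simp
qed

lemma integrable_min_exp:
  fixes \<beta> C :: real
  assumes "0 < \<beta>" "\<beta> < 1" "C \<ge> 0"
  shows "integrable lborel (\<lambda>\<tau>. min 1 (C * exp \<tau>) * exp (- \<beta> * \<tau>))"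
proof (rule Bochner_Integration.integrable_bound)
  show "integrable lborel (\<lambda>\<tau>. 2 * ((1 - exp (- (C * exp \<tau>))) * exp (- \<beta> * \<tau>)))"
    using assms nn_integral_subordination[of \<beta> C]
    by (intro integrable_mult_right integrableI_nonneg) auto
  show "AE \<tau> in lborel. norm (min 1 (C * exp \<tau>) * exp (- \<beta> * \<tau>))
      \<le> norm (2 * ((1 - exp (- (C * exp \<tau>))) * exp (- \<beta> * \<tau>)))"
    using min_one_le_exp[of "C * exp _"] assms
    by (intro AE_I2) (auto simp: abs_mult)
qed auto

section \<open>The standard Gaussian law\<close>

text \<open>The standard Gaussian law: independent standard normal coordinates in the basis \<^const>\<open>Basis\<close>.\<close>

definition gauss :: "'a::euclidean_space measure" where
  "gauss = distr (\<Pi>\<^sub>M b\<in>Basis. std_normal_distribution) borel (\<lambda>x. \<Sum>b\<in>Basis. x b *\<^sub>R b)"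

lemma sets_gauss [measurable_cong, simp]: "sets gauss = sets borel"
  by (simp add: gauss_def)

lemma space_gauss [simp]: "space gauss = UNIV"
  by (simp add: gauss_def)

interpretation std_normal_prod: product_prob_space "\<lambda>b::'a::euclidean_space. std_normal_distribution" "Basis :: 'a set"
proof -
  have "prob_space std_normal_distribution"
    by (rule prob_space_normal_density) simp
  then show "product_prob_space (\<lambda>b::'a. std_normal_distribution)"
    by (simp add: product_prob_space_def product_prob_space_axioms_def product_sigma_finite_def
       prob_space_imp_sigma_finite)
qed

lemma gauss_measurable [measurable]:
  "(\<lambda>x. \<Sum>b\<in>Basis. x b *\<^sub>R b :: 'a::euclidean_space) \<in> borel_measurable (\<Pi>\<^sub>M b\<in>Basis. std_normal_distribution)"
  by measurable

lemma prob_space_gauss: "prob_space (gauss :: 'a::euclidean_space measure)"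
  unfolding gauss_def by (rule prob_space.prob_space_distr) (auto intro: std_normal_prod.prob_space_axioms)

text \<open>Completing the square: up to normalization, \<open>exp (- \<beta> y\<^sup>2)\<close> times the standard normal density is again
  a normal density, with standard deviation \<open>c = 1 / sqrt (1 + 2 \<beta>)\<close>.\<close>

lemma std_normal_exp_square:
  fixes \<eta> \<beta> :: real
  assumes "\<beta> \<ge> 0"
  shows "(CLINT y|std_normal_distribution. exp (\<i> * complex_of_real (\<eta> * y)) * complex_of_real (exp (- \<beta> * y\<^sup>2))) =
    complex_of_real ((1 + 2 * \<beta>) powr (- 1 / 2) * exp (- \<eta>\<^sup>2 / (2 * (1 + 2 * \<beta>))))"
proof -
  define c where "c = 1 / sqrt (1 + 2 * \<beta>)"
  have c: "c > 0" "c\<^sup>2 * (1 + 2 * \<beta>) = 1"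
    using assms by (auto simp: c_def power_divide)
  have dens: "std_normal_density (c * x) * exp (- \<beta> * (c * x)\<^sup>2) = std_normal_density x" for x
  proof -
    have "- (c * x)\<^sup>2 / 2 + - \<beta> * (c * x)\<^sup>2 = - (c\<^sup>2 * (1 + 2 * \<beta>)) * x\<^sup>2 / 2"
      by (simp add: power_mult_distrib algebra_simps)
    also have "\<dots> = - x\<^sup>2 / 2" using c(2) by simp
    finally show ?thesis
      by (simp add: normal_density_def exp_add[symmetric] del: mult_minus_left)
  qed
  have "(CLINT y|std_normal_distribution. exp (\<i> * complex_of_real (\<eta> * y)) * complex_of_real (exp (- \<beta> * y\<^sup>2))) =
     (CLINT y|lborel. std_normal_density y *\<^sub>R (exp (\<i> * complex_of_real (\<eta> * y)) * complex_of_real (exp (- \<beta> * y\<^sup>2))))"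
    by (rule integral_density) auto
  also have "\<dots> = c *\<^sub>R (CLINT x|lborel. std_normal_density (c * x) *\<^sub>R (exp (\<i> * complex_of_real (\<eta> * (c * x))) * complex_of_real (exp (- \<beta> * (c * x)\<^sup>2))))"
    using c by (subst lborel_integral_real_affine[where c=c and t=0]) auto
  also have "\<dots> = c *\<^sub>R (CLINT x|lborel. std_normal_density x *\<^sub>R exp (\<i> * complex_of_real ((\<eta> * c) * x)))"
    by (subst dens[symmetric], intro arg_cong[where f="\<lambda>x. c *\<^sub>R x"] Bochner_Integration.integral_cong)
       (auto simp: scaleR_conv_of_real mult_ac)
  also have "\<dots> = c *\<^sub>R char std_normal_distribution (\<eta> * c)"
    unfolding char_def by (subst integral_density) auto
  also have "\<dots> = complex_of_real (c * exp (- (\<eta> * c)\<^sup>2 / 2))"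
    by (simp add: char_std_normal_distribution scaleR_conv_of_real)
  also have "- (\<eta> * c)\<^sup>2 / 2 = - \<eta>\<^sup>2 / (2 * (1 + 2 * \<beta>))"
    using assms by (simp add: c_def power_mult_distrib power_divide)
  also have "c = (1 + 2 * \<beta>) powr (- 1 / 2)"
    using assms by (simp add: c_def powr_minus_divide powr_half_sqrt[symmetric])
  finally show ?thesis .
qed

lemma gauss_characteristic:
  fixes \<xi> :: "'a::euclidean_space"
  assumes "\<beta> \<ge> 0"
  shows "(CLINT x|gauss. exp (\<i> * complex_of_real (\<xi> \<bullet> x)) * complex_of_real (exp (- \<beta> * (norm x)\<^sup>2))) =
    complex_of_real ((1 + 2 * \<beta>) powr (- real DIM('a) / 2) * exp (- (norm \<xi>)\<^sup>2 / (2 * (1 + 2 * \<beta>))))"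
proof -
  let ?f = "\<lambda>b y. exp (\<i> * complex_of_real ((\<xi> \<bullet> b) * y)) * complex_of_real (exp (- \<beta> * y\<^sup>2))"
  let ?s = "\<lambda>x. \<Sum>b\<in>Basis. x b *\<^sub>R b :: 'a"
  have pw: "exp (\<i> * complex_of_real (\<xi> \<bullet> ?s x)) * complex_of_real (exp (- \<beta> * (norm (?s x))\<^sup>2)) =
      (\<Prod>b\<in>Basis. ?f b (x b))" for x
  proof -
    have 1: "\<xi> \<bullet> ?s x = (\<Sum>b\<in>Basis. (\<xi> \<bullet> b) * x b)"
      by (simp add: inner_sum_right mult.commute)
    have 2: "(norm (?s x))\<^sup>2 = (\<Sum>b\<in>Basis. (x b)\<^sup>2)"
      unfolding power2_norm_eq_inner euclidean_inner[of "?s x" "?s x"] by (simp add: power2_eq_square)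
    show ?thesis
      unfolding 1 2 by (simp add: sum_distrib_left exp_sum prod.distrib of_real_sum)
  qed
  have "(CLINT x|gauss. exp (\<i> * complex_of_real (\<xi> \<bullet> x)) * complex_of_real (exp (- \<beta> * (norm x)\<^sup>2))) =
      (CLINT x|(\<Pi>\<^sub>M b\<in>(Basis::'a set). std_normal_distribution). (\<Prod>b\<in>Basis. ?f b (x b)))"
    unfolding gauss_def pw[symmetric] by (rule integral_distr) measurable
  also have "\<dots> = (\<Prod>b\<in>(Basis::'a set). CLINT y|std_normal_distribution. ?f b y)"
  proof (rule std_normal_prod.product_integral_prod)
    fix b :: 'a
    show "integrable std_normal_distribution (?f b)"
      by (rule std_normal_prod.M.integrable_const_bound[where B=1])
        (use assms in \<open>auto simp: norm_mult\<close>)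
  qed simp
  also have "\<dots> = (\<Prod>b\<in>(Basis::'a set). complex_of_real ((1 + 2 * \<beta>) powr (- 1 / 2) * exp (- (\<xi> \<bullet> b)\<^sup>2 / (2 * (1 + 2 * \<beta>)))))"
    using assms by (intro prod.cong refl std_normal_exp_square)
  also have "\<dots> = complex_of_real (((1 + 2 * \<beta>) powr (- 1 / 2)) ^ DIM('a) * exp (\<Sum>b\<in>(Basis::'a set). - (\<xi> \<bullet> b)\<^sup>2 / (2 * (1 + 2 * \<beta>))))"
    by (simp add: prod.distrib exp_sum)
  also have "((1 + 2 * \<beta>) powr (- 1 / 2)) ^ DIM('a) = (1 + 2 * \<beta>) powr (- real DIM('a) / 2)"
    using assms by (simp add: powr_realpow[symmetric] powr_powr)
  also have "(\<Sum>b\<in>(Basis::'a set). - (\<xi> \<bullet> b)\<^sup>2 / (2 * (1 + 2 * \<beta>))) = - (norm \<xi>)\<^sup>2 / (2 * (1 + 2 * \<beta>))"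
    unfolding power2_norm_eq_inner euclidean_inner[of \<xi> \<xi>]
    by (simp add: sum_divide_distrib sum_negf power2_eq_square)
  finally show ?thesis .
qed

lemma gauss_cos_exp:
  fixes \<xi> :: "'a::euclidean_space"
  assumes "\<beta> \<ge> 0"
  shows "(LINT x|gauss. cos (\<xi> \<bullet> x) * exp (- \<beta> * (norm x)\<^sup>2)) =
    (1 + 2 * \<beta>) powr (- real DIM('a) / 2) * exp (- (norm \<xi>)\<^sup>2 / (2 * (1 + 2 * \<beta>)))"
proof -
  interpret prob_space "gauss :: 'a measure" by (rule prob_space_gauss)
  have "integrable gauss (\<lambda>x. exp (\<i> * complex_of_real (\<xi> \<bullet> x)) * complex_of_real (exp (- \<beta> * (norm x)\<^sup>2)))"
    by (rule integrable_const_bound[where B=1]) (use assms in \<open>auto simp: norm_mult\<close>)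
  from integral_Re[OF this] show ?thesis
    unfolding gauss_characteristic[OF assms]
    by (simp add: Re_exp)
qed

lemma gauss_exp:
  assumes "\<beta> \<ge> 0"
  shows "(LINT x|(gauss :: 'a::euclidean_space measure). exp (- \<beta> * (norm x)\<^sup>2)) = (1 + 2 * \<beta>) powr (- real DIM('a) / 2)"
  using gauss_cos_exp[OF assms, of "0::'a"] by simp

lemma one_minus_powr_le:
  fixes v h :: real
  assumes "v \<ge> 0" "h \<ge> 0"
  shows "0 \<le> 1 - (1 + v) powr (- h)" "1 - (1 + v) powr (- h) \<le> min 1 (h * v)"
proof -
  have "(1 + v) powr (- h) \<le> (1 + v) powr 0"
    using assms by (intro powr_mono) auto
  then show "0 \<le> 1 - (1 + v) powr (- h)" using assms by simp
  have "h * ln (1 + v) \<le> h * v"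
    using assms ln_add_one_self_le_self[of v] by (intro mult_left_mono) auto
  moreover have "1 + - h * ln (1 + v) \<le> exp (- h * ln (1 + v))"
    by (rule exp_ge_add_one_self)
  ultimately have "1 - h * v \<le> (1 + v) powr (- h)"
    using assms by (simp add: powr_def)
  then show "1 - (1 + v) powr (- h) \<le> min 1 (h * v)"
    by (simp add: min_def)
qed

section \<open>The generator on Gaussian functions\<close>

context
  fixes \<beta> s :: real and \<xi> :: "'a::euclidean_space"
  assumes \<beta>: "0 < \<beta>" "\<beta> < 1" and s: "0 \<le> s"
begin

interpretation gauss: prob_space "gauss :: 'a measure"
  by (rule prob_space_gauss)

interpretation pair: pair_sigma_finite "gauss :: 'a measure" "lborel :: real measure" ..

lemma gauss_one_minus_exp:
  "(LINT x|(gauss :: 'a measure). (1 - exp (- (2 * s * (norm x)\<^sup>2 * exp \<tau>))) * exp (- \<beta> * \<tau>)) =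
    (1 - (1 + 4 * s * exp \<tau>) powr (- real DIM('a) / 2)) * exp (- \<beta> * \<tau>)"
proof -
  have "integrable (gauss :: 'a measure) (\<lambda>x. exp (- (2 * s * exp \<tau>) * (norm x)\<^sup>2))"
    by (rule gauss.integrable_const_bound[where B=1]) (use s in auto)
  then show ?thesis
    using gauss_exp[of "2 * s * exp \<tau>", where 'a='a] s gauss.prob_space by (simp add: mult_ac)
qed

text \<open>The double integral that justifies exchanging the Gaussian average with the subordination formula.
  Integrating the Gaussian variable first, \<open>abs (cos y) \<le> 1\<close> leaves a function of order
  \<open>min 1 (exp \<tau>) exp (- \<beta> \<tau>)\<close>.\<close>

lemma integrable_gauss_subordination:
  "integrable ((gauss :: 'a measure) \<Otimes>\<^sub>M lborel)
     (\<lambda>(x, \<tau>). cos (\<xi> \<bullet> x) * ((1 - exp (- (2 * s * (norm x)\<^sup>2 * exp \<tau>))) * exp (- \<beta> * \<tau>)))"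
proof (rule Bochner_Integration.integrable_bound)
  let ?g = "\<lambda>(x::'a, \<tau>). (1 - exp (- (2 * s * (norm x)\<^sup>2 * exp \<tau>))) * exp (- \<beta> * \<tau>)"
  have nn: "0 \<le> ?g p" for p using s by (auto simp: case_prod_beta)
  have "(\<integral>\<^sup>+p. ennreal (?g p) \<partial>((gauss :: 'a measure) \<Otimes>\<^sub>M lborel)) =
      (\<integral>\<^sup>+\<tau>. (\<integral>\<^sup>+x. ennreal (?g (x, \<tau>)) \<partial>(gauss :: 'a measure)) \<partial>lborel)"
    by (rule pair.nn_integral_snd[symmetric]) measurable
  also have "\<dots> \<le> (\<integral>\<^sup>+\<tau>. ennreal (min 1 (2 * real DIM('a) * s * exp \<tau>) * exp (- \<beta> * \<tau>)) \<partial>lborel)"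
  proof (rule nn_integral_mono)
    fix \<tau> :: real
    have "integrable (gauss :: 'a measure) (\<lambda>x. ?g (x, \<tau>))"
      by (rule gauss.integrable_const_bound[where B="exp (- \<beta> * \<tau>)"])
         (use s in \<open>auto simp: abs_mult mult_le_cancel_right1\<close>)
    then have "(\<integral>\<^sup>+x. ennreal (?g (x, \<tau>)) \<partial>(gauss :: 'a measure)) = ennreal (LINT x|(gauss :: 'a measure). ?g (x, \<tau>))"
      using nn by (intro nn_integral_eq_integral) auto
    also have "(LINT x|(gauss :: 'a measure). ?g (x, \<tau>)) =
        (1 - (1 + 4 * s * exp \<tau>) powr (- (real DIM('a) / 2))) * exp (- \<beta> * \<tau>)"
      using gauss_one_minus_exp by simp
    also have "ennreal \<dots> \<le> ennreal (min 1 (2 * real DIM('a) * s * exp \<tau>) * exp (- \<beta> * \<tau>))"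
      using one_minus_powr_le(2)[of "4 * s * exp \<tau>" "real DIM('a) / 2"] s
      by (intro ennreal_leI mult_right_mono) (auto simp: mult_ac)
    finally show "(\<integral>\<^sup>+x. ennreal (?g (x, \<tau>)) \<partial>(gauss :: 'a measure)) \<le> \<dots>" .
  qed
  also have "\<dots> < \<infinity>"
    using integrable_min_exp[OF \<beta>, of "2 * real DIM('a) * s"] s
    by (auto simp: integrable_iff_bounded abs_mult)
  finally show "integrable ((gauss :: 'a measure) \<Otimes>\<^sub>M lborel) ?g"
    using nn by (intro integrableI_nonneg) auto
  show "AE p in (gauss :: 'a measure) \<Otimes>\<^sub>M lborel.
      norm (case p of (x, \<tau>) \<Rightarrow> cos (\<xi> \<bullet> x) * ((1 - exp (- (2 * s * (norm x)\<^sup>2 * exp \<tau>))) * exp (- \<beta> * \<tau>))) \<le> norm (?g p)"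
    by (intro AE_I2) (auto simp: abs_mult intro!: mult_left_le_one_le)
qed measurable

lemma subordination_integral:
  assumes "y \<ge> 0"
  shows "(LINT \<tau>|lborel. (1 - exp (- (y * exp \<tau>))) * exp (- \<beta> * \<tau>)) = Gamma (1 - \<beta>) / \<beta> * y powr \<beta>"
  using nn_integral_subordination[OF \<beta> assms] assms \<beta>
  by (intro integral_eq_nn_integral[THEN trans]) auto

lemma
  shows integrable_gauss_powr: "integrable (gauss :: 'a measure) (\<lambda>x. cos (\<xi> \<bullet> x) * (2 * s * (norm x)\<^sup>2) powr \<beta>)"
    and integral_gauss_powr:
      "(LINT x|gauss. - (cos (\<xi> \<bullet> x) * (2 * s * (norm x)\<^sup>2) powr \<beta>)) =
        \<beta> / Gamma (1 - \<beta>) * (LINT \<tau>|lborel. ((1 + 4 * s * exp \<tau>) powr (- real DIM('a) / 2) *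
         exp (- (norm \<xi>)\<^sup>2 / (2 * (1 + 4 * s * exp \<tau>))) - exp (- (norm \<xi>)\<^sup>2 / 2)) * exp (- \<beta> * \<tau>))"
proof -
  let ?f = "\<lambda>x \<tau>. cos (\<xi> \<bullet> x) * ((1 - exp (- (2 * s * (norm x)\<^sup>2 * exp \<tau>))) * exp (- \<beta> * \<tau>))"
  let ?D = "\<lambda>\<tau>. (1 + 4 * s * exp \<tau>) powr (- real DIM('a) / 2) *
         exp (- (norm \<xi>)\<^sup>2 / (2 * (1 + 4 * s * exp \<tau>))) - exp (- (norm \<xi>)\<^sup>2 / 2)"
  note int = integrable_gauss_subordination
  have G: "Gamma (1 - \<beta>) > 0" using \<beta> by (intro Gamma_real_pos) auto
  have rearrange: "- I = \<beta> / Gamma (1 - \<beta>) * L" if "Gamma (1 - \<beta>) / \<beta> * I = - L" for I L :: real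
  proof -
    have "I = \<beta> / Gamma (1 - \<beta>) * (Gamma (1 - \<beta>) / \<beta> * I)"
      using less_imp_neq[OF G] \<beta> by simp
    also have "\<dots> = - (\<beta> / Gamma (1 - \<beta>) * L)"
      unfolding that by simp
    finally show ?thesis by simp
  qed
  have inner1: "(LINT \<tau>|lborel. ?f x \<tau>) = cos (\<xi> \<bullet> x) * (Gamma (1 - \<beta>) / \<beta> * (2 * s * (norm x)\<^sup>2) powr \<beta>)" for x :: 'a
    using subordination_integral[of "2 * s * (norm x)\<^sup>2"] s by simp
  have inner2: "(LINT x|gauss. ?f x \<tau>) = - (?D \<tau> * exp (- \<beta> * \<tau>))" for \<tau>
  proof -
    have i1: "integrable (gauss :: 'a measure) (\<lambda>x. cos (\<xi> \<bullet> x) * exp (- (2 * s * exp \<tau>) * (norm x)\<^sup>2))"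
      and i2: "integrable (gauss :: 'a measure) (\<lambda>x. cos (\<xi> \<bullet> x))"
      by (rule gauss.integrable_const_bound[where B=1];
          use s in \<open>auto simp: abs_mult intro!: AE_I2 mult_le_one\<close>)+
    have f_eq: "?f x \<tau> = (cos (\<xi> \<bullet> x) - cos (\<xi> \<bullet> x) * exp (- (2 * s * exp \<tau>) * (norm x)\<^sup>2)) * exp (- \<beta> * \<tau>)" for x :: 'a
      by (simp add: algebra_simps)
    have "(LINT x|gauss. ?f x \<tau>) = ((LINT x|gauss. cos (\<xi> \<bullet> x)) -
        (LINT x|gauss. cos (\<xi> \<bullet> x) * exp (- (2 * s * exp \<tau>) * (norm x)\<^sup>2))) * exp (- \<beta> * \<tau>)"
      unfolding f_eq using i1 i2 by (subst integral_mult_left_zero) (simp only: Bochner_Integration.integral_diff)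
    moreover have "(LINT x|gauss. cos (\<xi> \<bullet> x)) = exp (- (norm \<xi>)\<^sup>2 / 2)"
      using gauss_cos_exp[of 0 \<xi>] by simp
    moreover have "(LINT x|gauss. cos (\<xi> \<bullet> x) * exp (- (2 * s * exp \<tau>) * (norm x)\<^sup>2)) =
        (1 + 4 * s * exp \<tau>) powr (- real DIM('a) / 2) * exp (- (norm \<xi>)\<^sup>2 / (2 * (1 + 4 * s * exp \<tau>)))"
      using gauss_cos_exp[of "2 * s * exp \<tau>" \<xi>] s by (simp add: mult.assoc)
    ultimately show ?thesis by (simp add: algebra_simps)
  qed
  have "integrable (gauss :: 'a measure) (\<lambda>x. LINT \<tau>|lborel. ?f x \<tau>)"
    using pair.integrable_fst[OF int] by simp
  then have "integrable (gauss :: 'a measure) (\<lambda>x. \<beta> / Gamma (1 - \<beta>) * (LINT \<tau>|lborel. ?f x \<tau>))"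
    by simp
  then show "integrable (gauss :: 'a measure) (\<lambda>x. cos (\<xi> \<bullet> x) * (2 * s * (norm x)\<^sup>2) powr \<beta>)"
    unfolding inner1 using G \<beta> by (simp add: field_simps)
  have "(LINT x|gauss. LINT \<tau>|lborel. ?f x \<tau>) = (LINT \<tau>|lborel. LINT x|gauss. ?f x \<tau>)"
    using pair.Fubini_integral[OF int] by simp
  then have "Gamma (1 - \<beta>) / \<beta> * (LINT x|gauss. (cos (\<xi> \<bullet> x) * (2 * s * (norm x)\<^sup>2) powr \<beta>)) =
      - (LINT \<tau>|lborel. ?D \<tau> * exp (- \<beta> * \<tau>))"
    unfolding inner1 inner2 by (subst integral_mult_right_zero[symmetric]) (simp add: mult_ac)
  then show "(LINT x|gauss. - (cos (\<xi> \<bullet> x) * (2 * s * (norm x)\<^sup>2) powr \<beta>)) =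
      \<beta> / Gamma (1 - \<beta>) * (LINT \<tau>|lborel. ?D \<tau> * exp (- \<beta> * \<tau>))"
    using rearrange by simp
qed

end

text \<open>The difference quotient is a Gaussian average, dominated by \<open>(2 * s * (norm x)\<^sup>2) powr \<beta>\<close>. By
  \<open>integral_gauss_powr\<close> its limit is an integral over \<open>\<tau>\<close>.\<close>

lemma gauss_short_time:
  fixes \<beta> s :: real and \<xi> :: "'a::euclidean_space"
  assumes \<beta>: "0 < \<beta>" "\<beta> < 1" and s: "0 \<le> s"
  shows "((\<lambda>t. ((LINT x|gauss. cos (\<xi> \<bullet> x) * exp (- t * (2 * s * (norm x)\<^sup>2) powr \<beta>)) - exp (- (norm \<xi>)\<^sup>2 / 2)) / t)
     \<longlongrightarrow> \<beta> / Gamma (1 - \<beta>) * (LINT \<tau>|lborel. ((1 + 4 * s * exp \<tau>) powr (- real DIM('a) / 2) *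
         exp (- (norm \<xi>)\<^sup>2 / (2 * (1 + 4 * s * exp \<tau>))) - exp (- (norm \<xi>)\<^sup>2 / 2)) * exp (- \<beta> * \<tau>))) (at_right 0)"
proof (rule tendsto_at_right_sequentially[of 0 1])
  interpret gauss: prob_space "gauss :: 'a measure"
    by (rule prob_space_gauss)
  fix S :: "nat \<Rightarrow> real"
  assume S: "\<And>n. 0 < S n" "S \<longlonglongrightarrow> 0"
  define Y where "Y x = (2 * s * (norm x)\<^sup>2) powr \<beta>" for x :: 'a
  have [measurable]: "Y \<in> borel_measurable borel" unfolding Y_def by measurable
  have Y0: "Y x \<ge> 0" for x by (simp add: Y_def)
  have i2: "integrable (gauss :: 'a measure) (\<lambda>x. cos (\<xi> \<bullet> x))"
    by (rule gauss.integrable_const_bound[where B=1]) auto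
  have i1: "integrable (gauss :: 'a measure) (\<lambda>x. cos (\<xi> \<bullet> x) * exp (- S n * Y x))" for n
    by (rule gauss.integrable_const_bound[where B=1])
      (use S Y0 in \<open>auto simp: abs_mult less_imp_le intro!: mult_le_one\<close>)
  have eq: "((LINT x|gauss. cos (\<xi> \<bullet> x) * exp (- S n * Y x)) - exp (- (norm \<xi>)\<^sup>2 / 2)) / S n =
      (LINT x|gauss. cos (\<xi> \<bullet> x) * ((exp (- S n * Y x) - 1) / S n))" for n
  proof -
    have "exp (- (norm \<xi>)\<^sup>2 / 2) = (LINT x|gauss. cos (\<xi> \<bullet> x))"
      using gauss_cos_exp[of 0 \<xi>] by simp
    then have "((LINT x|gauss. cos (\<xi> \<bullet> x) * exp (- S n * Y x)) - exp (- (norm \<xi>)\<^sup>2 / 2)) / S n =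
        (LINT x|gauss. (cos (\<xi> \<bullet> x) * exp (- S n * Y x) - cos (\<xi> \<bullet> x)) / S n)"
      using i1 i2 by simp
    then show ?thesis by (simp add: algebra_simps)
  qed
  have "(\<lambda>n. LINT x|gauss. cos (\<xi> \<bullet> x) * ((exp (- S n * Y x) - 1) / S n)) \<longlonglongrightarrow> (LINT x|gauss. - (cos (\<xi> \<bullet> x) * Y x))"
  proof (rule integral_dominated_convergence)
    show "integrable (gauss :: 'a measure) Y"
      using integrable_gauss_powr[OF \<beta> s, of "0 :: 'a"] by (simp add: Y_def[abs_def])
    show "AE x in gauss. (\<lambda>n. cos (\<xi> \<bullet> x) * ((exp (- S n * Y x) - 1) / S n)) \<longlonglongrightarrow> - (cos (\<xi> \<bullet> x) * Y x)"
    proof (intro AE_I2)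
      fix x :: 'a
      have "((\<lambda>t. exp (- t * Y x)) has_real_derivative - Y x) (at 0)"
        by (auto intro!: derivative_eq_intros)
      then have "((\<lambda>t. (exp (- t * Y x) - 1) / t) \<longlongrightarrow> - Y x) (at 0)"
        by (simp add: has_field_derivative_iff)
      moreover have "filterlim S (at 0) sequentially"
        using S by (auto simp: filterlim_at intro!: always_eventually less_imp_neq[THEN not_sym])
      ultimately have "(\<lambda>n. (exp (- S n * Y x) - 1) / S n) \<longlonglongrightarrow> - Y x"
        by (rule filterlim_compose)
      from tendsto_mult_left[OF this, of "cos (\<xi> \<bullet> x)"]
      show "(\<lambda>n. cos (\<xi> \<bullet> x) * ((exp (- S n * Y x) - 1) / S n)) \<longlonglongrightarrow> - (cos (\<xi> \<bullet> x) * Y x)"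
        by simp
    qed
    fix n
    show "AE x in gauss. norm (cos (\<xi> \<bullet> x) * ((exp (- S n * Y x) - 1) / S n)) \<le> Y x"
    proof (intro AE_I2)
      fix x :: 'a
      have "1 + - S n * Y x \<le> exp (- S n * Y x)" by (rule exp_ge_add_one_self)
      moreover have "exp (- S n * Y x) \<le> 1" using S(1)[of n] Y0[of x] by simp
      ultimately have "\<bar>(exp (- S n * Y x) - 1) / S n\<bar> \<le> Y x"
        using S(1)[of n] by (simp add: abs_if field_simps)
      then have "\<bar>cos (\<xi> \<bullet> x)\<bar> * \<bar>(exp (- S n * Y x) - 1) / S n\<bar> \<le> 1 * Y x"
        by (intro mult_mono) auto
      then show "norm (cos (\<xi> \<bullet> x) * ((exp (- S n * Y x) - 1) / S n)) \<le> Y x"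
        by (simp add: abs_mult)
    qed
  qed measurable
  then show "(\<lambda>n. ((LINT x|gauss. cos (\<xi> \<bullet> x) * exp (- S n * (2 * s * (norm x)\<^sup>2) powr \<beta>)) - exp (- (norm \<xi>)\<^sup>2 / 2)) / S n)
     \<longlonglongrightarrow> \<beta> / Gamma (1 - \<beta>) * (LINT \<tau>|lborel. ((1 + 4 * s * exp \<tau>) powr (- real DIM('a) / 2) *
         exp (- (norm \<xi>)\<^sup>2 / (2 * (1 + 4 * s * exp \<tau>))) - exp (- (norm \<xi>)\<^sup>2 / 2)) * exp (- \<beta> * \<tau>))"
    unfolding integral_gauss_powr[OF \<beta> s, symmetric] Y_def[symmetric] eq .
qed auto

text \<open>In dimension \<open>2 h\<close>, let \<open>f w = exp (- s (norm w)\<^sup>2)\<close> and \<open>norm z = a\<close>, and put \<open>\<theta> = s a\<^sup>2\<close>. Then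
  \<open>gauss_diff h \<theta> \<tau>\<close> is the heat semigroup at time \<open>a\<^sup>2 exp \<tau> / 4\<close>, applied to \<open>f\<close> at \<open>z\<close>, minus \<open>f z\<close>. The heat
  semigroup is the one generated by the Laplacian.\<close>

definition gauss_diff :: "real \<Rightarrow> real \<Rightarrow> real \<Rightarrow> real" where
  "gauss_diff h \<theta> \<tau> = (1 + \<theta> * exp \<tau>) powr (- h) * exp (- \<theta> / (1 + \<theta> * exp \<tau>)) - exp (- \<theta>)"

context
  fixes \<alpha> :: real
    and P :: "'a::euclidean_space \<Rightarrow> 'w measure"
    and Z :: "real \<Rightarrow> 'w \<Rightarrow> 'a"
  assumes stable: "symmetric_stable_process \<alpha> P Z"
begin

lemma stable_prob_space: "prob_space (P z)"
  using stable by (simp add: symmetric_stable_process_def levy_process_def)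

lemma stable_measurable:
  assumes "t \<ge> 0"
  shows "Z t \<in> borel_measurable (P z)"
proof -
  have "(\<lambda>\<omega>. Z t \<omega> - z) \<in> borel_measurable (P z)"
    using stable assms by (simp add: symmetric_stable_process_def levy_process_def)
  then have "(\<lambda>\<omega>. (Z t \<omega> - z) + z) \<in> borel_measurable (P z)"
    by measurable
  then show ?thesis by simp
qed

lemma stable_translation:
  fixes f :: "'a \<Rightarrow> real"
  assumes t: "t \<ge> 0" and [measurable]: "f \<in> borel_measurable borel"
  shows "(LINT \<omega>|P z. f (Z t \<omega>)) = (LINT \<omega>|P 0. f (z + Z t \<omega>))"
proof -
  let ?M = "Pi\<^sub>M {0..} (\<lambda>_. borel) :: (real \<Rightarrow> 'a) measure"
  have m: "(\<lambda>\<omega>. \<lambda>t\<in>{0..}. Z t \<omega>) \<in> measurable (P z) ?M"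
    by (rule measurable_restrict) (auto intro: stable_measurable)
  have m0: "(\<lambda>\<omega>. \<lambda>t\<in>{0..}. z + Z t \<omega>) \<in> measurable (P 0) ?M"
    using stable_measurable[of _ 0] by (intro measurable_restrict) auto
  have p: "(\<lambda>x. f (x t)) \<in> borel_measurable ?M"
    by (rule measurable_compose[OF measurable_component_singleton]) (use t in auto)
  have "(LINT \<omega>|P z. f (Z t \<omega>)) = (LINT x|distr (P z) ?M (\<lambda>\<omega>. \<lambda>t\<in>{0..}. Z t \<omega>). f (x t))"
    using t by (simp add: integral_distr[OF m p])
  also have "distr (P z) ?M (\<lambda>\<omega>. \<lambda>t\<in>{0..}. Z t \<omega>) = distr (P 0) ?M (\<lambda>\<omega>. \<lambda>t\<in>{0..}. z + Z t \<omega>)"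
    using stable unfolding symmetric_stable_process_def by blast
  also have "(LINT x|\<dots>. f (x t)) = (LINT \<omega>|P 0. f (z + Z t \<omega>))"
    using t by (simp add: integral_distr[OF m0 p])
  finally show ?thesis .
qed

lemma stable_cos:
  assumes t: "t \<ge> 0"
  shows "(LINT \<omega>|P 0. cos (\<theta> + \<xi> \<bullet> Z t \<omega>)) = cos \<theta> * exp (- t * norm \<xi> powr \<alpha>)"
proof -
  interpret prob_space "P 0" by (rule stable_prob_space)
  note [measurable] = stable_measurable[OF t, of 0]
  have int: "integrable (P 0) (\<lambda>\<omega>. exp (\<i> * complex_of_real (\<xi> \<bullet> Z t \<omega>)))"
    by (rule integrable_const_bound[where B=1]) auto
  have ch: "(LINT \<omega>|P 0. exp (\<i> * complex_of_real (\<xi> \<bullet> Z t \<omega>))) = complex_of_real (exp (- t * norm \<xi> powr \<alpha>))"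
    using stable t unfolding symmetric_stable_process_def by blast
  have c: "(LINT \<omega>|P 0. cos (\<xi> \<bullet> Z t \<omega>)) = exp (- t * norm \<xi> powr \<alpha>)"
    using integral_Re[OF int] by (simp add: ch Re_exp)
  have s: "(LINT \<omega>|P 0. sin (\<xi> \<bullet> Z t \<omega>)) = 0"
    using integral_Im[OF int] by (simp add: ch Im_exp)
  have "integrable (P 0) (\<lambda>\<omega>. cos (\<xi> \<bullet> Z t \<omega>))" "integrable (P 0) (\<lambda>\<omega>. sin (\<xi> \<bullet> Z t \<omega>))"
    by (rule integrable_const_bound[where B=1]; auto)+
  then show ?thesis
    using c s by (simp add: cos_add)
qed

lemma stable_gaussian:
  assumes t: "t \<ge> 0" and s: "s \<ge> 0"
  shows "(LINT \<omega>|P z. exp (- s * (norm (Z t \<omega>))\<^sup>2)) =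
    (LINT x|gauss. cos ((sqrt (2 * s) *\<^sub>R z) \<bullet> x) * exp (- t * (2 * s * (norm x)\<^sup>2) powr (\<alpha> / 2)))"
proof -
  interpret P0: prob_space "P 0" by (rule stable_prob_space)
  interpret gauss: prob_space "gauss :: 'a measure" by (rule prob_space_gauss)
  interpret pair: pair_prob_space "P 0" "gauss :: 'a measure" ..
  note [measurable] = stable_measurable[OF t, of 0]
  let ?f = "\<lambda>\<omega> x. cos ((sqrt (2 * s) *\<^sub>R z) \<bullet> x + (sqrt (2 * s) *\<^sub>R x) \<bullet> Z t \<omega>)"
  have int: "integrable (P 0 \<Otimes>\<^sub>M (gauss :: 'a measure)) (\<lambda>(\<omega>, x). ?f \<omega> x)"
    by (rule pair.P.integrable_const_bound[where B=1]) auto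
  have G: "exp (- s * (norm (z + Z t \<omega>))\<^sup>2) = (LINT x|gauss. ?f \<omega> x)" for \<omega>
  proof -
    let ?w = "z + Z t \<omega>"
    have 1: "(sqrt (2 * s) *\<^sub>R ?w) \<bullet> x = (sqrt (2 * s) *\<^sub>R z) \<bullet> x + (sqrt (2 * s) *\<^sub>R x) \<bullet> Z t \<omega>" for x :: 'a
      by (simp only: inner_scaleR_left inner_add_left distrib_left inner_commute[of x "Z t \<omega>"])
    have 2: "(norm (sqrt (2 * s) *\<^sub>R ?w))\<^sup>2 = 2 * s * (norm ?w)\<^sup>2"
      using s by (simp add: power_mult_distrib)
    show ?thesis
      using gauss_cos_exp[of 0 "sqrt (2 * s) *\<^sub>R ?w"] unfolding 1 2 by simp
  qed
  have pw: "norm (sqrt (2 * s) *\<^sub>R x) powr \<alpha> = (2 * s * (norm x)\<^sup>2) powr (\<alpha> / 2)" for x :: 'a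
  proof (cases "sqrt (2 * s) *\<^sub>R x = 0")
    case True
    then show ?thesis using s by auto
  next
    case False
    have "2 * s * (norm x)\<^sup>2 = (norm (sqrt (2 * s) *\<^sub>R x))\<^sup>2"
      using s by (simp add: power_mult_distrib)
    also have "\<dots> = (norm (sqrt (2 * s) *\<^sub>R x)) powr 2"
      using False by (simp del: norm_scaleR)
    finally have "(2 * s * (norm x)\<^sup>2) powr (\<alpha> / 2) = norm (sqrt (2 * s) *\<^sub>R x) powr (2 * (\<alpha> / 2))"
      by (simp only: powr_powr)
    then show ?thesis by simp
  qed
  have "(LINT \<omega>|P z. exp (- s * (norm (Z t \<omega>))\<^sup>2)) = (LINT \<omega>|P 0. exp (- s * (norm (z + Z t \<omega>))\<^sup>2))"
    by (rule stable_translation[OF t]) measurable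
  also have "\<dots> = (LINT \<omega>|P 0. LINT x|gauss. ?f \<omega> x)"
    unfolding G ..
  also have "\<dots> = (LINT x|gauss. LINT \<omega>|P 0. ?f \<omega> x)"
    using pair.Fubini_integral[OF int] by simp
  also have "\<dots> = (LINT x|gauss. cos ((sqrt (2 * s) *\<^sub>R z) \<bullet> x) * exp (- t * (2 * s * (norm x)\<^sup>2) powr (\<alpha> / 2)))"
    unfolding stable_cos[OF t] pw ..
  finally show ?thesis .
qed

text \<open>The time of \<open>gauss_short_time\<close> is shifted by \<open>ln (a\<^sup>2 / 4)\<close>, which produces the factor
  \<open>a powr (- \<alpha>) * 2 powr \<alpha>\<close> and leaves an integrand that depends on \<open>s\<close> and \<open>a\<close> through \<open>s a\<^sup>2\<close> only.\<close>

lemma stable_generator_gaussian: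
  assumes \<alpha>: "0 < \<alpha>" "\<alpha> < 2" and s: "s \<ge> 0" and z: "norm z = a" "a > 0"
  shows "((\<lambda>t. ((LINT \<omega>|P z. exp (- s * (norm (Z t \<omega>))\<^sup>2)) - exp (- s * a\<^sup>2)) / t) \<longlongrightarrow>
    a powr (- \<alpha>) * (2 powr \<alpha> * (\<alpha> / 2) / Gamma (1 - \<alpha> / 2)) *
      (LINT \<tau>|lborel. gauss_diff (real DIM('a) / 2) (s * a\<^sup>2) \<tau> * exp (- (\<alpha> / 2) * \<tau>))) (at_right 0)"
proof -
  define \<beta> where "\<beta> = \<alpha> / 2"
  define L where "L = ln (a\<^sup>2 / 4)"
  have eL: "exp L = a\<^sup>2 / 4" using z by (simp add: L_def)
  have n: "(norm (sqrt (2 * s) *\<^sub>R z))\<^sup>2 = 2 * s * a\<^sup>2"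
    using z s by (simp add: power_mult_distrib)
  let ?h = "real DIM('a) / 2"
  let ?D = "\<lambda>\<tau>. ((1 + 4 * s * exp \<tau>) powr (- real DIM('a) / 2) *
         exp (- (2 * s * a\<^sup>2) / (2 * (1 + 4 * s * exp \<tau>))) - exp (- (2 * s * a\<^sup>2) / 2)) * exp (- \<beta> * \<tau>)"
  have lim: "((\<lambda>t. ((LINT x|gauss. cos ((sqrt (2 * s) *\<^sub>R z) \<bullet> x) * exp (- t * (2 * s * (norm x)\<^sup>2) powr \<beta>)) - exp (- (2 * s * a\<^sup>2) / 2)) / t)
     \<longlongrightarrow> \<beta> / Gamma (1 - \<beta>) * (LINT \<tau>|lborel. ?D \<tau>)) (at_right 0)"
    using gauss_short_time[of \<beta> s "sqrt (2 * s) *\<^sub>R z"] \<alpha> s unfolding n by (simp add: \<beta>_def)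
  have D: "?D (L + 1 * \<tau>) = a powr (- \<alpha>) * 2 powr \<alpha> * (gauss_diff ?h (s * a\<^sup>2) \<tau> * exp (- \<beta> * \<tau>))" for \<tau>
  proof -
    have e: "exp (L + \<tau>) = a\<^sup>2 / 4 * exp \<tau>" by (simp add: exp_add eL)
    have L: "L = 2 * ln a - 2 * ln 2"
      using z ln_realpow[of 2 2] by (simp add: L_def ln_div ln_realpow)
    have "- \<beta> * (L + 1 * \<tau>) = - \<alpha> * ln a + \<alpha> * ln 2 + - \<beta> * \<tau>"
      unfolding L \<beta>_def by (simp add: field_simps)
    then have "exp (- \<beta> * (L + 1 * \<tau>)) = a powr (- \<alpha>) * 2 powr \<alpha> * exp (- \<beta> * \<tau>)"
      using z by (simp only: exp_add powr_def) simp
    moreover have "(1 + 4 * s * exp (L + 1 * \<tau>)) powr (- real DIM('a) / 2) *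
         exp (- (2 * s * a\<^sup>2) / (2 * (1 + 4 * s * exp (L + 1 * \<tau>)))) - exp (- (2 * s * a\<^sup>2) / 2) =
         gauss_diff ?h (s * a\<^sup>2) \<tau>"
    proof -
      have "4 * s * exp (L + 1 * \<tau>) = s * a\<^sup>2 * exp \<tau>" by (simp add: e)
      moreover have "- (2 * s * a\<^sup>2) / (2 * (1 + s * a\<^sup>2 * exp \<tau>)) = - (s * a\<^sup>2) / (1 + s * a\<^sup>2 * exp \<tau>)"
        using mult_divide_mult_cancel_left[of 2 "- (s * a\<^sup>2)" "1 + s * a\<^sup>2 * exp \<tau>"]
        by (simp only: mult_minus_right mult.assoc)
      ultimately show ?thesis
        unfolding gauss_diff_def by (simp only:) simp
    qed
    ultimately show ?thesis
      by (simp only: mult_ac)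
  qed
  have "(LINT \<tau>|lborel. ?D \<tau>) = (LINT \<tau>|lborel. ?D (L + 1 * \<tau>))"
    by (subst lborel_integral_real_affine[where c=1 and t=L]) (simp, simp only: abs_one scaleR_one)
  also have "\<dots> = a powr (- \<alpha>) * 2 powr \<alpha> * (LINT \<tau>|lborel. gauss_diff ?h (s * a\<^sup>2) \<tau> * exp (- \<beta> * \<tau>))"
    unfolding D by (rule integral_mult_right_zero)
  finally have I: "\<beta> / Gamma (1 - \<beta>) * (LINT \<tau>|lborel. ?D \<tau>) =
      a powr (- \<alpha>) * (2 powr \<alpha> * \<beta> / Gamma (1 - \<beta>)) *
       (LINT \<tau>|lborel. gauss_diff ?h (s * a\<^sup>2) \<tau> * exp (- \<beta> * \<tau>))"
    by (simp only: times_divide_eq_left times_divide_eq_right mult_ac)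
  have S: "- (2 * s * a\<^sup>2) / 2 = - s * a\<^sup>2" by simp
  note lim[unfolded I, unfolded S]
  moreover have "\<forall>\<^sub>F t in at_right 0. ((LINT x|gauss. cos ((sqrt (2 * s) *\<^sub>R z) \<bullet> x) * exp (- t * (2 * s * (norm x)\<^sup>2) powr \<beta>)) - exp (- s * a\<^sup>2)) / t =
      ((LINT \<omega>|P z. exp (- s * (norm (Z t \<omega>))\<^sup>2)) - exp (- s * a\<^sup>2)) / t"
    using eventually_at_right_less[of "0::real"]
    by eventually_elim (simp only: stable_gaussian[OF less_imp_le s] \<beta>_def)
  ultimately show ?thesis
    unfolding \<beta>_def by (rule Lim_transform_eventually)
qed

end

section \<open>The subordinated Bessel kernel\<close>

text \<open>The bound \<open>1\<close> holds because \<open>gauss_diff\<close> is a difference of two numbers in \<open>[0, 1]\<close>. For the other one, with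
  \<open>v = \<theta> exp \<tau>\<close>, the factor \<open>(1 + v) powr (- h)\<close> costs at most \<open>h v\<close>, and replacing \<open>\<theta> / (1 + v)\<close> by \<open>\<theta>\<close> in the
  exponent costs at most \<open>\<theta> v\<close>.\<close>

lemma abs_gauss_diff_le:
  assumes "h \<ge> 0" "\<theta> \<ge> 0"
  shows "\<bar>gauss_diff h \<theta> \<tau>\<bar> \<le> min 1 ((\<theta>\<^sup>2 + h * \<theta>) * exp \<tau>)"
proof -
  define v where "v = \<theta> * exp \<tau>"
  define p where "p = (1 + v) powr (- h)"
  have v: "v \<ge> 0" using assms by (simp add: v_def)
  have p: "0 \<le> 1 - p" "1 - p \<le> h * v" "0 \<le> p"
    using one_minus_powr_le[OF v assms(1)] by (auto simp: p_def)
  define q where "q = exp (- \<theta> / (1 + v))"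
  have q1: "q \<le> 1" and q0: "q \<ge> 0" and th1: "exp (- \<theta>) \<le> 1" using assms v by (auto simp: q_def)
  have le: "- \<theta> \<le> - \<theta> / (1 + v)"
    using assms v divide_left_mono[of 1 "1 + v" \<theta>] by simp
  then have qth: "exp (- \<theta>) \<le> q" by (simp add: q_def)
  have "q - exp (- \<theta>) \<le> \<theta>\<^sup>2 * exp \<tau>"
  proof -
    have "exp (- \<theta>) = q * exp (- \<theta> + \<theta> / (1 + v))"
      by (simp add: q_def exp_add[symmetric])
    moreover have "exp (- \<theta> + \<theta> / (1 + v)) \<ge> 1 + (- \<theta> + \<theta> / (1 + v))"
      by (rule exp_ge_add_one_self)
    ultimately have "q - exp (- \<theta>) \<le> q * (\<theta> - \<theta> / (1 + v))"
      using q0 mult_left_mono[of "1 + (- \<theta> + \<theta> / (1 + v))" "exp (- \<theta> + \<theta> / (1 + v))" q]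
      by (simp add: algebra_simps)
    also have "\<dots> \<le> 1 * (\<theta> - \<theta> / (1 + v))"
      using le q1 by (intro mult_right_mono) auto
    also have "\<theta> - \<theta> / (1 + v) = \<theta> * v / (1 + v)"
      using v by (simp add: divide_simps algebra_simps)
    also have "1 * (\<theta> * v / (1 + v)) \<le> \<theta> * v"
      using assms v divide_left_mono[of 1 "1 + v" "\<theta> * v"] by simp
    finally show ?thesis by (simp add: v_def power2_eq_square mult_ac)
  qed
  then have diff: "0 \<le> q - exp (- \<theta>)" "q - exp (- \<theta>) \<le> \<theta>\<^sup>2 * exp \<tau>" using qth by auto
  have eq: "gauss_diff h \<theta> \<tau> = p * q - exp (- \<theta>)"
    by (simp add: gauss_diff_def p_def q_def v_def)
  have pq: "p * q \<le> q" using mult_right_mono[of p 1 q] p q0 by simp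
  have pq2: "q - p * q \<le> h * v"
  proof -
    have "q - p * q = q * (1 - p)" by (simp add: algebra_simps)
    also have "\<dots> \<le> 1 * (1 - p)" using p q1 by (intro mult_right_mono) auto
    finally show ?thesis using p by simp
  qed
  have "0 \<le> p * q" using p q0 by simp
  then have one: "\<bar>gauss_diff h \<theta> \<tau>\<bar> \<le> 1" using pq q1 th1 exp_gt_zero[of "- \<theta>"] unfolding eq by linarith
  have "h * v \<ge> 0" "\<theta>\<^sup>2 * exp \<tau> \<ge> 0" using assms v by auto
  then have "\<bar>gauss_diff h \<theta> \<tau>\<bar> \<le> \<theta>\<^sup>2 * exp \<tau> + h * v"
    using diff pq pq2 unfolding eq by linarith
  also have "\<dots> = (\<theta>\<^sup>2 + h * \<theta>) * exp \<tau>" by (simp add: v_def algebra_simps)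
  finally show ?thesis using one by simp
qed

text \<open>Half the dimension \<open>h\<close> and half the stability index \<open>\<beta>\<close>. No integrality of \<open>2 h\<close> is needed for the kernel.\<close>

locale subordinated_bessel =
  fixes h \<beta> :: real
  assumes h: "h > 0" and \<beta>: "0 < \<beta>" "\<beta> < 1"
begin

text \<open>The power series with coefficients \<open>coef\<close> is entire; it is, up to scaling of the argument and a factor 2, a modified Bessel
  function of order \<open>h - 1\<close> divided by its leading power.\<close>

definition coef :: "nat \<Rightarrow> real" where
  "coef k = 2 / (fact k * Gamma (h + real k))"

lemma Gamma_pos: "Gamma (h + real k) > 0"
  using h by (intro Gamma_real_pos) auto

lemma coef_pos: "coef k > 0"
  using Gamma_pos by (simp add: coef_def)

lemma coef_Suc: "coef (Suc k) * ((real k + 1) * (h + real k)) = coef k"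
proof -
  have "Gamma (h + real (Suc k)) = (h + real k) * Gamma (h + real k)"
    using Gamma_plus1[of "h + real k"] h by (auto simp: add_ac nonpos_Ints_def)
  then show ?thesis
    using h Gamma_pos[of k] by (simp add: coef_def) (simp add: divide_simps)
qed

lemma summable_coef: "summable (\<lambda>k. coef k * y ^ k)"
proof -
  obtain N :: nat where N: "max 1 (2 * \<bar>y\<bar>) \<le> real N" using real_arch_simple by blast
  show ?thesis
  proof (rule summable_ratio_test[where c="1/2" and N=N])
    fix k assume k: "N \<le> k"
    then have k': "real k \<ge> 1" "real k \<ge> 2 * \<bar>y\<bar>" using N by auto
    have "2 * \<bar>y\<bar> * 1 \<le> (h + real k) * (real k + 1)"
      using k' h by (intro mult_mono) auto
    then have "2 * \<bar>y\<bar> * coef (Suc k) \<le> (real k + 1) * (h + real k) * coef (Suc k)"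
      using coef_pos[of "Suc k"] by (intro mult_right_mono) (auto simp: mult_ac)
    also have "\<dots> = coef k" using coef_Suc[of k] by (simp add: mult_ac)
    finally have "coef (Suc k) * \<bar>y\<bar> \<le> coef k / 2" by (simp add: mult_ac)
    then have "(coef (Suc k) * \<bar>y\<bar>) * \<bar>y\<bar> ^ k \<le> (coef k / 2) * \<bar>y\<bar> ^ k"
      by (intro mult_right_mono) auto
    then show "norm (coef (Suc k) * y ^ Suc k) \<le> 1 / 2 * norm (coef k * y ^ k)"
      using coef_pos[of k] coef_pos[of "Suc k"] by (simp add: abs_mult power_abs mult_ac)
  qed simp
qed

text \<open>The transition density \<open>p\<close> of the radial part of the heat flow, started from radius 1 and taken at time
  \<open>exp \<tau> / 4\<close>, satisfies \<open>p (exp u) exp u exp (- \<beta> \<tau>) = kern \<tau> u\<close>. The definition displays how it depends on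
  \<open>\<tau> - u\<close> and \<open>u\<close>: the factor \<open>exp ((h - \<beta>) * u)\<close> apart, \<open>u\<close> enters only through \<open>cosh u\<close>. So the integral
  over \<open>\<tau>\<close> is \<open>exp ((h - \<beta>) * u)\<close> times the even function \<open>jump\<close>, which is infinite at \<open>0\<close>.\<close>

definition profile :: "real \<Rightarrow> real" where
  "profile x = exp (- (h + \<beta>) * x) * (\<Sum>k. coef k * exp (- 2 * x) ^ k)"

definition kern :: "real \<Rightarrow> real \<Rightarrow> real" where
  "kern \<tau> u = exp ((h - \<beta>) * u) * (profile (\<tau> - u) * exp (- (2 * cosh u * exp (u - \<tau>))))"

definition jump :: "real \<Rightarrow> ennreal" where
  "jump u = (\<integral>\<^sup>+x. ennreal (profile x * exp (- (2 * cosh u * exp (- x)))) \<partial>lborel)"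

lemma profile_measurable [measurable]: "profile \<in> borel_measurable borel"
  unfolding profile_def by measurable

lemma profile_nonneg: "profile x \<ge> 0"
  unfolding profile_def using coef_pos by (intro mult_nonneg_nonneg suminf_nonneg summable_coef) (auto simp: less_imp_le)

lemma kern_measurable [measurable]:
  "(\<lambda>(\<tau>, u). kern \<tau> u) \<in> borel_measurable (borel \<Otimes>\<^sub>M borel)"
  unfolding kern_def cosh_def by measurable

lemma kern_measurable' [measurable (raw)]:
  "f \<in> borel_measurable M \<Longrightarrow> g \<in> borel_measurable M \<Longrightarrow> (\<lambda>x. kern (f x) (g x)) \<in> borel_measurable M"
proof -
  assume [measurable]: "f \<in> borel_measurable M" "g \<in> borel_measurable M"
  have "(\<lambda>x. (f x, g x)) \<in> measurable M (borel \<Otimes>\<^sub>M borel)"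
    by measurable
  from measurable_compose[OF this kern_measurable] show ?thesis by simp
qed

lemma kern_nonneg: "kern \<tau> u \<ge> 0"
  by (simp add: kern_def profile_nonneg)

lemma jump_measurable [measurable]: "jump \<in> borel_measurable borel"
  unfolding jump_def[abs_def] cosh_def by measurable

lemma nn_integral_kern_left:
  "(\<integral>\<^sup>+\<tau>. ennreal (kern \<tau> u) \<partial>lborel) = ennreal (exp ((h - \<beta>) * u)) * jump u"
proof -
  have "(\<integral>\<^sup>+\<tau>. ennreal (kern \<tau> u) \<partial>lborel) = (\<integral>\<^sup>+x. ennreal (kern (u + 1 * x) u) \<partial>lborel)"
    by (subst nn_integral_real_affine[where c=1 and t=u]) auto
  also have "\<dots> = (\<integral>\<^sup>+x. ennreal (exp ((h - \<beta>) * u)) * ennreal (profile x * exp (- (2 * cosh u * exp (- x)))) \<partial>lborel)"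
    by (intro nn_integral_cong) (simp add: kern_def ennreal_mult profile_nonneg)
  also have "\<dots> = ennreal (exp ((h - \<beta>) * u)) * jump u"
    unfolding jump_def by (rule nn_integral_cmult) measurable
  finally show ?thesis .
qed

lemma jump_minus: "jump (- u) = jump u"
  by (simp add: jump_def)

lemma jump_mono:
  assumes "\<bar>u\<bar> \<le> \<bar>v\<bar>"
  shows "jump v \<le> jump u"
proof -
  have "cosh u \<le> cosh v"
    using assms cosh_real_nonneg_le_iff[of "\<bar>u\<bar>" "\<bar>v\<bar>"] by simp
  then show ?thesis
    unfolding jump_def
    by (intro nn_integral_mono ennreal_leI mult_left_mono profile_nonneg) simp
qed

lemma profile_eq_suminf:
  "ennreal (profile x * e) = (\<Sum>k. ennreal (coef k * exp (- (h + \<beta> + 2 * real k) * x) * e))" if "e \<ge> 0"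
proof -
  have eq: "exp (- (h + \<beta>) * x) * (coef k * exp (- 2 * x) ^ k) * e = coef k * exp (- (h + \<beta> + 2 * real k) * x) * e" for k
  proof -
    have "exp (- (h + \<beta>) * x) * exp (- 2 * x) ^ k = exp (- (h + \<beta> + 2 * real k) * x)"
      by (simp add: exp_of_nat_mult[symmetric] exp_add[symmetric] algebra_simps)
    then show ?thesis by (simp add: mult_ac)
  qed
  have s: "summable (\<lambda>k. exp (- (h + \<beta>) * x) * (coef k * exp (- 2 * x) ^ k) * e)"
    by (intro summable_mult summable_mult2 summable_coef)
  have "profile x * e = (\<Sum>k. exp (- (h + \<beta>) * x) * (coef k * exp (- 2 * x) ^ k) * e)"
    unfolding profile_def
    by (intro sums_unique sums_mult2 sums_mult summable_sums summable_coef)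
  also have "ennreal \<dots> = (\<Sum>k. ennreal (exp (- (h + \<beta>) * x) * (coef k * exp (- 2 * x) ^ k) * e))"
    using s that coef_pos by (intro suminf_ennreal2[symmetric]) (auto simp: less_imp_le)
  finally show ?thesis unfolding eq .
qed

lemma nn_integral_Gamma_exp2:
  assumes "b > 0" "x > 0"
  shows "(\<integral>\<^sup>+u. ennreal (exp (2 * b * u) * exp (- (x * exp (2 * u)))) \<partial>lborel) = ennreal (Gamma b * x powr (- b) / 2)"
proof -
  have "ennreal (Gamma b * x powr - b) = (\<integral>\<^sup>+u. ennreal (exp (b * u) * exp (- (x * exp u))) \<partial>lborel)"
    using assms by (rule nn_integral_Gamma_exp[symmetric])
  also have "\<dots> = ennreal 2 * (\<integral>\<^sup>+u. ennreal (exp (2 * b * u) * exp (- (x * exp (2 * u)))) \<partial>lborel)"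
    by (subst nn_integral_real_affine[where c=2 and t=0]) (auto simp: mult_ac)
  finally have *: "ennreal (Gamma b * x powr - b) =
      ennreal 2 * (\<integral>\<^sup>+u. ennreal (exp (2 * b * u) * exp (- (x * exp (2 * u)))) \<partial>lborel)" .
  have "ennreal (Gamma b * x powr (- b) / 2) = ennreal (1 / 2) * ennreal (Gamma b * x powr (- b))"
    using assms by (subst ennreal_mult[symmetric]) (auto simp: Gamma_real_pos less_imp_le)
  also have "\<dots> = ennreal (1 / 2) * ennreal 2 * (\<integral>\<^sup>+u. ennreal (exp (2 * b * u) * exp (- (x * exp (2 * u)))) \<partial>lborel)"
    unfolding * by (simp only: mult.assoc)
  also have "ennreal (1 / 2) * ennreal 2 = 1"
    by (subst ennreal_mult[symmetric]) auto
  finally show ?thesis by simp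
qed

text \<open>Tonelli's theorem, term by term in the series. Each term is a Gamma integral, and the resulting series in
  \<open>k\<close> is exponential.\<close>

lemma nn_integral_kern_right:
  assumes "\<theta> \<ge> 0"
  shows "(\<integral>\<^sup>+u. ennreal (kern \<tau> u * exp (- (\<theta> * exp (2 * u)))) \<partial>lborel) =
    ennreal (exp (- \<beta> * \<tau>) * (gauss_diff h \<theta> \<tau> + exp (- \<theta>)))"
proof -
  define r where "r = 1 + \<theta> * exp \<tau>"
  define y where "y = exp (- \<tau>) / r"
  define A where "A k = coef k * exp (- (h + \<beta> + 2 * real k) * \<tau>) * exp (- exp (- \<tau>))" for k
  define x where "x = exp (- \<tau>) + \<theta>"
  have r: "r > 0" and x: "x > 0" using assms by (auto simp: r_def x_def add_pos_nonneg)
  have "exp (- \<tau>) * exp \<tau> = 1" by (simp add: mult_exp_exp)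
  then have xr: "x = exp (- \<tau>) * r" unfolding x_def r_def by algebra
  have A0: "A k \<ge> 0" for k using coef_pos[of k] by (simp add: A_def)
  have "ennreal (kern \<tau> u * exp (- (\<theta> * exp (2 * u)))) =
      (\<Sum>k. ennreal (A k) * ennreal (exp (2 * (h + real k) * u) * exp (- (x * exp (2 * u)))))" for u
  proof -
    define G where "G = exp ((h - \<beta>) * u) * exp (- (2 * cosh u * exp (u - \<tau>))) * exp (- (\<theta> * exp (2 * u)))"
    have G0: "G \<ge> 0" by (simp add: G_def)
    have "kern \<tau> u * exp (- (\<theta> * exp (2 * u))) = profile (\<tau> - u) * G"
      unfolding kern_def G_def by (simp only: mult_ac)
    also have "ennreal \<dots> = (\<Sum>k. ennreal (coef k * exp (- (h + \<beta> + 2 * real k) * (\<tau> - u)) * G))"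
      by (rule profile_eq_suminf[OF G0])
    also have "\<dots> = (\<Sum>k. ennreal (A k) * ennreal (exp (2 * (h + real k) * u) * exp (- (x * exp (2 * u)))))"
    proof (rule suminf_cong)
      fix k
      have c1: "exp u * exp (u - \<tau>) = exp (- \<tau>) * exp (2 * u)"
        and c2: "exp (- u) * exp (u - \<tau>) = exp (- \<tau>)"
        by (simp_all add: mult_exp_exp)
      have "2 * cosh u * exp (u - \<tau>) = exp u * exp (u - \<tau>) + exp (- u) * exp (u - \<tau>)"
        by (simp add: cosh_def distrib_right)
      then have "- (2 * cosh u * exp (u - \<tau>)) + - (\<theta> * exp (2 * u)) = - exp (- \<tau>) + - (x * exp (2 * u))"
        unfolding c1 c2 x_def by (simp add: distrib_right)
      then have e: "exp (- (2 * cosh u * exp (u - \<tau>))) * exp (- (\<theta> * exp (2 * u))) = exp (- exp (- \<tau>)) * exp (- (x * exp (2 * u)))"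
        by (simp only: mult_exp_exp)
      have "- (h + \<beta> + 2 * real k) * (\<tau> - u) + (h - \<beta>) * u =
          - (h + \<beta> + 2 * real k) * \<tau> + 2 * (h + real k) * u"
        by (simp add: algebra_simps)
      then have f: "exp (- (h + \<beta> + 2 * real k) * (\<tau> - u)) * exp ((h - \<beta>) * u) =
          exp (- (h + \<beta> + 2 * real k) * \<tau>) * exp (2 * (h + real k) * u)"
        by (simp only: mult_exp_exp)
      have "coef k * exp (- (h + \<beta> + 2 * real k) * (\<tau> - u)) * G =
        coef k * (exp (- (h + \<beta> + 2 * real k) * (\<tau> - u)) * exp ((h - \<beta>) * u)) *
        (exp (- (2 * cosh u * exp (u - \<tau>))) * exp (- (\<theta> * exp (2 * u))))"
        unfolding G_def by (simp only: mult_ac)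
      also have "\<dots> = A k * (exp (2 * (h + real k) * u) * exp (- (x * exp (2 * u))))"
        unfolding e f A_def by (simp only: mult_ac)
      finally show "ennreal (coef k * exp (- (h + \<beta> + 2 * real k) * (\<tau> - u)) * G) =
        ennreal (A k) * ennreal (exp (2 * (h + real k) * u) * exp (- (x * exp (2 * u))))"
        using A0[of k] by (simp only: ennreal_mult' [symmetric])
    qed
    finally show ?thesis .
  qed
  then have "(\<integral>\<^sup>+u. ennreal (kern \<tau> u * exp (- (\<theta> * exp (2 * u)))) \<partial>lborel) =
      (\<Sum>k. \<integral>\<^sup>+u. ennreal (A k) * ennreal (exp (2 * (h + real k) * u) * exp (- (x * exp (2 * u)))) \<partial>lborel)"
    by (simp add: nn_integral_suminf)
  also have "\<dots> = (\<Sum>k. ennreal (A k) * ennreal (Gamma (h + real k) * x powr (- (h + real k)) / 2))"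
  proof (rule suminf_cong)
    fix k
    have "(\<integral>\<^sup>+u. ennreal (A k) * ennreal (exp (2 * (h + real k) * u) * exp (- (x * exp (2 * u)))) \<partial>lborel) =
        ennreal (A k) * (\<integral>\<^sup>+u. ennreal (exp (2 * (h + real k) * u) * exp (- (x * exp (2 * u)))) \<partial>lborel)"
      by (rule nn_integral_cmult) measurable
    also have "(\<integral>\<^sup>+u. ennreal (exp (2 * (h + real k) * u) * exp (- (x * exp (2 * u)))) \<partial>lborel) =
        ennreal (Gamma (h + real k) * x powr (- (h + real k)) / 2)"
      using h x by (intro nn_integral_Gamma_exp2) auto
    finally show "(\<integral>\<^sup>+u. ennreal (A k) * ennreal (exp (2 * (h + real k) * u) * exp (- (x * exp (2 * u)))) \<partial>lborel) =
        ennreal (A k) * ennreal (Gamma (h + real k) * x powr (- (h + real k)) / 2)" .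
  qed
  also have "\<dots> = (\<Sum>k. ennreal (exp (- \<beta> * \<tau>) * exp (- exp (- \<tau>)) * r powr (- h) * (y ^ k /\<^sub>R fact k)))"
  proof (rule suminf_cong)
    fix k
    have "x powr (- (h + real k)) = exp (- \<tau>) powr (- (h + real k)) * r powr (- (h + real k))"
      using r unfolding xr by (simp add: powr_mult)
    also have "\<dots> = exp ((h + real k) * \<tau>) * (r powr (- h) * r powr (- real k))"
    proof -
      have "exp (- \<tau>) powr (- (h + real k)) = exp ((h + real k) * \<tau>)"
        by (simp add: powr_def algebra_simps)
      moreover have "r powr (- (h + real k)) = r powr (- h) * r powr (- real k)"
        by (simp add: powr_add[symmetric])
      ultimately show ?thesis by simp
    qed
    also have "r powr (- real k) = 1 / r ^ k" using r by (simp add: powr_minus_divide powr_realpow)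
    finally have xp: "x powr (- (h + real k)) = exp ((h + real k) * \<tau>) * (r powr (- h) * (1 / r ^ k))" .
    have "A k * (Gamma (h + real k) * x powr (- (h + real k)) / 2) =
        (coef k * Gamma (h + real k) / 2) * (exp (- (h + \<beta> + 2 * real k) * \<tau>) * exp ((h + real k) * \<tau>)) *
        exp (- exp (- \<tau>)) * r powr (- h) * (1 / r ^ k)"
      unfolding A_def xp by (simp only: mult_ac times_divide_eq_left times_divide_eq_right)
    also have "coef k * Gamma (h + real k) / 2 = 1 / fact k"
      using Gamma_pos[of k] by (simp add: coef_def)
    also have "exp (- (h + \<beta> + 2 * real k) * \<tau>) * exp ((h + real k) * \<tau>) = exp (- \<beta> * \<tau>) * exp (- \<tau>) ^ k"
    proof -
      have "- (h + \<beta> + 2 * real k) * \<tau> + (h + real k) * \<tau> = - \<beta> * \<tau> + real k * - \<tau>"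
        by (simp add: algebra_simps)
      then show ?thesis
        by (simp only: mult_exp_exp exp_of_nat_mult[symmetric])
    qed
    also have "1 / fact k * (exp (- \<beta> * \<tau>) * exp (- \<tau>) ^ k) * exp (- exp (- \<tau>)) * r powr (- h) * (1 / r ^ k) =
        exp (- \<beta> * \<tau>) * exp (- exp (- \<tau>)) * r powr (- h) * (y ^ k /\<^sub>R fact k)"
      by (simp add: y_def power_divide divide_inverse power_mult_distrib power_inverse mult_ac)
    finally show "ennreal (A k) * ennreal (Gamma (h + real k) * x powr (- (h + real k)) / 2) =
        ennreal (exp (- \<beta> * \<tau>) * exp (- exp (- \<tau>)) * r powr (- h) * (y ^ k /\<^sub>R fact k))"
      using A0[of k] by (simp only: ennreal_mult'[symmetric])
  qed
  also have "\<dots> = ennreal (exp (- \<beta> * \<tau>) * exp (- exp (- \<tau>)) * r powr (- h) * exp y)"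
  proof (rule suminf_ennreal_eq)
    show "(\<lambda>k. exp (- \<beta> * \<tau>) * exp (- exp (- \<tau>)) * r powr (- h) * (y ^ k /\<^sub>R fact k)) sums
        (exp (- \<beta> * \<tau>) * exp (- exp (- \<tau>)) * r powr (- h) * exp y)"
      by (intro sums_mult exp_converges)
  qed (use r in \<open>auto simp: y_def\<close>)
  also have "exp (- \<beta> * \<tau>) * exp (- exp (- \<tau>)) * r powr (- h) * exp y = exp (- \<beta> * \<tau>) * (gauss_diff h \<theta> \<tau> + exp (- \<theta>))"
  proof -
    have "- exp (- \<tau>) + y = - \<theta> / r"
    proof -
      have "- exp (- \<tau>) * r + exp (- \<tau>) = - \<theta>"
        by (simp add: r_def algebra_simps mult_exp_exp)
      moreover have "- exp (- \<tau>) + y = (- exp (- \<tau>) * r + exp (- \<tau>)) / r"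
        using r by (simp add: y_def diff_divide_distrib)
      ultimately show ?thesis by simp
    qed
    then have "exp (- exp (- \<tau>)) * exp y = exp (- \<theta> / r)" by (simp add: mult_exp_exp)
    then show ?thesis by (simp add: gauss_diff_def r_def[symmetric] mult_ac)
  qed
  finally show ?thesis .
qed

end

section \<open>Integrability against the kernel\<close>

text \<open>The radial process is started from \<open>a > 0\<close>.\<close>

locale bessel_start = subordinated_bessel +
  fixes a :: real
  assumes a: "a > 0"
begin

text \<open>With \<open>r = a exp u\<close>, \<open>gexp u\<close> is \<open>exp (- r\<^sup>2)\<close>, \<open>x0\<close> is its value at \<open>u = 0\<close>, and \<open>gdev\<close> is the deviation from
  it. It vanishes to first order at \<open>0\<close> and only there, so \<open>gdev u\<close> plays the role of a bounded coordinate, comparable to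
  \<open>min 1 \<bar>u\<bar>\<close>.\<close>

definition gexp :: "real \<Rightarrow> real" where
  "gexp u = exp (- (a\<^sup>2 * exp (2 * u)))"

definition x0 :: real where
  "x0 = exp (- a\<^sup>2)"

definition gdev :: "real \<Rightarrow> real" where
  "gdev u = gexp u - x0"

text \<open>The real versions of \<open>jump\<close> and of the integral of \<open>kern\<close> over \<open>\<tau>\<close>. At \<open>u = 0\<close>, where \<open>jump\<close> is infinite, they are
  \<open>0\<close>; a value at one point does not affect the integrals below.\<close>

definition rjump :: "real \<Rightarrow> real" where
  "rjump u = enn2real (jump u)"

definition jker :: "real \<Rightarrow> real" where
  "jker u = exp ((h - \<beta>) * u) * rjump u"

lemma gexp_measurable [measurable]: "gexp \<in> borel_measurable borel"
  unfolding gexp_def by measurable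

lemma gdev_measurable [measurable]: "gdev \<in> borel_measurable borel"
  unfolding gdev_def by measurable

lemma rjump_measurable [measurable]: "rjump \<in> borel_measurable borel"
  unfolding rjump_def by measurable

lemma jker_measurable [measurable]: "jker \<in> borel_measurable borel"
  unfolding jker_def by measurable

lemma gexp_bounds: "0 < gexp u" "gexp u < 1"
  using a by (auto simp: gexp_def)

lemma x0_bounds: "0 < x0" "x0 < 1"
  using a by (auto simp: x0_def)

lemma abs_gdev_le_1: "\<bar>gdev u\<bar> \<le> 1"
  using gexp_bounds[of u] x0_bounds by (auto simp: gdev_def)

lemma gdev_0: "gdev 0 = 0"
  by (simp add: gdev_def gexp_def x0_def)

lemma gexp_power: "gexp u ^ i = exp (- (real i * a\<^sup>2 * exp (2 * u)))"
  by (simp add: gexp_def exp_of_nat_mult[symmetric] mult_ac)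

lemma x0_power: "x0 ^ i = exp (- (real i * a\<^sup>2))"
  by (simp add: x0_def exp_of_nat_mult[symmetric])

lemma
  shows integrable_kern_power: "integrable lborel (\<lambda>u. kern \<tau> u * gexp u ^ i)"
    and integral_kern_power: "(LINT u|lborel. kern \<tau> u * gexp u ^ i) =
      exp (- \<beta> * \<tau>) * (gauss_diff h (real i * a\<^sup>2) \<tau> + x0 ^ i)"
proof -
  have eq: "(\<integral>\<^sup>+u. ennreal (kern \<tau> u * gexp u ^ i) \<partial>lborel) =
      ennreal (exp (- \<beta> * \<tau>) * (gauss_diff h (real i * a\<^sup>2) \<tau> + x0 ^ i))"
    using nn_integral_kern_right[of "real i * a\<^sup>2" \<tau>] by (simp add: gexp_power x0_power)
  have nn: "0 \<le> kern \<tau> u * gexp u ^ i" for u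
    using gexp_bounds[of u] kern_nonneg[of \<tau> u] by (simp add: less_imp_le)
  show "integrable lborel (\<lambda>u. kern \<tau> u * gexp u ^ i)"
    using nn eq by (intro integrableI_nonneg) auto
  have "0 \<le> gauss_diff h (real i * a\<^sup>2) \<tau> + x0 ^ i"
    by (simp add: gauss_diff_def x0_power)
  then show "(LINT u|lborel. kern \<tau> u * gexp u ^ i) =
      exp (- \<beta> * \<tau>) * (gauss_diff h (real i * a\<^sup>2) \<tau> + x0 ^ i)"
    using nn by (intro integral_eq_nn_integral[THEN trans]) (auto simp: eq simp del: mult_minus_left)
qed

lemma integrable_gauss_diff:
  assumes "\<theta> \<ge> 0"
  shows "integrable lborel (\<lambda>\<tau>. gauss_diff h \<theta> \<tau> * exp (- \<beta> * \<tau>))"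
proof (rule Bochner_Integration.integrable_bound)
  let ?C = "\<theta>\<^sup>2 + h * \<theta>"
  have C: "?C \<ge> 0" using assms h by simp
  show "integrable lborel (\<lambda>\<tau>. min 1 (?C * exp \<tau>) * exp (- \<beta> * \<tau>))"
    by (rule integrable_min_exp[OF \<beta> C])
  show "AE \<tau> in lborel. norm (gauss_diff h \<theta> \<tau> * exp (- \<beta> * \<tau>)) \<le> norm (min 1 (?C * exp \<tau>) * exp (- \<beta> * \<tau>))"
  proof (intro AE_I2)
    fix \<tau> :: real
    have "\<bar>gauss_diff h \<theta> \<tau>\<bar> \<le> \<bar>min 1 (?C * exp \<tau>)\<bar>"
      using abs_gauss_diff_le[of h \<theta> \<tau>] assms h by linarith
    then show "norm (gauss_diff h \<theta> \<tau> * exp (- \<beta> * \<tau>)) \<le> norm (min 1 (?C * exp \<tau>) * exp (- \<beta> * \<tau>))"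
      by (simp add: abs_mult)
  qed
qed (simp add: gauss_diff_def)

lemma
  fixes c :: "nat \<Rightarrow> real"
  assumes p: "\<And>x. p x = (\<Sum>i\<le>n. c i * x ^ i)"
  shows integrable_kern_poly: "integrable lborel (\<lambda>u. kern \<tau> u * p (gexp u))"
    and integral_kern_poly: "(LINT u|lborel. kern \<tau> u * p (gexp u)) =
      (\<Sum>i\<le>n. c i * gauss_diff h (real i * a\<^sup>2) \<tau>) * exp (- \<beta> * \<tau>) + p x0 * exp (- \<beta> * \<tau>)"
    and integral_poly_diff: "(LINT \<tau>|lborel. (\<Sum>i\<le>n. c i * gauss_diff h (real i * a\<^sup>2) \<tau>) * exp (- \<beta> * \<tau>)) =
      (\<Sum>i\<le>n. c i * (LINT \<tau>|lborel. gauss_diff h (real i * a\<^sup>2) \<tau> * exp (- \<beta> * \<tau>)))"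
proof -
  have eq: "kern \<tau> u * p (gexp u) = (\<Sum>i\<le>n. c i * (kern \<tau> u * gexp u ^ i))" for u
    unfolding p by (simp add: sum_distrib_left mult_ac)
  show "integrable lborel (\<lambda>u. kern \<tau> u * p (gexp u))"
    unfolding eq by (intro Bochner_Integration.integrable_sum integrable_mult_right integrable_kern_power)
  have "(LINT u|lborel. kern \<tau> u * p (gexp u)) = (\<Sum>i\<le>n. c i * (LINT u|lborel. kern \<tau> u * gexp u ^ i))"
    unfolding eq by (subst Bochner_Integration.integral_sum) (auto intro: integrable_mult_right integrable_kern_power)
  also have "\<dots> = (\<Sum>i\<le>n. c i * gauss_diff h (real i * a\<^sup>2) \<tau>) * exp (- \<beta> * \<tau>) + p x0 * exp (- \<beta> * \<tau>)"
    unfolding integral_kern_power p sum_distrib_right sum.distrib[symmetric]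
    by (rule sum.cong) (auto simp: algebra_simps)
  finally show "(LINT u|lborel. kern \<tau> u * p (gexp u)) = \<dots>" .
  have eq2: "(\<Sum>i\<le>n. c i * gauss_diff h (real i * a\<^sup>2) \<tau>) * exp (- \<beta> * \<tau>) =
      (\<Sum>i\<le>n. c i * (gauss_diff h (real i * a\<^sup>2) \<tau> * exp (- \<beta> * \<tau>)))" for \<tau>
    unfolding sum_distrib_right by (rule sum.cong) (auto simp: mult_ac)
  show "(LINT \<tau>|lborel. (\<Sum>i\<le>n. c i * gauss_diff h (real i * a\<^sup>2) \<tau>) * exp (- \<beta> * \<tau>)) =
      (\<Sum>i\<le>n. c i * (LINT \<tau>|lborel. gauss_diff h (real i * a\<^sup>2) \<tau> * exp (- \<beta> * \<tau>)))"
    unfolding eq2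
  proof (subst Bochner_Integration.integral_sum)
    fix i
    show "integrable lborel (\<lambda>\<tau>. c i * (gauss_diff h (real i * a\<^sup>2) \<tau> * exp (- \<beta> * \<tau>)))"
      by (intro integrable_mult_right integrable_gauss_diff) auto
  qed (simp only: integral_mult_right_zero)
qed

lemma
  shows integrable_kern_sq: "integrable lborel (\<lambda>u. kern \<tau> u * (gdev u)\<^sup>2)"
    and integral_kern_sq: "(LINT u|lborel. kern \<tau> u * (gdev u)\<^sup>2) =
      (gauss_diff h (2 * a\<^sup>2) \<tau> - 2 * x0 * gauss_diff h (a\<^sup>2) \<tau>) * exp (- \<beta> * \<tau>)"
proof -
  define c where "c = (\<lambda>i::nat. if i = 0 then x0\<^sup>2 else if i = 1 then - 2 * x0 else 1)"
  have c: "(x - x0)\<^sup>2 = (\<Sum>i\<le>2. c i * x ^ i)" for x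
    by (simp add: c_def numeral_2_eq_2 power2_eq_square algebra_simps)
  show "integrable lborel (\<lambda>u. kern \<tau> u * (gdev u)\<^sup>2)"
    using integrable_kern_poly[OF c] by (simp add: gdev_def)
  have "(\<Sum>i\<le>2. c i * gauss_diff h (real i * a\<^sup>2) \<tau>) = gauss_diff h (2 * a\<^sup>2) \<tau> - 2 * x0 * gauss_diff h (a\<^sup>2) \<tau>"
    by (simp add: c_def numeral_2_eq_2 gauss_diff_def)
  then show "(LINT u|lborel. kern \<tau> u * (gdev u)\<^sup>2) =
      (gauss_diff h (2 * a\<^sup>2) \<tau> - 2 * x0 * gauss_diff h (a\<^sup>2) \<tau>) * exp (- \<beta> * \<tau>)"
    using integral_kern_poly[OF c, of \<tau>] by (simp add: gdev_def)
qed

text \<open>The source of all integrability statements: \<open>gdev\<^sup>2\<close> is a polynomial in \<open>gexp\<close>, so its integral over \<open>u\<close> is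
  explicit, and the integral over \<open>\<tau>\<close> of the result is finite.\<close>

lemma integrable_pair_sq: "integrable (lborel \<Otimes>\<^sub>M lborel) (\<lambda>(\<tau>, u). kern \<tau> u * (gdev u)\<^sup>2)"
proof (rule integrableI_nonneg)
  show "AE x in lborel \<Otimes>\<^sub>M lborel. 0 \<le> (case x of (\<tau>, u) \<Rightarrow> kern \<tau> u * (gdev u)\<^sup>2)"
    by (auto simp: kern_nonneg)
  have "(\<integral>\<^sup>+x. ennreal (case x of (\<tau>, u) \<Rightarrow> kern \<tau> u * (gdev u)\<^sup>2) \<partial>(lborel \<Otimes>\<^sub>M lborel)) =
      (\<integral>\<^sup>+\<tau>. (\<integral>\<^sup>+u. ennreal (kern \<tau> u * (gdev u)\<^sup>2) \<partial>lborel) \<partial>lborel)"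
    by (subst lborel.nn_integral_fst[symmetric]) auto
  also have "\<dots> = (\<integral>\<^sup>+\<tau>. ennreal (LINT u|lborel. kern \<tau> u * (gdev u)\<^sup>2) \<partial>lborel)"
    using integrable_kern_sq by (intro nn_integral_cong nn_integral_eq_integral) (auto simp: kern_nonneg)
  also have "\<dots> < \<infinity>"
  proof -
    have "integrable lborel (\<lambda>\<tau>. gauss_diff h (2 * a\<^sup>2) \<tau> * exp (- \<beta> * \<tau>) - 2 * x0 * (gauss_diff h (a\<^sup>2) \<tau> * exp (- \<beta> * \<tau>)))"
      by (intro Bochner_Integration.integrable_diff integrable_mult_right integrable_gauss_diff) auto
    then have "integrable lborel (\<lambda>\<tau>. LINT u|lborel. kern \<tau> u * (gdev u)\<^sup>2)"
      unfolding integral_kern_sq by (simp add: algebra_simps)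
    moreover have "0 \<le> (LINT u|lborel. kern \<tau> u * (gdev u)\<^sup>2)" for \<tau>
      by (intro Bochner_Integration.integral_nonneg) (simp add: kern_nonneg)
    ultimately show ?thesis
      by (simp add: integrable_iff_bounded)
  qed
  finally show "(\<integral>\<^sup>+x. ennreal (case x of (\<tau>, u) \<Rightarrow> kern \<tau> u * (gdev u)\<^sup>2) \<partial>(lborel \<Otimes>\<^sub>M lborel)) < \<infinity>" .
qed measurable

lemma gdev_deriv: "(gdev has_real_derivative - (2 * a\<^sup>2 * exp (2 * u) * gexp u)) (at u)"
  unfolding gdev_def[abs_def] gexp_def[abs_def] by (auto intro!: derivative_eq_intros)

lemma gdev_mono: "u < v \<Longrightarrow> gdev v < gdev u"
  using a by (simp add: gdev_def gexp_def)

lemma gdev_bounds: "\<exists>C>0. (\<forall>u. min 1 \<bar>u\<bar> \<le> C * \<bar>gdev u\<bar>) \<and> (\<forall>u. \<bar>u\<bar> \<le> 1 \<longrightarrow> \<bar>gdev u\<bar> \<le> C * \<bar>u\<bar>)"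
proof -
  define D where "D u = 2 * a\<^sup>2 * exp (2 * u) * gexp u" for u
  have Dpos: "D u > 0" for u using a gexp_bounds[of u] by (simp add: D_def)
  have cont: "continuous_on {-1..1} D"
    unfolding D_def gexp_def by (intro continuous_intros)
  obtain l where l: "l \<in> {-1..1}" "\<And>u. u \<in> {-1..1} \<Longrightarrow> D l \<le> D u"
    using continuous_attains_inf[OF _ _ cont] by auto
  obtain m where m: "m \<in> {-1..1}" "\<And>u. u \<in> {-1..1} \<Longrightarrow> D u \<le> D m"
    using continuous_attains_sup[OF _ _ cont] by auto
  have small: "D l * \<bar>u\<bar> \<le> \<bar>gdev u\<bar> \<and> \<bar>gdev u\<bar> \<le> D m * \<bar>u\<bar>" if u: "\<bar>u\<bar> \<le> 1" for u
  proof (cases "u = 0")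
    case False
    have "\<exists>\<xi>. \<bar>\<xi>\<bar> \<le> 1 \<and> gdev u = - (u * D \<xi>)"
    proof (cases "u > 0")
      case True
      from MVT2[OF True, of gdev "\<lambda>x. - D x"] obtain \<xi> where "0 < \<xi>" "\<xi> < u" "gdev u - gdev 0 = (u - 0) * - D \<xi>"
        using gdev_deriv unfolding D_def by blast
      then show ?thesis using u gdev_0 by (intro exI[of _ \<xi>]) auto
    next
      case neg: False
      with False have "u < 0" by simp
      from MVT2[OF this, of gdev "\<lambda>x. - D x"] obtain \<xi> where "u < \<xi>" "\<xi> < 0" "gdev 0 - gdev u = (0 - u) * - D \<xi>"
        using gdev_deriv unfolding D_def by blast
      then show ?thesis using u gdev_0 by (intro exI[of _ \<xi>]) auto
    qed
    then obtain \<xi> where \<xi>: "\<bar>\<xi>\<bar> \<le> 1" "gdev u = - (u * D \<xi>)" by blast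
    then have "\<bar>gdev u\<bar> = D \<xi> * \<bar>u\<bar>" using Dpos[of \<xi>] by (simp add: abs_mult)
    moreover have "D l \<le> D \<xi>" "D \<xi> \<le> D m" using \<xi> l m by (auto simp: abs_le_iff)
    ultimately show ?thesis by (simp add: mult_right_mono)
  qed (simp add: gdev_0)
  have big: "min 1 \<bar>u\<bar> * D l \<le> \<bar>gdev u\<bar>" for u
  proof (cases "\<bar>u\<bar> \<le> 1")
    case True
    then show ?thesis using small[OF True] by (simp add: min_def mult.commute)
  next
    case False
    then consider "u > 1" | "u < -1" by linarith
    then have "\<bar>gdev u\<bar> \<ge> D l"
    proof cases
      case 1
      then have "gdev u < gdev 1" by (rule gdev_mono)
      moreover have "gdev 1 < gdev 0" by (rule gdev_mono) simp
      ultimately show ?thesis using small[of 1] gdev_0 by auto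
    next
      case 2
      then have "gdev (-1) < gdev u" by (rule gdev_mono)
      moreover have "gdev 0 < gdev (-1)" by (rule gdev_mono) simp
      ultimately show ?thesis using small[of "-1"] gdev_0 by auto
    qed
    then show ?thesis using False by (simp add: min_def)
  qed
  define C where "C = 1 / D l + D m"
  have C: "C > 0" using Dpos[of l] Dpos[of m] by (simp add: C_def add_pos_pos)
  have "min 1 \<bar>u\<bar> \<le> C * \<bar>gdev u\<bar>" for u
  proof -
    have "min 1 \<bar>u\<bar> \<le> 1 / D l * \<bar>gdev u\<bar>" using big[of u] Dpos[of l] by (simp add: field_simps)
    also have "\<dots> \<le> C * \<bar>gdev u\<bar>" using Dpos[of m] by (intro mult_right_mono) (auto simp: C_def)
    finally show ?thesis .
  qed
  moreover have "\<bar>gdev u\<bar> \<le> C * \<bar>u\<bar>" if "\<bar>u\<bar> \<le> 1" for u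
  proof -
    have "\<bar>gdev u\<bar> \<le> D m * \<bar>u\<bar>" using small[OF that] by simp
    also have "\<dots> \<le> C * \<bar>u\<bar>" using Dpos[of l] by (intro mult_right_mono) (auto simp: C_def)
    finally show ?thesis .
  qed
  ultimately show ?thesis using C by blast
qed

lemma gdev_eq_0_iff: "gdev u = 0 \<longleftrightarrow> u = 0"
  using gdev_mono[of u 0] gdev_mono[of 0 u] gdev_0 by (cases u "0::real" rule: linorder_cases) auto

text \<open>An integrable function is finite almost everywhere; by monotonicity \<open>jump\<close> is then finite everywhere except at
  \<open>0\<close>.\<close>

lemma jump_finite:
  assumes "u \<noteq> 0"
  shows "jump u < \<infinity>"
proof -
  have "(\<integral>\<^sup>+x. ennreal (case x of (\<tau>, u) \<Rightarrow> kern \<tau> u * (gdev u)\<^sup>2) \<partial>(lborel \<Otimes>\<^sub>M lborel)) =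
      (\<integral>\<^sup>+v. (\<integral>\<^sup>+\<tau>. ennreal (kern \<tau> v * (gdev v)\<^sup>2) \<partial>lborel) \<partial>lborel)"
    by (subst lborel_pair.nn_integral_snd[symmetric]) auto
  also have "\<dots> = (\<integral>\<^sup>+v. ennreal ((gdev v)\<^sup>2 * exp ((h - \<beta>) * v)) * jump v \<partial>lborel)"
  proof (rule nn_integral_cong)
    fix v
    have "(\<integral>\<^sup>+\<tau>. ennreal (kern \<tau> v * (gdev v)\<^sup>2) \<partial>lborel) = (\<integral>\<^sup>+\<tau>. ennreal ((gdev v)\<^sup>2) * ennreal (kern \<tau> v) \<partial>lborel)"
      by (intro nn_integral_cong) (simp add: ennreal_mult[symmetric] kern_nonneg mult.commute)
    also have "\<dots> = ennreal ((gdev v)\<^sup>2) * (\<integral>\<^sup>+\<tau>. ennreal (kern \<tau> v) \<partial>lborel)"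
      by (rule nn_integral_cmult) measurable
    finally show "(\<integral>\<^sup>+\<tau>. ennreal (kern \<tau> v * (gdev v)\<^sup>2) \<partial>lborel) = ennreal ((gdev v)\<^sup>2 * exp ((h - \<beta>) * v)) * jump v"
      by (simp add: nn_integral_kern_left ennreal_mult mult.assoc)
  qed
  finally have "(\<integral>\<^sup>+v. ennreal ((gdev v)\<^sup>2 * exp ((h - \<beta>) * v)) * jump v \<partial>lborel) \<noteq> \<infinity>"
    using integrable_pair_sq by (subst (asm) integrable_iff_bounded) (auto simp: kern_nonneg abs_mult case_prod_beta)
  then have "AE v in lborel. ennreal ((gdev v)\<^sup>2 * exp ((h - \<beta>) * v)) * jump v \<noteq> \<infinity>"
    by (intro nn_integral_PInf_AE) auto
  then have "AE v in lborel. v \<in> {0<..<\<bar>u\<bar>} \<longrightarrow> jump v < \<infinity>"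
  proof eventually_elim
    case (elim v)
    show ?case
    proof
      assume "v \<in> {0<..<\<bar>u\<bar>}"
      then have "gdev v \<noteq> 0" by (simp add: gdev_eq_0_iff)
      then have "ennreal ((gdev v)\<^sup>2 * exp ((h - \<beta>) * v)) \<noteq> 0" by (simp add: ennreal_eq_0_iff mult_le_0_iff not_le)
      then show "jump v < \<infinity>" using elim by (auto simp: ennreal_mult_eq_top_iff less_top)
    qed
  qed
  moreover have "\<not> (AE v in lborel. v \<notin> {0<..<\<bar>u\<bar>})"
  proof
    assume "AE v in lborel. v \<notin> {0<..<\<bar>u\<bar>}"
    then have "{0<..<\<bar>u\<bar>} \<in> null_sets lborel" by (subst AE_iff_null_sets) auto
    then have "emeasure lborel {0<..<\<bar>u\<bar>} = 0" by auto
    then show False using assms by simp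
  qed
  moreover have "AE v in lborel. v \<notin> {0<..<\<bar>u\<bar>}"
    if "AE v in lborel. v \<in> {0<..<\<bar>u\<bar>} \<longrightarrow> jump v < \<infinity>"
      and "\<not> (\<exists>v\<in>{0<..<\<bar>u\<bar>}. jump v < \<infinity>)"
    using that(1) by eventually_elim (use that(2) in auto)
  ultimately have "\<exists>v\<in>{0<..<\<bar>u\<bar>}. jump v < \<infinity>"
    by blast
  then obtain v where "v \<in> {0<..<\<bar>u\<bar>}" "jump v < \<infinity>" by blast
  then show ?thesis
    using jump_mono[of v u] by (auto intro: le_less_trans)
qed

lemma ennreal_rjump: "u \<noteq> 0 \<Longrightarrow> ennreal (rjump u) = jump u"
  using jump_finite[of u] by (simp add: rjump_def)

lemma rjump_nonneg: "rjump u \<ge> 0"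
  by (simp add: rjump_def)

lemma jker_nonneg: "jker u \<ge> 0"
  by (simp add: jker_def rjump_nonneg)

lemma rjump_minus: "rjump (- u) = rjump u"
  by (simp add: rjump_def jump_minus)

lemma rjump_mono:
  assumes "u \<noteq> 0" "\<bar>u\<bar> \<le> \<bar>v\<bar>"
  shows "rjump v \<le> rjump u"
  unfolding rjump_def using jump_mono[OF assms(2)] jump_finite[OF assms(1)] by (intro enn2real_mono) auto

lemma
  assumes "u \<noteq> 0"
  shows integrable_kern_left: "integrable lborel (\<lambda>\<tau>. kern \<tau> u)"
    and integral_kern_left: "(LINT \<tau>|lborel. kern \<tau> u) = jker u"
proof -
  have eq: "(\<integral>\<^sup>+\<tau>. ennreal (kern \<tau> u) \<partial>lborel) = ennreal (jker u)"
    using ennreal_rjump[OF assms] by (simp add: nn_integral_kern_left jker_def ennreal_mult rjump_nonneg)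
  show "integrable lborel (\<lambda>\<tau>. kern \<tau> u)"
    using eq by (intro integrableI_nonneg) (auto simp: kern_nonneg)
  show "(LINT \<tau>|lborel. kern \<tau> u) = jker u"
    using eq by (intro integral_eq_nn_integral[THEN trans]) (auto simp: kern_nonneg jker_nonneg)
qed

lemma
  assumes [measurable]: "G \<in> borel_measurable borel" and G: "\<And>u. \<bar>G u\<bar> \<le> C * (gdev u)\<^sup>2"
  shows integrable_pair_quadratic: "integrable (lborel \<Otimes>\<^sub>M lborel) (\<lambda>(\<tau>, u). kern \<tau> u * G u)"
    and integrable_jker_quadratic: "integrable lborel (\<lambda>u. jker u * G u)"
    and integrable_kern_quadratic: "integrable lborel (\<lambda>\<tau>. LINT u|lborel. kern \<tau> u * G u)"
    and integral_jker_quadratic: "(LINT \<tau>|lborel. LINT u|lborel. kern \<tau> u * G u) = (LINT u|lborel. jker u * G u)"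
proof -
  show int: "integrable (lborel \<Otimes>\<^sub>M lborel) (\<lambda>(\<tau>, u). kern \<tau> u * G u)"
  proof (rule Bochner_Integration.integrable_bound)
    show "integrable (lborel \<Otimes>\<^sub>M lborel) (\<lambda>x. C * (case x of (\<tau>, u) \<Rightarrow> kern \<tau> u * (gdev u)\<^sup>2))"
      by (intro integrable_mult_right integrable_pair_sq)
    have "\<bar>kern \<tau> u * G u\<bar> \<le> \<bar>C * (kern \<tau> u * (gdev u)\<^sup>2)\<bar>" for \<tau> u
    proof -
      have "\<bar>kern \<tau> u * G u\<bar> \<le> kern \<tau> u * (C * (gdev u)\<^sup>2)"
        using mult_left_mono[OF G kern_nonneg] by (simp add: abs_mult kern_nonneg)
      then show ?thesis by (simp add: mult_ac)
    qed
    then show "AE x in lborel \<Otimes>\<^sub>M lborel. norm (case x of (\<tau>, u) \<Rightarrow> kern \<tau> u * G u)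
        \<le> norm (C * (case x of (\<tau>, u) \<Rightarrow> kern \<tau> u * (gdev u)\<^sup>2))"
      by (intro AE_I2) auto
  qed measurable
  have inner: "AE u in lborel. (LINT \<tau>|lborel. kern \<tau> u * G u) = jker u * G u"
    using AE_lborel_singleton[of 0]
    by eventually_elim (simp add: integrable_kern_left integral_kern_left)
  have "integrable lborel (\<lambda>u. LINT \<tau>|lborel. kern \<tau> u * G u)"
    using lborel_pair.integrable_snd[OF int] by simp
  then show "integrable lborel (\<lambda>u. jker u * G u)"
    by (rule integrable_cong_AE_imp) (use inner in \<open>auto elim: AE_mp\<close>)
  show "integrable lborel (\<lambda>\<tau>. LINT u|lborel. kern \<tau> u * G u)"
    using lborel_pair.integrable_fst[OF int] by simp
  have "(LINT \<tau>|lborel. LINT u|lborel. kern \<tau> u * G u) = (LINT u|lborel. LINT \<tau>|lborel. kern \<tau> u * G u)"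
    using lborel_pair.Fubini_integral[OF int] by simp
  also have "\<dots> = (LINT u|lborel. jker u * G u)"
    by (rule integral_cong_AE) (use inner in auto)
  finally show "(LINT \<tau>|lborel. LINT u|lborel. kern \<tau> u * G u) = (LINT u|lborel. jker u * G u)" .
qed

end

section \<open>Symmetrization\<close>

lemma
  fixes f :: "real \<Rightarrow> real"
  assumes f: "integrable lborel f"
  shows integrable_reflection_sum: "integrable lborel (\<lambda>u. indicator {0<..} u * (f u + f (- u)))"
    and integral_reflection_sum: "(LINT u|lborel. indicator {0<..} u * (f u + f (- u))) = (LINT u|lborel. f u)"
proof -
  have [measurable]: "f \<in> borel_measurable borel" using f by auto
  have fm: "integrable lborel (\<lambda>u. f (- u))"
    using lborel_integrable_real_affine_iff[of "-1" f 0] f by simp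
  have pos: "integrable lborel (\<lambda>u. indicator {0<..} u * f u)"
    and neg: "integrable lborel (\<lambda>u. indicator {..<0} u * f u)"
    and neg': "integrable lborel (\<lambda>u. indicator {0<..} u * f (- u))"
    using f fm by (auto intro!: integrable_real_mult_indicator simp: mult.commute[of "indicator _ _"])
  then show "integrable lborel (\<lambda>u. indicator {0<..} u * (f u + f (- u)))"
    by (simp add: distrib_left)
  have "(LINT u|lborel. indicator {..<0} u * f u) = (LINT u|lborel. indicator {..<0} (- u) * f (- u))"
    by (subst lborel_integral_real_affine[where c="-1" and t=0]) auto
  also have "\<dots> = (LINT u|lborel. indicator {0<..} u * f (- u))"
    by (intro Bochner_Integration.integral_cong) (auto simp: indicator_def)
  finally have "(LINT u|lborel. indicator {0<..} u * (f u + f (- u))) =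
      (LINT u|lborel. indicator {0<..} u * f u) + (LINT u|lborel. indicator {..<0} u * f u)"
    using pos neg' by (simp add: distrib_left)
  also have "\<dots> = (LINT u|lborel. indicator {0<..} u * f u + indicator {..<0} u * f u)"
    using pos neg by simp
  also have "\<dots> = (LINT u|lborel. f u)"
  proof (rule integral_cong_AE)
    show "AE u in lborel. indicator {0<..} u * f u + indicator {..<0} u * f u = f u"
      using AE_lborel_singleton[of "0::real"] by eventually_elim (auto simp: indicator_def)
  qed auto
  finally show "(LINT u|lborel. indicator {0<..} u * (f u + f (- u))) = (LINT u|lborel. f u)" .
qed

text \<open>A cut-off function with Lipschitz constant \<open>1 / Suc n\<close> that vanishes below \<open>- 2 Suc n\<close> and is \<open>1\<close> above
  \<open>- Suc n\<close>.\<close>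

definition ramp :: "nat \<Rightarrow> real \<Rightarrow> real" where
  "ramp n x = max 0 (min 1 (2 + x / real (Suc n)))"

lemma ramp_measurable [measurable]: "ramp n \<in> borel_measurable borel"
  unfolding ramp_def by measurable

lemma ramp_bounds: "0 \<le> ramp n x" "ramp n x \<le> 1"
  by (auto simp: ramp_def)

lemma ramp_Lipschitz: "\<bar>ramp n x - ramp n y\<bar> \<le> \<bar>x - y\<bar> / real (Suc n)"
proof -
  have "\<bar>ramp n x - ramp n y\<bar> \<le> \<bar>x / real (Suc n) - y / real (Suc n)\<bar>"
    by (auto simp: ramp_def max_def min_def abs_if)
  also have "\<dots> = \<bar>x - y\<bar> / real (Suc n)"
    by (simp add: diff_divide_distrib[symmetric])
  finally show ?thesis .
qed

lemma ramp_tendsto: "(\<lambda>n. ramp n x) \<longlonglongrightarrow> 1"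
proof (rule tendsto_eventually)
  obtain N :: nat where N: "\<bar>x\<bar> \<le> real N" using real_arch_simple by blast
  show "\<forall>\<^sub>F n in sequentially. ramp n x = 1"
  proof (rule eventually_sequentiallyI[of N])
    fix n assume "N \<le> n"
    then have "- real (Suc n) \<le> x" using N by linarith
    then have "- 1 \<le> x / real (Suc n)" by (simp add: pos_le_divide_eq)
    then show "ramp n x = 1" by (simp add: ramp_def)
  qed
qed

lemma ramp_le: "ramp n x \<le> min 1 (exp (2 * real (Suc n)) * exp x)"
proof (cases "x \<le> - 2 * real (Suc n)")
  case True
  then have "x / real (Suc n) \<le> - 2" by (simp add: pos_divide_le_eq)
  then have "ramp n x = 0" by (simp add: ramp_def)
  then show ?thesis by simp
next
  case False
  then have "1 \<le> exp (2 * real (Suc n) + x)" by simp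
  then have "1 \<le> exp (2 * real (Suc n)) * exp x" by (simp only: exp_add)
  then show ?thesis using ramp_bounds(2)[of n x] by linarith
qed

context bessel_start
begin

lemma
  assumes "u \<noteq> 0"
  shows integrable_profile: "integrable lborel (\<lambda>x. profile x * exp (- (2 * cosh u * exp (- x))))"
    and integral_profile: "(LINT x|lborel. profile x * exp (- (2 * cosh u * exp (- x)))) = rjump u"
proof -
  have eq: "(\<integral>\<^sup>+x. ennreal (profile x * exp (- (2 * cosh u * exp (- x)))) \<partial>lborel) = ennreal (rjump u)"
    using ennreal_rjump[OF assms] by (simp add: jump_def)
  show "integrable lborel (\<lambda>x. profile x * exp (- (2 * cosh u * exp (- x))))"
    using eq by (intro integrableI_nonneg) (auto simp: profile_nonneg)
  show "(LINT x|lborel. profile x * exp (- (2 * cosh u * exp (- x)))) = rjump u"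
    using eq by (intro integral_eq_nn_integral[THEN trans]) (auto simp: profile_nonneg rjump_nonneg)
qed

lemma
  shows integrable_kern: "integrable lborel (kern \<tau>)"
    and integral_kern: "(LINT u|lborel. kern \<tau> u) = exp (- \<beta> * \<tau>)"
  using integrable_kern_power[of \<tau> 0] integral_kern_power[of \<tau> 0] by (auto simp: gauss_diff_def)

lemma rjump_sq_le: "\<exists>K\<ge>0. \<forall>u. 0 < u \<longrightarrow> u \<le> 1 \<longrightarrow> rjump u * u\<^sup>2 \<le> K * (jker u * (gdev u)\<^sup>2)"
proof -
  obtain Cg where Cg: "Cg > 0" "\<And>u. min 1 \<bar>u\<bar> \<le> Cg * \<bar>gdev u\<bar>"
    using gdev_bounds by blast
  have "rjump u * u\<^sup>2 \<le> (exp \<bar>h - \<beta>\<bar> * Cg\<^sup>2) * (jker u * (gdev u)\<^sup>2)" if u: "0 < u" "u \<le> 1" for u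
  proof -
    have "u \<le> Cg * \<bar>gdev u\<bar>" using Cg(2)[of u] u by (simp add: min_def split: if_splits)
    then have "u\<^sup>2 \<le> (Cg * \<bar>gdev u\<bar>)\<^sup>2" using u by (intro power_mono) auto
    then have 1: "u\<^sup>2 \<le> Cg\<^sup>2 * (gdev u)\<^sup>2" by (simp add: power_mult_distrib)
    have "- \<bar>h - \<beta>\<bar> \<le> (h - \<beta>) * u"
    proof -
      have "\<bar>h - \<beta>\<bar> * u \<le> \<bar>h - \<beta>\<bar> * 1" using u by (intro mult_left_mono) auto
      then show ?thesis using u abs_ge_minus_self[of "(h - \<beta>) * u"] by (simp add: abs_mult)
    qed
    then have "1 \<le> exp \<bar>h - \<beta>\<bar> * exp ((h - \<beta>) * u)" by (simp add: mult_exp_exp)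
    then have "1 * rjump u \<le> exp \<bar>h - \<beta>\<bar> * exp ((h - \<beta>) * u) * rjump u"
      using rjump_nonneg by (intro mult_right_mono) auto
    then have "rjump u \<le> exp \<bar>h - \<beta>\<bar> * jker u" by (simp add: jker_def mult_ac)
    then have "rjump u * u\<^sup>2 \<le> (exp \<bar>h - \<beta>\<bar> * jker u) * (Cg\<^sup>2 * (gdev u)\<^sup>2)"
      using 1 rjump_nonneg[of u] jker_nonneg[of u] by (intro mult_mono) auto
    then show ?thesis by (simp add: mult_ac)
  qed
  then show ?thesis by (intro exI[of _ "exp \<bar>h - \<beta>\<bar> * Cg\<^sup>2"]) auto
qed

text \<open>The even part, up to a factor 2, of \<open>G\<close> times the weight \<open>exp ((h - \<beta>) * u)\<close>.\<close>

definition symm :: "(real \<Rightarrow> real) \<Rightarrow> real \<Rightarrow> real" where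
  "symm G u = exp ((h - \<beta>) * u) * G u + exp (- ((h - \<beta>) * u)) * G (- u)"

text \<open>For \<open>G\<close> of first order at \<open>0\<close>, the iterated integral (first over \<open>u\<close>, then over \<open>\<tau>\<close>) is the principal value of
  the integral against \<open>jker\<close>, although \<open>kern \<tau> u * G u\<close> need not be integrable in the plane. Inserting
  \<open>ramp n \<tau>\<close> approximates the left-hand side and inserting \<open>ramp n (\<tau> - u)\<close> the right-hand side; the
  difference is at most \<open>\<bar>u\<bar> / Suc n\<close>, and \<open>\<bar>u\<bar> * \<bar>G u\<bar>\<close> is of second order, hence integrable against
  \<open>kern\<close>.\<close>

lemma symmetrization:
  assumes [measurable]: "G \<in> borel_measurable borel"
    and supp: "\<And>u. \<bar>u\<bar> > 1 \<Longrightarrow> G u = 0"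
    and C: "C \<ge> 0" and G: "\<And>u. \<bar>G u\<bar> \<le> C * \<bar>gdev u\<bar>"
    and sym: "\<And>u. 0 < u \<Longrightarrow> u \<le> 1 \<Longrightarrow> \<bar>symm G u\<bar> \<le> C * u\<^sup>2"
    and A: "integrable lborel (\<lambda>\<tau>. LINT u|lborel. kern \<tau> u * G u)"
  shows "integrable lborel (\<lambda>u. indicator {0<..} u * (rjump u * symm G u))" (is ?int)
    and "(LINT \<tau>|lborel. LINT u|lborel. kern \<tau> u * G u) = (LINT u|lborel. indicator {0<..} u * (rjump u * symm G u))" (is ?eq)
proof -
  have [measurable]: "symm G \<in> borel_measurable borel" unfolding symm_def by measurable
  obtain Cg where Cg: "Cg > 0" "\<And>u. min 1 \<bar>u\<bar> \<le> Cg * \<bar>gdev u\<bar>"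
    using gdev_bounds by blast
  have small: "\<bar>u\<bar> \<le> Cg * \<bar>gdev u\<bar>" if "\<bar>u\<bar> \<le> 1" for u
    using Cg(2)[of u] that by (simp add: min_def split: if_splits)
  have uG: "\<bar>\<bar>u\<bar> * \<bar>G u\<bar>\<bar> \<le> (Cg * C) * (gdev u)\<^sup>2" for u
  proof (cases "\<bar>u\<bar> \<le> 1")
    case True
    have "\<bar>u\<bar> * \<bar>G u\<bar> \<le> (Cg * \<bar>gdev u\<bar>) * (C * \<bar>gdev u\<bar>)"
      using small[OF True] G[of u] Cg(1) by (intro mult_mono) auto
    then show ?thesis by (simp add: power2_eq_square mult_ac abs_mult)
  next
    case False
    then show ?thesis using supp[of u] Cg(1) C by simp
  qed
  have intQ: "integrable (lborel \<Otimes>\<^sub>M lborel) (\<lambda>(\<tau>, u). kern \<tau> u * (\<bar>u\<bar> * \<bar>G u\<bar>))"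
    by (rule integrable_pair_quadratic[OF _ uG]) measurable
  have GC: "\<bar>G u\<bar> \<le> C" for u
    using G[of u] abs_gdev_le_1[of u] C mult_left_mono[of "\<bar>gdev u\<bar>" 1 C] by linarith
  have kG: "integrable lborel (\<lambda>u. kern \<tau> u * G u)" for \<tau>
  proof (rule Bochner_Integration.integrable_bound)
    show "integrable lborel (\<lambda>u. C * kern \<tau> u)" by (intro integrable_mult_right integrable_kern)
    show "AE u in lborel. norm (kern \<tau> u * G u) \<le> norm (C * kern \<tau> u)"
    proof (intro AE_I2)
      fix u
      show "norm (kern \<tau> u * G u) \<le> norm (C * kern \<tau> u)"
        using mult_left_mono[OF GC[of u] kern_nonneg[of \<tau> u]] C
        by (simp add: abs_mult kern_nonneg mult.commute)
    qed
  qed measurable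
  \<comment> \<open>The cut-off in \<open>\<tau>\<close> makes the total mass finite, as \<open>kern \<tau>\<close> has mass \<open>exp (- \<beta> * \<tau>)\<close>.\<close>
  have ramp_kern: "integrable (lborel \<Otimes>\<^sub>M lborel) (\<lambda>(\<tau>, u). ramp n \<tau> * kern \<tau> u)" for n
  proof (rule lborel_pair.Fubini_integrable)
    have "integrable lborel (\<lambda>\<tau>. ramp n \<tau> * exp (- \<beta> * \<tau>))"
    proof (rule Bochner_Integration.integrable_bound)
      show "integrable lborel (\<lambda>\<tau>. min 1 (exp (2 * real (Suc n)) * exp \<tau>) * exp (- \<beta> * \<tau>))"
        by (rule integrable_min_exp[OF \<beta>]) simp
      have "\<bar>ramp n \<tau>\<bar> \<le> \<bar>min 1 (exp (2 * real (Suc n)) * exp \<tau>)\<bar>" for \<tau>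
        using ramp_le[of n \<tau>] ramp_bounds[of n \<tau>] by linarith
      then show "AE \<tau> in lborel. norm (ramp n \<tau> * exp (- \<beta> * \<tau>)) \<le>
          norm (min 1 (exp (2 * real (Suc n)) * exp \<tau>) * exp (- \<beta> * \<tau>))"
        by (intro AE_I2) (auto simp: abs_mult simp del: of_nat_Suc intro!: mult_right_mono)
    qed measurable
    moreover have "(LINT u|lborel. norm (case (\<tau>, u) of (\<tau>, u) \<Rightarrow> ramp n \<tau> * kern \<tau> u)) = ramp n \<tau> * exp (- \<beta> * \<tau>)" for \<tau>
      using ramp_bounds[of n \<tau>] by (simp add: abs_mult kern_nonneg integral_kern)
    ultimately show "integrable lborel (\<lambda>\<tau>. LINT u|lborel. norm (case (\<tau>, u) of (\<tau>, u) \<Rightarrow> ramp n \<tau> * kern \<tau> u))"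
      by simp
    show "AE \<tau> in lborel. integrable lborel (\<lambda>u. case (\<tau>, u) of (\<tau>, u) \<Rightarrow> ramp n \<tau> * kern \<tau> u)"
      using integrable_kern by simp
  qed measurable
  have int1: "integrable (lborel \<Otimes>\<^sub>M lborel) (\<lambda>(\<tau>, u). ramp n \<tau> * (kern \<tau> u * G u))" for n
  proof (rule Bochner_Integration.integrable_bound)
    show "integrable (lborel \<Otimes>\<^sub>M lborel) (\<lambda>x. C * (case x of (\<tau>, u) \<Rightarrow> ramp n \<tau> * kern \<tau> u))"
      by (intro integrable_mult_right ramp_kern)
    have "\<bar>ramp n \<tau> * (kern \<tau> u * G u)\<bar> \<le> \<bar>C * (ramp n \<tau> * kern \<tau> u)\<bar>" for \<tau> u
    proof -
      have "ramp n \<tau> * kern \<tau> u * \<bar>G u\<bar> \<le> ramp n \<tau> * kern \<tau> u * C"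
        using GC[of u] ramp_bounds[of n \<tau>] kern_nonneg[of \<tau> u] by (intro mult_left_mono) auto
      then show ?thesis using C ramp_bounds[of n \<tau>] kern_nonneg[of \<tau> u] by (simp add: abs_mult mult_ac)
    qed
    then show "AE x in lborel \<Otimes>\<^sub>M lborel. norm (case x of (\<tau>, u) \<Rightarrow> ramp n \<tau> * (kern \<tau> u * G u))
        \<le> norm (C * (case x of (\<tau>, u) \<Rightarrow> ramp n \<tau> * kern \<tau> u))"
      by (intro AE_I2) auto
  qed measurable
  have diff: "\<bar>ramp n \<tau> * (kern \<tau> u * G u) - ramp n (\<tau> - u) * (kern \<tau> u * G u)\<bar> \<le>
      kern \<tau> u * (\<bar>u\<bar> * \<bar>G u\<bar>) / real (Suc n)" for n \<tau> u
  proof -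
    have "\<bar>ramp n \<tau> * (kern \<tau> u * G u) - ramp n (\<tau> - u) * (kern \<tau> u * G u)\<bar> =
        \<bar>ramp n \<tau> - ramp n (\<tau> - u)\<bar> * (kern \<tau> u * \<bar>G u\<bar>)"
      using kern_nonneg[of \<tau> u] by (simp add: left_diff_distrib[symmetric] abs_mult)
    also have "\<dots> \<le> (\<bar>u\<bar> / real (Suc n)) * (kern \<tau> u * \<bar>G u\<bar>)"
      using ramp_Lipschitz[of n \<tau> "\<tau> - u"] kern_nonneg[of \<tau> u] by (intro mult_right_mono) auto
    finally show ?thesis by (simp add: mult_ac)
  qed
  have int12: "integrable (lborel \<Otimes>\<^sub>M lborel) (\<lambda>(\<tau>, u). ramp n \<tau> * (kern \<tau> u * G u) - ramp n (\<tau> - u) * (kern \<tau> u * G u))" for n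
  proof (rule Bochner_Integration.integrable_bound)
    show "integrable (lborel \<Otimes>\<^sub>M lborel) (\<lambda>x. (case x of (\<tau>, u) \<Rightarrow> kern \<tau> u * (\<bar>u\<bar> * \<bar>G u\<bar>)) / real (Suc n))"
      by (intro integrable_divide intQ)
    show "AE x in lborel \<Otimes>\<^sub>M lborel. norm (case x of (\<tau>, u) \<Rightarrow> ramp n \<tau> * (kern \<tau> u * G u) - ramp n (\<tau> - u) * (kern \<tau> u * G u))
        \<le> norm ((case x of (\<tau>, u) \<Rightarrow> kern \<tau> u * (\<bar>u\<bar> * \<bar>G u\<bar>)) / real (Suc n))"
      unfolding case_prod_beta real_norm_def by (intro AE_I2 order_trans[OF diff abs_ge_self])
  qed measurable
  \<comment> \<open>The cut-off in \<open>\<tau> - u\<close> inherits integrability from the one in \<open>\<tau>\<close> through the Lipschitz bound.\<close>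
  have int2: "integrable (lborel \<Otimes>\<^sub>M lborel) (\<lambda>(\<tau>, u). ramp n (\<tau> - u) * (kern \<tau> u * G u))" for n
    using Bochner_Integration.integrable_diff[OF int1[of n] int12[of n]] by (simp add: case_prod_beta')
  define L1 where "L1 n = (integral\<^sup>L (lborel \<Otimes>\<^sub>M lborel) (\<lambda>(\<tau>, u). ramp n \<tau> * (kern \<tau> u * G u)))" for n
  define L2 where "L2 n = (integral\<^sup>L (lborel \<Otimes>\<^sub>M lborel) (\<lambda>(\<tau>, u). ramp n (\<tau> - u) * (kern \<tau> u * G u)))" for n
  define Q where "Q = (integral\<^sup>L (lborel \<Otimes>\<^sub>M lborel) (\<lambda>(\<tau>, u). kern \<tau> u * (\<bar>u\<bar> * \<bar>G u\<bar>)))"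
  have L12: "\<bar>L1 n - L2 n\<bar> \<le> Q / real (Suc n)" for n
  proof -
    have "L1 n - L2 n = (integral\<^sup>L (lborel \<Otimes>\<^sub>M lborel) (\<lambda>(\<tau>, u). ramp n \<tau> * (kern \<tau> u * G u) - ramp n (\<tau> - u) * (kern \<tau> u * G u)))"
      unfolding L1_def L2_def using int1[of n] int2[of n] by (subst Bochner_Integration.integral_diff[symmetric]) (auto simp: case_prod_beta')
    moreover have "\<bar>integral\<^sup>L (lborel \<Otimes>\<^sub>M lborel) (\<lambda>(\<tau>, u). ramp n \<tau> * (kern \<tau> u * G u) - ramp n (\<tau> - u) * (kern \<tau> u * G u))\<bar>
        \<le> (LINT x|(lborel \<Otimes>\<^sub>M lborel). (case x of (\<tau>, u) \<Rightarrow> kern \<tau> u * (\<bar>u\<bar> * \<bar>G u\<bar>)) / real (Suc n))"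
      by (rule integral_abs_bound_integral[OF int12 integrable_divide[OF intQ]])
        (unfold case_prod_beta, rule diff)
    moreover have "(LINT x|(lborel \<Otimes>\<^sub>M lborel). (case x of (\<tau>, u) \<Rightarrow> kern \<tau> u * (\<bar>u\<bar> * \<bar>G u\<bar>)) / real (Suc n)) = Q / real (Suc n)"
      unfolding Q_def by (rule integral_divide_zero)
    ultimately show ?thesis by (simp only:)
  qed
  have "(\<lambda>n. Q / real (Suc n)) \<longlonglongrightarrow> 0"
    by (rule LIMSEQ_Suc[OF lim_const_over_n])
  then have d0: "(\<lambda>n. L1 n - L2 n) \<longlonglongrightarrow> 0"
    by (rule Lim_null_comparison[rotated]) (use L12 in \<open>auto simp del: of_nat_Suc\<close>)
  have "L1 n = (LINT \<tau>|lborel. ramp n \<tau> * (LINT u|lborel. kern \<tau> u * G u))" for n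
    unfolding L1_def using lborel_pair.integral_fst[OF int1[of n]] by simp
  moreover have "(\<lambda>n. LINT \<tau>|lborel. ramp n \<tau> * (LINT u|lborel. kern \<tau> u * G u)) \<longlonglongrightarrow> (LINT \<tau>|lborel. LINT u|lborel. kern \<tau> u * G u)"
  proof (rule integral_dominated_convergence)
    show "integrable lborel (\<lambda>\<tau>. \<bar>LINT u|lborel. kern \<tau> u * G u\<bar>)" using A by simp
    show "AE \<tau> in lborel. (\<lambda>n. ramp n \<tau> * (LINT u|lborel. kern \<tau> u * G u)) \<longlonglongrightarrow> (LINT u|lborel. kern \<tau> u * G u)"
      using tendsto_mult_right[OF ramp_tendsto] by (intro AE_I2) simp
    show "AE \<tau> in lborel. norm (ramp n \<tau> * (LINT u|lborel. kern \<tau> u * G u)) \<le> \<bar>LINT u|lborel. kern \<tau> u * G u\<bar>" for n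
      using ramp_bounds by (intro AE_I2) (auto simp: abs_mult intro!: mult_left_le_one_le)
  qed (use A in auto)
  ultimately have L1: "L1 \<longlonglongrightarrow> (LINT \<tau>|lborel. LINT u|lborel. kern \<tau> u * G u)"
    by (simp add: LIMSEQ_iff)
  define En where "En n u = (LINT x|lborel. ramp n x * (profile x * exp (- (2 * cosh u * exp (- x)))))" for n u
  have inner: "(LINT \<tau>|lborel. ramp n (\<tau> - u) * (kern \<tau> u * G u)) = exp ((h - \<beta>) * u) * G u * En n u" for n u
  proof -
    have "(LINT \<tau>|lborel. ramp n (\<tau> - u) * (kern \<tau> u * G u)) =
        (LINT x|lborel. ramp n (u + 1 * x - u) * (kern (u + 1 * x) u * G u))"
      by (subst lborel_integral_real_affine[where c=1 and t=u]) auto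
    also have "\<dots> = (LINT x|lborel. (exp ((h - \<beta>) * u) * G u) * (ramp n x * (profile x * exp (- (2 * cosh u * exp (- x))))))"
      by (intro Bochner_Integration.integral_cong) (auto simp: kern_def)
    finally show ?thesis unfolding En_def by simp
  qed
  have En_minus: "En n (- u) = En n u" for n u by (simp add: En_def)
  have L2_eq: "L2 n = (LINT u|lborel. indicator {0<..} u * (En n u * symm G u))" for n
  proof -
    have int: "integrable lborel (\<lambda>u. exp ((h - \<beta>) * u) * G u * En n u)"
      using lborel_pair.integrable_snd[OF int2[of n]] by (simp add: inner)
    have "L2 n = (LINT u|lborel. exp ((h - \<beta>) * u) * G u * En n u)"
      unfolding L2_def using lborel_pair.integral_snd[OF int2[of n]] by (simp add: inner)
    also have "\<dots> = (LINT u|lborel. indicator {0<..} u * (exp ((h - \<beta>) * u) * G u * En n u +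
        exp ((h - \<beta>) * - u) * G (- u) * En n (- u)))"
      by (rule integral_reflection_sum[OF int, symmetric])
    also have "\<dots> = (LINT u|lborel. indicator {0<..} u * (En n u * symm G u))"
      by (intro Bochner_Integration.integral_cong) (auto simp: symm_def En_minus algebra_simps)
    finally show ?thesis .
  qed
  have En_le: "\<bar>En n u\<bar> \<le> rjump u" if "u \<noteq> 0" for n u
    unfolding En_def integral_profile[OF that, symmetric]
  proof (rule integral_abs_bound_integral)
    have b: "\<bar>ramp n x * (profile x * exp (- (2 * cosh u * exp (- x))))\<bar> \<le> profile x * exp (- (2 * cosh u * exp (- x)))" for x
      using ramp_bounds[of n x] profile_nonneg[of x] by (auto simp: abs_mult intro!: mult_left_le_one_le)
    then show "\<bar>ramp n x * (profile x * exp (- (2 * cosh u * exp (- x))))\<bar> \<le> profile x * exp (- (2 * cosh u * exp (- x)))" for x .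
    show int: "integrable lborel (\<lambda>x. profile x * exp (- (2 * cosh u * exp (- x))))"
      by (rule integrable_profile[OF that])
    show "integrable lborel (\<lambda>x. ramp n x * (profile x * exp (- (2 * cosh u * exp (- x)))))"
      using b by (intro Bochner_Integration.integrable_bound[OF int]) (auto intro: order_trans[OF _ abs_ge_self])
  qed
  have En_lim: "(\<lambda>n. En n u) \<longlonglongrightarrow> rjump u" if "u \<noteq> 0" for u
    unfolding En_def integral_profile[OF that, symmetric]
  proof (rule integral_dominated_convergence)
    show "integrable lborel (\<lambda>x. profile x * exp (- (2 * cosh u * exp (- x))))"
      by (rule integrable_profile[OF that])
    show "AE x in lborel. (\<lambda>n. ramp n x * (profile x * exp (- (2 * cosh u * exp (- x))))) \<longlonglongrightarrow> profile x * exp (- (2 * cosh u * exp (- x)))"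
      using tendsto_mult_right[OF ramp_tendsto] by (intro AE_I2) simp
    show "AE x in lborel. norm (ramp n x * (profile x * exp (- (2 * cosh u * exp (- x))))) \<le> profile x * exp (- (2 * cosh u * exp (- x)))" for n
      using ramp_bounds profile_nonneg by (intro AE_I2) (auto simp: abs_mult intro!: mult_left_le_one_le)
  qed measurable
  obtain K0 where K0: "K0 \<ge> 0" "\<And>u. 0 < u \<Longrightarrow> u \<le> 1 \<Longrightarrow> rjump u * u\<^sup>2 \<le> K0 * (jker u * (gdev u)\<^sup>2)"
    using rjump_sq_le by blast
  define K where "K = C * K0"
  have dom: "indicator {0<..} u * (rjump u * \<bar>symm G u\<bar>) \<le> jker u * (K * (gdev u)\<^sup>2)" for u :: real
  proof (cases "0 < u \<and> u \<le> 1")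
    case True
    have "rjump u * \<bar>symm G u\<bar> \<le> rjump u * (C * u\<^sup>2)"
      using sym[of u] True by (intro mult_left_mono rjump_nonneg) auto
    also have "\<dots> = C * (rjump u * u\<^sup>2)" by (simp only: mult_ac)
    also have "\<dots> \<le> C * (K0 * (jker u * (gdev u)\<^sup>2))"
      using K0(2)[of u] True C by (intro mult_left_mono) auto
    finally show ?thesis using True by (simp add: K_def mult_ac)
  next
    case False
    then have "indicator {0<..} u * (rjump u * \<bar>symm G u\<bar>) = 0"
      using supp[of u] supp[of "- u"] by (auto simp: symm_def indicator_def)
    moreover have "0 \<le> jker u * (K * (gdev u)\<^sup>2)" using jker_nonneg[of u] C K0 by (simp add: K_def)
    ultimately show ?thesis by linarith
  qed
  have intK: "integrable lborel (\<lambda>u. jker u * (K * (gdev u)\<^sup>2))"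
    using C K0 by (intro integrable_jker_quadratic[where C=K]) (auto simp: K_def abs_mult)
  show ?int
  proof (rule Bochner_Integration.integrable_bound[OF intK])
    show "AE u in lborel. norm (indicator {0<..} u * (rjump u * symm G u)) \<le> norm (jker u * (K * (gdev u)\<^sup>2))"
    proof (intro AE_I2)
      fix u :: real
      have "norm (indicator {0<..} u * (rjump u * symm G u)) = indicator {0<..} u * (rjump u * \<bar>symm G u\<bar>)"
        by (simp add: abs_mult rjump_nonneg)
      also have "\<dots> \<le> jker u * (K * (gdev u)\<^sup>2)" by (rule dom)
      also have "\<dots> \<le> norm (jker u * (K * (gdev u)\<^sup>2))" unfolding real_norm_def by (rule abs_ge_self)
      finally show "norm (indicator {0<..} u * (rjump u * symm G u)) \<le> norm (jker u * (K * (gdev u)\<^sup>2))" .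
    qed
  qed measurable
  have "(\<lambda>n. LINT u|lborel. indicator {0<..} u * (En n u * symm G u)) \<longlonglongrightarrow> (LINT u|lborel. indicator {0<..} u * (rjump u * symm G u))"
  proof (rule integral_dominated_convergence[OF _ _ intK])
    show "AE u in lborel. (\<lambda>n. indicator {0<..} u * (En n u * symm G u)) \<longlonglongrightarrow> indicator {0<..} u * (rjump u * symm G u)"
      using AE_lborel_singleton[of "0::real"]
      by eventually_elim (auto intro!: tendsto_intros En_lim)
    show "AE u in lborel. norm (indicator {0<..} u * (En n u * symm G u)) \<le> jker u * (K * (gdev u)\<^sup>2)" for n
      using AE_lborel_singleton[of "0::real"]
    proof eventually_elim
      case (elim u)
      have "norm (indicator {0<..} u * (En n u * symm G u)) = indicator {0<..} u * (\<bar>En n u\<bar> * \<bar>symm G u\<bar>)"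
        by (simp add: abs_mult)
      also have "\<dots> \<le> indicator {0<..} u * (rjump u * \<bar>symm G u\<bar>)"
        using En_le[OF elim, of n] by (intro mult_left_mono mult_right_mono) auto
      also have "\<dots> \<le> jker u * (K * (gdev u)\<^sup>2)" by (rule dom)
      finally show ?case .
    qed
  qed (auto simp: En_def cosh_def)
  then have L2: "L2 \<longlonglongrightarrow> (LINT u|lborel. indicator {0<..} u * (rjump u * symm G u))"
    by (simp add: L2_eq LIMSEQ_iff)
  show ?eq
    using tendsto_diff[OF L1 L2] d0 LIMSEQ_unique by fastforce
qed

end

lemma second_difference_bound:
  fixes F F' F'' :: "real \<Rightarrow> real"
  assumes F: "\<And>x. (F has_real_derivative F' x) (at x)"
    and F': "\<And>x. (F' has_real_derivative F'' x) (at x)"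
    and cont: "continuous_on {-1..1} F''"
  shows "\<exists>M\<ge>0. \<forall>u. 0 < u \<longrightarrow> u \<le> 1 \<longrightarrow> \<bar>F u + F (- u) - 2 * F 0\<bar> \<le> M * u\<^sup>2"
proof -
  have "bounded (F'' ` {-1..1})" by (intro compact_imp_bounded compact_continuous_image cont) simp
  then obtain M where "\<forall>y\<in>F'' ` {-1..1}. norm y \<le> M"
    unfolding bounded_iff by blast
  then have M: "\<bar>F'' x\<bar> \<le> M" if "x \<in> {-1..1}" for x using that by auto
  have M0: "M \<ge> 0" using M[of 0] by auto
  have "\<bar>F u + F (- u) - 2 * F 0\<bar> \<le> (2 * M) * u\<^sup>2" if u: "0 < u" "u \<le> 1" for u
  proof -
    define H where "H x = F x + F (- x) - 2 * F 0" for x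
    have "(H has_real_derivative (F' x - F' (- x))) (at x)" for x
    proof -
      have "((\<lambda>x. F (- x)) has_real_derivative (F' (- x) * - 1)) (at x)"
        by (rule DERIV_chain2[OF F]) (auto intro!: derivative_eq_intros)
      then show ?thesis
        unfolding H_def by (auto intro!: derivative_eq_intros F)
    qed
    from MVT2[OF u(1), of H "\<lambda>x. F' x - F' (- x)"] this
    obtain \<xi> where \<xi>: "0 < \<xi>" "\<xi> < u" "H u - H 0 = (u - 0) * (F' \<xi> - F' (- \<xi>))" by blast
    have "- \<xi> < \<xi>" using \<xi> by simp
    from MVT2[OF this, of F' F''] F'
    obtain \<zeta> where \<zeta>: "- \<xi> < \<zeta>" "\<zeta> < \<xi>" "F' \<xi> - F' (- \<xi>) = (\<xi> - - \<xi>) * F'' \<zeta>" by blast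
    have "\<bar>H u\<bar> = u * ((2 * \<xi>) * \<bar>F'' \<zeta>\<bar>)"
      using \<xi> \<zeta> u by (simp add: H_def abs_mult)
    also have "\<dots> \<le> u * ((2 * u) * M)"
      using M[of \<zeta>] \<xi> \<zeta> u by (intro mult_mono) auto
    finally show ?thesis by (simp add: H_def power2_eq_square mult_ac)
  qed
  then show ?thesis using M0 by (intro exI[of _ "2 * M"]) auto
qed

context bessel_start
begin

lemma symm_gdev_bound: "\<exists>M\<ge>0. \<forall>u. 0 < u \<longrightarrow> u \<le> 1 \<longrightarrow> \<bar>symm gdev u\<bar> \<le> M * u\<^sup>2"
proof -
  define F where "F u = exp ((h - \<beta>) * u) * gdev u" for u
  define g1 where "g1 u = - (2 * a\<^sup>2 * exp (2 * u) * gexp u)" for u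
  define g2 where "g2 u = - (4 * a\<^sup>2 * exp (2 * u) * gexp u) + 4 * a\<^sup>2 * a\<^sup>2 * exp (2 * u) * exp (2 * u) * gexp u" for u
  have d1: "(gdev has_real_derivative g1 u) (at u)" for u
    unfolding g1_def by (rule gdev_deriv)
  have d2: "(g1 has_real_derivative g2 u) (at u)" for u
    unfolding g1_def[abs_def] g2_def gexp_def[abs_def]
    by (auto intro!: derivative_eq_intros simp: algebra_simps power2_eq_square)
  have e: "((\<lambda>u. exp ((h - \<beta>) * u)) has_real_derivative (h - \<beta>) * exp ((h - \<beta>) * u)) (at u)" for u
    by (auto intro!: derivative_eq_intros)
  have "\<exists>M\<ge>0. \<forall>u. 0 < u \<longrightarrow> u \<le> 1 \<longrightarrow> \<bar>F u + F (- u) - 2 * F 0\<bar> \<le> M * u\<^sup>2"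
  proof (rule second_difference_bound)
    show "(F has_real_derivative ((h - \<beta>) * exp ((h - \<beta>) * u) * gdev u + g1 u * exp ((h - \<beta>) * u))) (at u)" for u
      unfolding F_def by (rule DERIV_mult[OF e d1])
    have e': "((\<lambda>u. (h - \<beta>) * exp ((h - \<beta>) * u)) has_real_derivative (h - \<beta>) * ((h - \<beta>) * exp ((h - \<beta>) * u))) (at u)" for u
      by (rule DERIV_cmult[OF e])
    show "((\<lambda>u. (h - \<beta>) * exp ((h - \<beta>) * u) * gdev u + g1 u * exp ((h - \<beta>) * u)) has_real_derivative
        ((h - \<beta>) * ((h - \<beta>) * exp ((h - \<beta>) * u)) * gdev u + g1 u * ((h - \<beta>) * exp ((h - \<beta>) * u)) +
         (g2 u * exp ((h - \<beta>) * u) + (h - \<beta>) * exp ((h - \<beta>) * u) * g1 u))) (at u)" for u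
      by (rule DERIV_add[OF DERIV_mult[OF e' d1] DERIV_mult[OF d2 e]])
    show "continuous_on {-1..1} (\<lambda>u. ((h - \<beta>) * ((h - \<beta>) * exp ((h - \<beta>) * u)) * gdev u + g1 u * ((h - \<beta>) * exp ((h - \<beta>) * u)) +
         (g2 u * exp ((h - \<beta>) * u) + (h - \<beta>) * exp ((h - \<beta>) * u) * g1 u)))"
      unfolding gdev_def g1_def g2_def gexp_def by (intro continuous_intros)
  qed
  moreover have "F u + F (- u) - 2 * F 0 = symm gdev u" for u
    by (simp add: F_def symm_def gdev_0)
  ultimately show ?thesis by simp
qed

text \<open>The principal value at \<open>0\<close> of the integral of \<open>jker u * G u\<close>, as the integral over \<open>u > 0\<close> of the sum of the
  contributions of \<open>u\<close> and \<open>- u\<close>.\<close>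

definition pvint :: "(real \<Rightarrow> real) \<Rightarrow> real" where
  "pvint G = (LINT u|lborel. indicator {0<..} u * (rjump u * symm G u))"

lemma jker_symm: "jker u * G u + jker (- u) * G (- u) = rjump u * symm G u"
  by (simp add: jker_def symm_def rjump_minus algebra_simps)

lemma
  assumes "integrable lborel (\<lambda>u. jker u * G u)"
  shows integrable_jker_symm: "integrable lborel (\<lambda>u. indicator {0<..} u * (rjump u * symm G u))"
    and pvint_eq: "pvint G = (LINT u|lborel. jker u * G u)"
  using integrable_reflection_sum[OF assms] integral_reflection_sum[OF assms] unfolding jker_symm pvint_def by auto

lemma integral_kern_gdev:
  shows "integrable lborel (\<lambda>u. kern \<tau> u * gdev u)"
    and "(LINT u|lborel. kern \<tau> u * gdev u) = gauss_diff h (a\<^sup>2) \<tau> * exp (- \<beta> * \<tau>)"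
proof -
  define c where "c = (\<lambda>i::nat. if i = 0 then - x0 else 1)"
  have c: "x - x0 = (\<Sum>i\<le>1. c i * x ^ i)" for x
    by (simp add: c_def)
  show "integrable lborel (\<lambda>u. kern \<tau> u * gdev u)"
    using integrable_kern_poly[OF c] by (simp add: gdev_def)
  have "(\<Sum>i\<le>1. c i * gauss_diff h (real i * a\<^sup>2) \<tau>) = gauss_diff h (a\<^sup>2) \<tau>"
    by (simp add: c_def gauss_diff_def)
  then show "(LINT u|lborel. kern \<tau> u * gdev u) = gauss_diff h (a\<^sup>2) \<tau> * exp (- \<beta> * \<tau>)"
    using integral_kern_poly[OF c, of \<tau>] by (simp add: gdev_def)
qed

lemma symm_add: "symm (\<lambda>u. F u + G u) v = symm F v + symm G v"
  by (simp add: symm_def algebra_simps)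

text \<open>Near \<open>0\<close> this is the symmetrization lemma, away from \<open>0\<close> it is Fubini's theorem.\<close>

lemma
  shows integrable_symm_gdev: "integrable lborel (\<lambda>u. indicator {0<..} u * (rjump u * symm gdev u))"
    and pvint_gdev: "pvint gdev = (LINT \<tau>|lborel. gauss_diff h (a\<^sup>2) \<tau> * exp (- \<beta> * \<tau>))"
proof -
  define G1 where "G1 u = indicator {-1..1} u * gdev u" for u
  define G2 where "G2 u = indicator (- {-1..1}) u * gdev u" for u
  have [measurable]: "G1 \<in> borel_measurable borel" "G2 \<in> borel_measurable borel"
    unfolding G1_def[abs_def] G2_def[abs_def] by measurable
  have split: "gdev u = G1 u + G2 u" for u by (simp add: G1_def G2_def indicator_def)
  obtain Cg where Cg: "Cg > 0" "\<And>u. min 1 \<bar>u\<bar> \<le> Cg * \<bar>gdev u\<bar>"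
    using gdev_bounds by blast
  have G2: "\<bar>G2 u\<bar> \<le> Cg * (gdev u)\<^sup>2" for u
  proof (cases "u \<in> {-1..1}")
    case False
    then have "1 \<le> Cg * \<bar>gdev u\<bar>" using Cg(2)[of u] by (auto simp: min_def split: if_splits)
    then have "1 * \<bar>gdev u\<bar> \<le> (Cg * \<bar>gdev u\<bar>) * \<bar>gdev u\<bar>" by (intro mult_right_mono) auto
    then show ?thesis using False by (simp add: G2_def power2_eq_square mult_ac abs_mult)
  qed (use Cg in \<open>simp add: G2_def\<close>)
  note q = integrable_pair_quadratic[OF _ G2] integrable_jker_quadratic[OF _ G2]
    integrable_kern_quadratic[OF _ G2] integral_jker_quadratic[OF _ G2]
  have k2: "integrable lborel (\<lambda>u. kern \<tau> u * G2 u)" and k1: "integrable lborel (\<lambda>u. kern \<tau> u * G1 u)" for \<tau>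
    by (rule Bochner_Integration.integrable_bound[OF integral_kern_gdev(1)[of \<tau>]];
        auto simp: G1_def G2_def indicator_def)+
  have kg: "(LINT u|lborel. kern \<tau> u * gdev u) = (LINT u|lborel. kern \<tau> u * G1 u) + (LINT u|lborel. kern \<tau> u * G2 u)" for \<tau>
    using k1 k2 by (simp add: split distrib_left)
  have A0: "integrable lborel (\<lambda>\<tau>. LINT u|lborel. kern \<tau> u * gdev u)"
    unfolding integral_kern_gdev(2) by (rule integrable_gauss_diff) simp
  have A2: "integrable lborel (\<lambda>\<tau>. LINT u|lborel. kern \<tau> u * G2 u)"
    by (rule q(3)) measurable
  have A1: "integrable lborel (\<lambda>\<tau>. LINT u|lborel. kern \<tau> u * G1 u)"
    using Bochner_Integration.integrable_diff[OF A0 A2] by (simp add: kg)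
  obtain M where M: "M \<ge> 0" "\<And>u. 0 < u \<Longrightarrow> u \<le> 1 \<Longrightarrow> \<bar>symm gdev u\<bar> \<le> M * u\<^sup>2"
    using symm_gdev_bound by blast
  define C where "C = max 1 M"
  have s: "\<bar>u\<bar> > 1 \<Longrightarrow> G1 u = 0" "C \<ge> 0" "\<bar>G1 u\<bar> \<le> C * \<bar>gdev u\<bar>"
    "0 < u \<Longrightarrow> u \<le> 1 \<Longrightarrow> \<bar>symm G1 u\<bar> \<le> C * u\<^sup>2" for u
  proof -
    show "\<bar>u\<bar> > 1 \<Longrightarrow> G1 u = 0" by (auto simp: G1_def indicator_def)
    show "C \<ge> 0" by (simp add: C_def)
    have "1 * \<bar>gdev u\<bar> \<le> C * \<bar>gdev u\<bar>" by (intro mult_right_mono) (auto simp: C_def)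
    then show "\<bar>G1 u\<bar> \<le> C * \<bar>gdev u\<bar>" by (auto simp: G1_def indicator_def)
    assume u: "0 < u" "u \<le> 1"
    then have "symm G1 u = symm gdev u" by (simp add: symm_def G1_def)
    moreover have "M * u\<^sup>2 \<le> C * u\<^sup>2" by (intro mult_right_mono) (auto simp: C_def)
    ultimately show "\<bar>symm G1 u\<bar> \<le> C * u\<^sup>2" using M(2)[OF u] by linarith
  qed
  note sym = symmetrization[of G1 C, OF _ s A1]
  have i1: "integrable lborel (\<lambda>u. indicator {0<..} u * (rjump u * symm G1 u))"
    by (rule sym(1)) auto
  have p1: "(LINT \<tau>|lborel. LINT u|lborel. kern \<tau> u * G1 u) = pvint G1"
    unfolding pvint_def by (rule sym(2)) auto
  have j2: "integrable lborel (\<lambda>u. jker u * G2 u)" by (rule q(2)) measurable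
  have i2: "integrable lborel (\<lambda>u. indicator {0<..} u * (rjump u * symm G2 u))"
    by (rule integrable_jker_symm[OF j2])
  have p2: "(LINT \<tau>|lborel. LINT u|lborel. kern \<tau> u * G2 u) = pvint G2"
    unfolding pvint_eq[OF j2] by (rule q(4)) measurable
  have gd: "gdev = (\<lambda>u. G1 u + G2 u)" using split by auto
  have f: "indicator {0<..} u * (rjump u * symm gdev u) =
      indicator {0<..} u * (rjump u * symm G1 u) + indicator {0<..} u * (rjump u * symm G2 u)" for u :: real
    unfolding gd symm_add by (simp add: distrib_left)
  show "integrable lborel (\<lambda>u. indicator {0<..} u * (rjump u * symm gdev u))"
    unfolding f using i1 i2 by (rule Bochner_Integration.integrable_add)
  have "pvint gdev = pvint G1 + pvint G2"
    unfolding pvint_def f using i1 i2 by (rule Bochner_Integration.integral_add)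
  also have "\<dots> = (LINT \<tau>|lborel. LINT u|lborel. kern \<tau> u * gdev u)"
    unfolding p1[symmetric] p2[symmetric] kg using A1 A2 by (rule Bochner_Integration.integral_add[symmetric])
  finally show "pvint gdev = (LINT \<tau>|lborel. gauss_diff h (a\<^sup>2) \<tau> * exp (- \<beta> * \<tau>))"
    unfolding integral_kern_gdev(2) .
qed

text \<open>For \<open>\<beta> < 1/2\<close> the first-order integral converges absolutely: for \<open>\<tau> \<le> 0\<close>, the mean of \<open>\<bar>gdev\<bar>\<close> under the normalized
  \<open>kern \<tau>\<close> is at most the square root of the mean of \<open>gdev\<^sup>2\<close>, hence of order \<open>exp (\<tau> / 2)\<close>. The proof uses
  \<open>\<bar>x\<bar> \<le> r + x\<^sup>2 / r\<close> with \<open>r = exp (\<tau> / 2)\<close> in place of the Cauchy-Schwarz inequality.\<close>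

lemma integrable_jker_gdev:
  assumes "\<beta> < 1 / 2"
  shows "integrable lborel (\<lambda>u. jker u * gdev u)"
proof -
  define V where "V \<tau> = gauss_diff h (2 * a\<^sup>2) \<tau> - 2 * x0 * gauss_diff h (a\<^sup>2) \<tau>" for \<tau>
  define C where "C = ((2 * a\<^sup>2)\<^sup>2 + h * (2 * a\<^sup>2)) + 2 * ((a\<^sup>2)\<^sup>2 + h * a\<^sup>2)"
  have C: "C \<ge> 0" using h by (simp add: C_def)
  have V: "V \<tau> \<le> C * exp \<tau>" for \<tau>
  proof -
    have "\<bar>gauss_diff h (2 * a\<^sup>2) \<tau>\<bar> \<le> ((2 * a\<^sup>2)\<^sup>2 + h * (2 * a\<^sup>2)) * exp \<tau>"
      using abs_gauss_diff_le[of h "2 * a\<^sup>2" \<tau>] h by simp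
    moreover have "\<bar>gauss_diff h (a\<^sup>2) \<tau>\<bar> \<le> ((a\<^sup>2)\<^sup>2 + h * a\<^sup>2) * exp \<tau>"
      using abs_gauss_diff_le[of h "a\<^sup>2" \<tau>] h by simp
    moreover have "\<bar>2 * x0 * gauss_diff h (a\<^sup>2) \<tau>\<bar> \<le> 2 * \<bar>gauss_diff h (a\<^sup>2) \<tau>\<bar>"
      using x0_bounds by (simp add: abs_mult mult_left_le_one_le)
    ultimately have "V \<tau> \<le> ((2 * a\<^sup>2)\<^sup>2 + h * (2 * a\<^sup>2)) * exp \<tau> + 2 * (((a\<^sup>2)\<^sup>2 + h * a\<^sup>2) * exp \<tau>)"
      unfolding V_def by linarith
    then show ?thesis by (simp add: C_def algebra_simps)
  qed
  have ka: "integrable lborel (\<lambda>u. kern \<tau> u * \<bar>gdev u\<bar>)" for \<tau>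
    using integrable_abs[OF integral_kern_gdev(1)[of \<tau>]] by (simp add: abs_mult kern_nonneg)
  have bound: "(LINT u|lborel. kern \<tau> u * \<bar>gdev u\<bar>) \<le> (1 + C) * (min 1 (1 * exp (\<tau> / 2)) * exp (- \<beta> * \<tau>))" for \<tau>
  proof (cases "\<tau> \<le> 0")
    case False
    have "(LINT u|lborel. kern \<tau> u * \<bar>gdev u\<bar>) \<le> (LINT u|lborel. kern \<tau> u)"
      using abs_gdev_le_1 kern_nonneg[of \<tau>]
      by (intro integral_mono ka integrable_kern) (simp add: mult_left_le)
    also have "\<dots> = 1 * exp (- \<beta> * \<tau>)" by (simp add: integral_kern)
    also have "\<dots> \<le> (1 + C) * exp (- \<beta> * \<tau>)" using C by (intro mult_right_mono) auto
    finally show ?thesis using False by (simp add: min_def)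
  next
    case True
    define r where "r = exp (\<tau> / 2)"
    have r: "r > 0" "r * r = exp \<tau>" by (auto simp: r_def mult_exp_exp)
    have pw: "\<bar>x\<bar> \<le> r + x\<^sup>2 / r" for x
    proof -
      have "0 \<le> (\<bar>x\<bar> - r)\<^sup>2" by simp
      also have "(\<bar>x\<bar> - r)\<^sup>2 = x\<^sup>2 + r * r - 2 * r * \<bar>x\<bar>" by (simp add: power2_eq_square algebra_simps)
      finally have "r * \<bar>x\<bar> \<le> x\<^sup>2 + r * r" using r(1) mult_nonneg_nonneg[of r "\<bar>x\<bar>"] by linarith
      then show ?thesis using r(1) by (simp add: field_simps)
    qed
    have "(LINT u|lborel. kern \<tau> u * \<bar>gdev u\<bar>) \<le> (LINT u|lborel. r * kern \<tau> u + (kern \<tau> u * (gdev u)\<^sup>2) / r)"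
    proof (rule integral_mono[OF ka])
      show "integrable lborel (\<lambda>u. r * kern \<tau> u + (kern \<tau> u * (gdev u)\<^sup>2) / r)"
        by (intro Bochner_Integration.integrable_add integrable_mult_right integrable_divide integrable_kern integrable_kern_sq)
      fix u
      show "kern \<tau> u * \<bar>gdev u\<bar> \<le> r * kern \<tau> u + (kern \<tau> u * (gdev u)\<^sup>2) / r"
        using mult_left_mono[OF pw[of "gdev u"] kern_nonneg[of \<tau> u]] by (simp add: distrib_left mult_ac)
    qed
    also have "\<dots> = (LINT u|lborel. r * kern \<tau> u) + (LINT u|lborel. (kern \<tau> u * (gdev u)\<^sup>2) / r)"
      by (intro Bochner_Integration.integral_add integrable_mult_right integrable_divide integrable_kern integrable_kern_sq)
    also have "\<dots> = r * exp (- \<beta> * \<tau>) + V \<tau> * exp (- \<beta> * \<tau>) / r"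
      by (simp add: integral_kern integral_kern_sq V_def)
    also have "\<dots> \<le> r * exp (- \<beta> * \<tau>) + (C * (r * r)) * exp (- \<beta> * \<tau>) / r"
      using V[of \<tau>] r by (intro add_left_mono divide_right_mono mult_right_mono) auto
    also have "\<dots> = (1 + C) * (r * exp (- \<beta> * \<tau>))" using r(1) by (simp add: field_simps)
    also have "r = min 1 (1 * exp (\<tau> / 2))" using True by (simp add: r_def min_def)
    finally show ?thesis .
  qed
  have ib: "integrable lborel (\<lambda>\<tau>. min 1 (1 * exp (\<tau> / 2)) * exp (- \<beta> * \<tau>))"
  proof -
    have "integrable lborel (\<lambda>\<sigma>. min 1 (1 * exp \<sigma>) * exp (- (2 * \<beta>) * \<sigma>))"
      using assms \<beta> by (intro integrable_min_exp) auto
    then have "integrable lborel (\<lambda>\<tau>. min 1 (1 * exp (0 + (1/2) * \<tau>)) * exp (- (2 * \<beta>) * (0 + (1/2) * \<tau>)))"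
      by (subst lborel_integrable_real_affine_iff) auto
    then show ?thesis by simp
  qed
  have int: "integrable (lborel \<Otimes>\<^sub>M lborel) (\<lambda>(\<tau>, u). kern \<tau> u * gdev u)"
  proof (rule lborel_pair.Fubini_integrable)
    have n: "(LINT u|lborel. norm (case (\<tau>, u) of (\<tau>, u) \<Rightarrow> kern \<tau> u * gdev u)) = (LINT u|lborel. kern \<tau> u * \<bar>gdev u\<bar>)" for \<tau>
      by (simp add: abs_mult kern_nonneg)
    show "integrable lborel (\<lambda>\<tau>. LINT u|lborel. norm (case (\<tau>, u) of (\<tau>, u) \<Rightarrow> kern \<tau> u * gdev u))"
      unfolding n
    proof (rule Bochner_Integration.integrable_bound[OF integrable_mult_right[OF ib, of "1 + C"]])
      show "AE \<tau> in lborel. norm (LINT u|lborel. kern \<tau> u * \<bar>gdev u\<bar>) \<le> norm ((1 + C) * (min 1 (1 * exp (\<tau> / 2)) * exp (- \<beta> * \<tau>)))"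
      proof (intro AE_I2)
        fix \<tau> :: real
        have "0 \<le> (LINT u|lborel. kern \<tau> u * \<bar>gdev u\<bar>)"
          by (intro Bochner_Integration.integral_nonneg) (simp add: kern_nonneg)
        then show "norm (LINT u|lborel. kern \<tau> u * \<bar>gdev u\<bar>) \<le> norm ((1 + C) * (min 1 (1 * exp (\<tau> / 2)) * exp (- \<beta> * \<tau>)))"
          using bound[of \<tau>] unfolding real_norm_def by linarith
      qed
    qed measurable
    show "AE \<tau> in lborel. integrable lborel (\<lambda>u. case (\<tau>, u) of (\<tau>, u) \<Rightarrow> kern \<tau> u * gdev u)"
      using integral_kern_gdev(1) by simp
  qed measurable
  have i: "integrable lborel (\<lambda>u. LINT \<tau>|lborel. kern \<tau> u * gdev u)"
    using lborel_pair.integrable_snd[OF int] by simp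
  have e: "AE u in lborel. (LINT \<tau>|lborel. kern \<tau> u * gdev u) = jker u * gdev u"
    using AE_lborel_singleton[of "0::real"]
    by eventually_elim (simp add: integrable_kern_left integral_kern_left)
  show ?thesis
    by (rule integrable_cong_AE_imp[OF i _ e]) measurable
qed

end

section \<open>Principal values\<close>

text \<open>The window \<open>\<bar>y - 1\<bar> \<le> \<epsilon>\<close> in the variable \<open>ln y\<close>: its two half-widths differ by at most \<open>2 \<epsilon>\<^sup>2\<close>.\<close>

lemma log_interval_bounds:
  fixes \<epsilon> :: real
  assumes "0 < \<epsilon>" "\<epsilon> \<le> 1 / 2"
  shows "\<epsilon> / 2 \<le> ln (1 + \<epsilon>)" "ln (1 + \<epsilon>) \<le> - ln (1 - \<epsilon>)" "- ln (1 - \<epsilon>) \<le> 2 * \<epsilon>"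
    "- ln (1 - \<epsilon>) - ln (1 + \<epsilon>) \<le> 2 * \<epsilon>\<^sup>2"
proof -
  have inv: "- ln x \<le> 1 / x - 1" if "x > 0" for x :: real
    using ln_le_minus_one[of "1 / x"] that by (simp add: ln_div)
  have "1 - 1 / (1 + \<epsilon>) \<le> ln (1 + \<epsilon>)" using inv[of "1 + \<epsilon>"] assms by simp
  moreover have "\<epsilon> / 2 \<le> 1 - 1 / (1 + \<epsilon>)" using assms by (simp add: field_simps)
  ultimately show "\<epsilon> / 2 \<le> ln (1 + \<epsilon>)" by linarith
  have "1 / (1 - \<epsilon>) - 1 \<le> 2 * \<epsilon>" using assms by (simp add: field_simps)
  then show "- ln (1 - \<epsilon>) \<le> 2 * \<epsilon>" using inv[of "1 - \<epsilon>"] assms by linarith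
  have sq: "\<epsilon>\<^sup>2 \<le> 1 / 4" using assms power_mono[of \<epsilon> "1/2" 2] by (simp add: power2_eq_square)
  have sum: "ln (1 - \<epsilon>) + ln (1 + \<epsilon>) = ln (1 - \<epsilon>\<^sup>2)"
  proof -
    have "ln ((1 - \<epsilon>) * (1 + \<epsilon>)) = ln (1 - \<epsilon>) + ln (1 + \<epsilon>)"
      using assms by (intro ln_mult_pos) auto
    then show ?thesis by (simp add: power2_eq_square algebra_simps)
  qed
  have "1 / (1 - \<epsilon>\<^sup>2) - 1 \<le> 2 * \<epsilon>\<^sup>2"
  proof -
    have "\<epsilon>\<^sup>2 * (1 - 2 * \<epsilon>\<^sup>2) \<ge> 0" using sq by (intro mult_nonneg_nonneg) auto
    then show ?thesis using sq by (simp add: field_simps)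
  qed
  then show "- ln (1 - \<epsilon>) - ln (1 + \<epsilon>) \<le> 2 * \<epsilon>\<^sup>2"
    using inv[of "1 - \<epsilon>\<^sup>2"] sq sum by linarith
  have "ln (1 - \<epsilon>\<^sup>2) \<le> 0" using sq by (subst ln_le_zero_iff) auto
  then show "ln (1 + \<epsilon>) \<le> - ln (1 - \<epsilon>)" using sum by linarith
qed

context bessel_start
begin

text \<open>The integral of \<open>u\<^sup>2 * rjump u\<close> over \<open>[x/2, x]\<close> tends to \<open>0\<close> with \<open>x\<close>, and by monotonicity it is at least
  \<open>x\<^sup>3 * rjump x / 8\<close>.\<close>

lemma cube_rjump_tendsto: "((\<lambda>x. x ^ 3 * rjump x) \<longlongrightarrow> 0) (at_right 0)"
proof (rule tendsto_at_right_sequentially[of 0 1])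
  fix S :: "nat \<Rightarrow> real"
  assume S: "\<And>n. 0 < S n" "\<And>n. S n < 1" "S \<longlonglongrightarrow> 0"
  obtain K where K: "K \<ge> 0" "\<And>u. 0 < u \<Longrightarrow> u \<le> 1 \<Longrightarrow> rjump u * u\<^sup>2 \<le> K * (jker u * (gdev u)\<^sup>2)"
    using rjump_sq_le by blast
  have intK: "integrable lborel (\<lambda>u. K * (jker u * (gdev u)\<^sup>2))"
    by (intro integrable_mult_right integrable_jker_quadratic[where C=1]) auto
  let ?f = "\<lambda>n u. indicator {0<..S n} u * (rjump u * u\<^sup>2)"
  have dom: "norm (?f n u) \<le> K * (jker u * (gdev u)\<^sup>2)" for n u
    using K(2)[of u] S(2)[of n] K(1) rjump_nonneg[of u] jker_nonneg[of u] by (auto simp: indicator_def abs_mult)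
  have int: "integrable lborel (?f n)" for n
    by (rule Bochner_Integration.integrable_bound[OF intK])
       (use dom[of n] in \<open>auto intro: order_trans[OF _ abs_ge_self]\<close>)
  have lim: "(\<lambda>n. LINT u|lborel. ?f n u) \<longlonglongrightarrow> (LINT u|(lborel :: real measure). 0)"
  proof (rule integral_dominated_convergence[OF _ _ intK])
    show "AE u in lborel. (\<lambda>n. ?f n u) \<longlonglongrightarrow> 0"
    proof (intro AE_I2)
      fix u :: real
      show "(\<lambda>n. ?f n u) \<longlonglongrightarrow> 0"
      proof (cases "u > 0")
        case True
        have "\<forall>\<^sub>F n in sequentially. S n < u" using S(3) True by (rule order_tendstoD(2))
        then have "\<forall>\<^sub>F n in sequentially. ?f n u = 0" by eventually_elim simp
        then show ?thesis by (rule tendsto_eventually)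
      qed simp
    qed
    show "AE u in lborel. norm (?f n u) \<le> K * (jker u * (gdev u)\<^sup>2)" for n using dom by simp
  qed measurable
  have le: "S n ^ 3 * rjump (S n) \<le> 8 * (LINT u|lborel. ?f n u)" for n
  proof -
    have "(LINT u|lborel. indicator {S n / 2..S n} u * (rjump (S n) * (S n / 2)\<^sup>2)) \<le> (LINT u|lborel. ?f n u)"
    proof (rule integral_mono)
      show "integrable lborel (\<lambda>u. indicator {S n / 2..S n} u * (rjump (S n) * (S n / 2)\<^sup>2))"
        by (intro integrable_mult_left integrable_real_indicator) (auto simp: S less_imp_le)
      show "integrable lborel (?f n)" by (rule int)
      fix u
      show "indicator {S n / 2..S n} u * (rjump (S n) * (S n / 2)\<^sup>2) \<le> ?f n u"
      proof (cases "u \<in> {S n / 2..S n}")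
        case True
        then have u: "0 < u" "S n / 2 \<le> u" "u \<le> S n" using S(1)[of n] by auto
        have "rjump (S n) * (S n / 2)\<^sup>2 \<le> rjump u * u\<^sup>2"
          using u S(1)[of n] rjump_nonneg by (intro mult_mono power_mono rjump_mono) auto
        then show ?thesis using u True by simp
      qed (use rjump_nonneg in auto)
    qed
    moreover have "(LINT u|lborel. indicator {S n / 2..S n} u * (rjump (S n) * (S n / 2)\<^sup>2)) = S n / 2 * (rjump (S n) * (S n / 2)\<^sup>2)"
      using S(1)[of n] by simp
    ultimately have "S n / 2 * (rjump (S n) * (S n / 2)\<^sup>2) \<le> (LINT u|lborel. ?f n u)" by (simp only:)
    moreover have "S n ^ 3 * rjump (S n) = 8 * (S n / 2 * (rjump (S n) * (S n / 2)\<^sup>2))"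
      by (simp add: power2_eq_square power3_eq_cube)
    ultimately show ?thesis by linarith
  qed
  have "(\<lambda>n. 8 * (LINT u|lborel. ?f n u)) \<longlonglongrightarrow> 0"
    using tendsto_mult_left[OF lim, of 8] by simp
  then show "(\<lambda>n. S n ^ 3 * rjump (S n)) \<longlonglongrightarrow> 0"
    by (rule tendsto_sandwich[OF always_eventually always_eventually tendsto_const, rotated 2])
       (use le S(1) rjump_nonneg in \<open>auto simp: less_imp_le\<close>)
qed simp

text \<open>For \<open>G\<close> of first order, the integral over \<open>\<bar>exp u - 1\<bar> > \<epsilon>\<close> splits into one over a symmetric set and one over an
  interval of length \<open>O(\<epsilon>\<^sup>2)\<close>, on which \<open>G\<close> is \<open>O(\<epsilon>)\<close> and \<open>rjump\<close> is at most \<open>rjump (\<epsilon> / 2)\<close>.\<close>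

lemma
  assumes [measurable]: "G \<in> borel_measurable borel" and C: "C \<ge> 0" and G: "\<And>u. \<bar>G u\<bar> \<le> C * \<bar>gdev u\<bar>"
  shows integrable_truncated: "\<epsilon> > 0 \<Longrightarrow> integrable lborel (\<lambda>u. indicator {u. \<bar>exp u - 1\<bar> > \<epsilon>} u * (jker u * G u))"
    and truncated_tendsto_pvint: "integrable lborel (\<lambda>u. indicator {0<..} u * (rjump u * symm G u)) \<Longrightarrow>
      ((\<lambda>\<epsilon>. LINT u|lborel. indicator {u. \<bar>exp u - 1\<bar> > \<epsilon>} u * (jker u * G u)) \<longlongrightarrow> pvint G) (at_right 0)"
proof -
  let ?S = "\<lambda>\<epsilon>. {u::real. \<bar>exp u - 1\<bar> > \<epsilon>}"
  have [measurable]: "symm G \<in> borel_measurable borel" unfolding symm_def by measurable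
  have [measurable]: "?S \<epsilon> \<in> sets borel" for \<epsilon> by measurable
  obtain Cg where Cg: "Cg > 0" "\<And>u. min 1 \<bar>u\<bar> \<le> Cg * \<bar>gdev u\<bar>" "\<And>u. \<bar>u\<bar> \<le> 1 \<Longrightarrow> \<bar>gdev u\<bar> \<le> Cg * \<bar>u\<bar>"
    using gdev_bounds by blast
  have away: "integrable lborel (\<lambda>u. indicator A u * (jker u * G u))"
    if A: "A \<in> sets borel" and l: "l > 0" "\<And>u. u \<in> A \<Longrightarrow> l \<le> \<bar>u\<bar>" for A l
  proof -
    note [measurable] = A
    define m where "m = min 1 l"
    have m: "m > 0" using l by (simp add: m_def)
    have "\<bar>indicator A u * G u\<bar> \<le> (C * (Cg / m)) * (gdev u)\<^sup>2" for u
    proof (cases "u \<in> A")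
      case True
      then have "m \<le> Cg * \<bar>gdev u\<bar>" using Cg(2)[of u] l(2)[of u] by (auto simp: m_def)
      then have "1 \<le> (Cg / m) * \<bar>gdev u\<bar>" using m by (simp add: field_simps)
      then have "1 * (C * \<bar>gdev u\<bar>) \<le> ((Cg / m) * \<bar>gdev u\<bar>) * (C * \<bar>gdev u\<bar>)" using C by (intro mult_right_mono) auto
      then show ?thesis using G[of u] True by (simp add: power2_eq_square mult_ac abs_mult)
    qed (use C Cg m in simp)
    from integrable_jker_quadratic[OF _ this] show ?thesis by (simp add: mult_ac)
  qed
  have S_away: "ln (1 + \<epsilon>) \<le> \<bar>u\<bar>" if "\<epsilon> > 0" "u \<in> ?S \<epsilon>" for \<epsilon> u
  proof (rule ccontr)
    assume "\<not> ?thesis"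
    then have u: "u < ln (1 + \<epsilon>)" "- ln (1 + \<epsilon>) < u" by auto
    have "exp u < 1 + \<epsilon>" using u(1) that by (metis add_pos_pos exp_less_cancel_iff exp_ln zero_less_one)
    moreover have "1 / (1 + \<epsilon>) < exp u"
      using u(2) that exp_less_cancel_iff[of "- ln (1 + \<epsilon>)" u] by (simp add: exp_minus divide_inverse)
    moreover have "1 - \<epsilon> \<le> 1 / (1 + \<epsilon>)" using that by (simp add: field_simps)
    ultimately show False using that by auto
  qed
  show trunc: "integrable lborel (\<lambda>u. indicator (?S \<epsilon>) u * (jker u * G u))" if "\<epsilon> > 0" for \<epsilon>
    using S_away[OF that] that by (intro away[where l="ln (1 + \<epsilon>)"]) auto
  assume intf: "integrable lborel (\<lambda>u. indicator {0<..} u * (rjump u * symm G u))"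
  show "((\<lambda>\<epsilon>. LINT u|lborel. indicator (?S \<epsilon>) u * (jker u * G u)) \<longlongrightarrow> pvint G) (at_right 0)"
  proof (rule tendsto_at_right_sequentially[of 0 "1 / 2"])
    fix E :: "nat \<Rightarrow> real"
    assume E: "\<And>n. 0 < E n" "\<And>n. E n < 1 / 2" "E \<longlonglongrightarrow> 0"
    define l1 where "l1 n = - ln (1 - E n)" for n
    define l2 where "l2 n = ln (1 + E n)" for n
    have b: "E n / 2 \<le> l2 n" "l2 n \<le> l1 n" "l1 n \<le> 2 * E n" "l1 n - l2 n \<le> 2 * (E n)\<^sup>2" "0 < l1 n" for n
      using log_interval_bounds[of "E n"] E(1)[of n] E(2)[of n] by (auto simp: l1_def l2_def)
    define B where "B n = {u::real. l1 n < \<bar>u\<bar>}" for n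
    have [measurable]: "B n \<in> sets borel" for n unfolding B_def by measurable
    have S_eq: "u \<in> ?S (E n) \<longleftrightarrow> l2 n < u \<or> u < - l1 n" for u n
    proof -
      have "1 + E n < exp u \<longleftrightarrow> l2 n < u"
        using E(1)[of n] exp_less_cancel_iff[of "ln (1 + E n)" u] by (simp add: l2_def)
      moreover have "exp u < 1 - E n \<longleftrightarrow> u < - l1 n"
        using E(2)[of n] exp_less_cancel_iff[of u "ln (1 - E n)"] by (simp add: l1_def)
      ultimately show ?thesis
        using b(1,5)[of n] E(1)[of n] by (auto simp: abs_if)
    qed
    have ind: "indicat_real (?S (E n)) u = indicator (B n) u + indicator {l2 n<..l1 n} u" for n u
      using S_eq[of u n] b(1,2,5)[of n] E(1)[of n] by (auto simp: B_def indicator_def)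
    have iB: "integrable lborel (\<lambda>u. indicator (B n) u * (jker u * G u))" for n
      using b(5)[of n] by (intro away[where l="l1 n"]) (auto simp: B_def)
    have iI: "integrable lborel (\<lambda>u. indicator {l2 n<..l1 n} u * (jker u * G u))" for n
      using Bochner_Integration.integrable_diff[OF trunc[OF E(1)[of n]] iB[of n]] by (simp add: ind algebra_simps)
    have split: "(LINT u|lborel. indicator (?S (E n)) u * (jker u * G u)) =
        (LINT u|lborel. indicator (B n) u * (jker u * G u)) + (LINT u|lborel. indicator {l2 n<..l1 n} u * (jker u * G u))" for n
      unfolding ind distrib_right by (rule Bochner_Integration.integral_add[OF iB iI])
    have "(\<lambda>n. LINT u|lborel. indicator {0<..} u * (indicator (B n) u * (rjump u * symm G u))) \<longlonglongrightarrow> pvint G"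
      unfolding pvint_def
    proof (rule integral_dominated_convergence[OF _ _ integrable_abs[OF intf]])
      show "AE u in lborel. (\<lambda>n. indicator {0<..} u * (indicator (B n) u * (rjump u * symm G u))) \<longlonglongrightarrow> indicator {0<..} u * (rjump u * symm G u)"
      proof (intro AE_I2)
        fix u :: real
        show "(\<lambda>n. indicator {0<..} u * (indicator (B n) u * (rjump u * symm G u))) \<longlonglongrightarrow> indicator {0<..} u * (rjump u * symm G u)"
        proof (cases "u > 0")
          case True
          have "(\<lambda>n. 2 * E n) \<longlonglongrightarrow> 0" using tendsto_mult_left[OF E(3), of 2] by simp
          then have "\<forall>\<^sub>F n in sequentially. 2 * E n < u" using True by (rule order_tendstoD(2))
          then have "\<forall>\<^sub>F n in sequentially. indicator {0<..} u * (indicator (B n) u * (rjump u * symm G u)) = indicator {0<..} u * (rjump u * symm G u)"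
          proof eventually_elim
            case (elim n)
            then have "u \<in> B n" using b(3)[of n] True by (simp add: B_def)
            then show ?case by simp
          qed
          then show ?thesis by (rule tendsto_eventually)
        qed simp
      qed
      show "AE u in lborel. norm (indicator {0<..} u * (indicator (B n) u * (rjump u * symm G u))) \<le> \<bar>indicator {0<..} u * (rjump u * symm G u)\<bar>" for n
        by (intro AE_I2) (auto simp: indicator_def)
    qed measurable
    moreover have "(LINT u|lborel. indicator (B n) u * (jker u * G u)) =
        (LINT u|lborel. indicator {0<..} u * (indicator (B n) u * (rjump u * symm G u)))" for n
    proof -
      have "indicator (B n) (- u) = (indicator (B n) u :: real)" for u by (simp add: B_def indicator_def)
      then have "indicator (B n) u * (jker u * G u) + indicator (B n) (- u) * (jker (- u) * G (- u)) =
          indicator (B n) u * (rjump u * symm G u)" for u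
        by (simp add: jker_symm[symmetric] distrib_left)
      then show ?thesis
        unfolding integral_reflection_sum[OF iB, symmetric] by simp
    qed
    ultimately have L1: "(\<lambda>n. LINT u|lborel. indicator (B n) u * (jker u * G u)) \<longlonglongrightarrow> pvint G"
      by simp
    define K where "K = exp \<bar>h - \<beta>\<bar> * (C * (Cg * 2))"
    have K0: "K \<ge> 0" using C Cg(1) by (simp add: K_def)
    have small: "\<bar>LINT u|lborel. indicator {l2 n<..l1 n} u * (jker u * G u)\<bar> \<le> 16 * K * ((E n / 2) ^ 3 * rjump (E n / 2))" for n
    proof -
      define M where "M = K * E n * rjump (E n / 2)"
      have M0: "M \<ge> 0" using K0 E(1)[of n] rjump_nonneg by (simp add: M_def)
      have pw: "\<bar>indicator {l2 n<..l1 n} u * (jker u * G u)\<bar> \<le> indicator {l2 n<..l1 n} u * M" for u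
      proof (cases "u \<in> {l2 n<..l1 n}")
        case True
        then have u: "E n / 2 \<le> u" "0 < u" "u \<le> 2 * E n" "u \<le> 1"
          using b[of n] E(1)[of n] E(2)[of n] by auto
        have e: "exp ((h - \<beta>) * u) \<le> exp \<bar>h - \<beta>\<bar>"
        proof -
          have "(h - \<beta>) * u \<le> \<bar>h - \<beta>\<bar> * 1" using u by (intro mult_mono) auto
          then show ?thesis by simp
        qed
        have r: "rjump u \<le> rjump (E n / 2)" using u E(1)[of n] by (intro rjump_mono) auto
        have "Cg * \<bar>u\<bar> \<le> Cg * (2 * E n)" using u Cg(1) by (intro mult_left_mono) auto
        moreover have "\<bar>gdev u\<bar> \<le> Cg * \<bar>u\<bar>" using u by (intro Cg(3)) auto
        ultimately have "\<bar>gdev u\<bar> \<le> Cg * (2 * E n)" by linarith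
        then have g: "\<bar>G u\<bar> \<le> C * (Cg * (2 * E n))" using G[of u] C mult_left_mono[of "\<bar>gdev u\<bar>" "Cg * (2 * E n)" C] by linarith
        have "jker u * \<bar>G u\<bar> \<le> (exp \<bar>h - \<beta>\<bar> * rjump (E n / 2)) * (C * (Cg * (2 * E n)))"
          unfolding jker_def using e r g rjump_nonneg by (intro mult_mono) auto
        also have "\<dots> = M" by (simp add: M_def K_def)
        finally show ?thesis using True by (simp add: abs_mult jker_nonneg)
      qed simp
      have "\<bar>LINT u|lborel. indicator {l2 n<..l1 n} u * (jker u * G u)\<bar> \<le> (LINT u|lborel. indicator {l2 n<..l1 n} u * M)"
        by (rule integral_abs_bound_integral[OF iI])
          (use b(2)[of n] in \<open>auto intro!: integrable_real_indicator integrable_mult_left pw\<close>)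
      also have "\<dots> = (l1 n - l2 n) * M" using b(2)[of n] by simp
      also have "\<dots> \<le> (2 * (E n)\<^sup>2) * M" using b(4)[of n] M0 by (intro mult_right_mono) auto
      also have "\<dots> = 16 * K * ((E n / 2) ^ 3 * rjump (E n / 2))"
        by (simp add: M_def power2_eq_square power3_eq_cube)
      finally show ?thesis .
    qed
    have "filterlim (\<lambda>n. E n / 2) (at_right 0) sequentially"
    proof -
      have "(\<lambda>n. E n / 2) \<longlonglongrightarrow> 0" using tendsto_divide[OF E(3) tendsto_const, of 2] by simp
      then show ?thesis using E(1) less_imp_neq[OF E(1)] by (auto simp: filterlim_at intro!: always_eventually)
    qed
    from filterlim_compose[OF cube_rjump_tendsto this]
    have "(\<lambda>n. 16 * K * ((E n / 2) ^ 3 * rjump (E n / 2))) \<longlonglongrightarrow> 16 * K * 0"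
      by (rule tendsto_mult_left)
    then have "(\<lambda>n. 16 * K * ((E n / 2) ^ 3 * rjump (E n / 2))) \<longlonglongrightarrow> 0" by simp
    then have L2: "(\<lambda>n. LINT u|lborel. indicator {l2 n<..l1 n} u * (jker u * G u)) \<longlonglongrightarrow> 0"
      by (rule Lim_null_comparison[rotated]) (use small in auto)
    show "(\<lambda>n. LINT u|lborel. indicator (?S (E n)) u * (jker u * G u)) \<longlonglongrightarrow> pvint G"
      using tendsto_add[OF L1 L2] by (simp add: split)
  qed simp
qed

end

section \<open>The hypergeometric density\<close>

context bessel_start
begin

lemma rjump_sums:
  assumes "u \<noteq> 0"
  shows "(\<lambda>k. coef k * (Gamma (h + \<beta> + 2 * real k) * (2 * cosh u) powr (- (h + \<beta> + 2 * real k)))) sums rjump u"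
proof -
  let ?t = "\<lambda>k. coef k * (Gamma (h + \<beta> + 2 * real k) * (2 * cosh u) powr (- (h + \<beta> + 2 * real k)))"
  have pos: "h + \<beta> + 2 * real k > 0" for k using h \<beta> by (simp add: add_pos_nonneg)
  have t0: "?t k \<ge> 0" for k
    using coef_pos[of k] Gamma_real_pos[OF pos[of k]] by (intro mult_nonneg_nonneg) auto
  have trm: "(\<integral>\<^sup>+x. ennreal (coef k * exp (- (h + \<beta> + 2 * real k) * x) * exp (- (2 * cosh u * exp (- x)))) \<partial>lborel) = ennreal (?t k)" for k
  proof -
    have "(\<integral>\<^sup>+x. ennreal (coef k * exp (- (h + \<beta> + 2 * real k) * x) * exp (- (2 * cosh u * exp (- x)))) \<partial>lborel) =
        (\<integral>\<^sup>+x. ennreal (coef k * exp (- (h + \<beta> + 2 * real k) * (0 + -1 * x)) * exp (- (2 * cosh u * exp (- (0 + -1 * x))))) \<partial>lborel)"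
      by (subst nn_integral_real_affine[where c="-1" and t=0]) auto
    also have "\<dots> = (\<integral>\<^sup>+x. ennreal (coef k) * ennreal (exp ((h + \<beta> + 2 * real k) * x) * exp (- (2 * cosh u * exp x))) \<partial>lborel)"
    proof (rule nn_integral_cong)
      fix x
      have "- (h + \<beta> + 2 * real k) * (0 + -1 * x) = (h + \<beta> + 2 * real k) * x" "- (0 + -1 * x) = x"
        by (simp_all add: algebra_simps)
      then have "coef k * exp (- (h + \<beta> + 2 * real k) * (0 + -1 * x)) * exp (- (2 * cosh u * exp (- (0 + -1 * x)))) =
          coef k * (exp ((h + \<beta> + 2 * real k) * x) * exp (- (2 * cosh u * exp x)))"
        by (simp only: mult.assoc)
      then show "ennreal (coef k * exp (- (h + \<beta> + 2 * real k) * (0 + -1 * x)) * exp (- (2 * cosh u * exp (- (0 + -1 * x))))) =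
          ennreal (coef k) * ennreal (exp ((h + \<beta> + 2 * real k) * x) * exp (- (2 * cosh u * exp x)))"
        using coef_pos[of k] by (simp only: ennreal_mult'[OF less_imp_le])
    qed
    also have "\<dots> = ennreal (coef k) * (\<integral>\<^sup>+x. ennreal (exp ((h + \<beta> + 2 * real k) * x) * exp (- (2 * cosh u * exp x))) \<partial>lborel)"
      by (rule nn_integral_cmult) measurable
    also have "(\<integral>\<^sup>+x. ennreal (exp ((h + \<beta> + 2 * real k) * x) * exp (- (2 * cosh u * exp x))) \<partial>lborel) =
        ennreal (Gamma (h + \<beta> + 2 * real k) * (2 * cosh u) powr (- (h + \<beta> + 2 * real k)))"
      by (rule nn_integral_Gamma_exp[OF pos]) simp
    also have "ennreal (coef k) * \<dots> = ennreal (?t k)"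
      using coef_pos[of k] by (simp only: ennreal_mult'[OF less_imp_le])
    finally show ?thesis .
  qed
  have "jump u = (\<integral>\<^sup>+x. (\<Sum>k. ennreal (coef k * exp (- (h + \<beta> + 2 * real k) * x) * exp (- (2 * cosh u * exp (- x))))) \<partial>lborel)"
    unfolding jump_def by (simp only: profile_eq_suminf[OF exp_ge_zero])
  also have "\<dots> = (\<Sum>k. \<integral>\<^sup>+x. ennreal (coef k * exp (- (h + \<beta> + 2 * real k) * x) * exp (- (2 * cosh u * exp (- x)))) \<partial>lborel)"
    by (rule nn_integral_suminf) measurable
  finally have J: "jump u = (\<Sum>k. ennreal (?t k))" unfolding trm .
  then have "(\<Sum>k. ennreal (?t k)) \<noteq> \<top>" using jump_finite[OF assms] by auto
  then have s: "summable ?t" by (rule summable_suminf_not_top[OF t0])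
  then have "jump u = ennreal (\<Sum>k. ?t k)" unfolding J by (rule suminf_ennreal2[OF t0])
  then have "rjump u = (\<Sum>k. ?t k)" using suminf_nonneg[OF s t0] by (simp add: rjump_def)
  then show ?thesis using s by (simp add: sums_iff)
qed

text \<open>The duplication formula for the Pochhammer symbol turns the hypergeometric series into the series of
  \<open>rjump_sums\<close>.\<close>

lemma Fbar_eq_rjump:
  assumes d: "real d = 2 * h" and u: "u \<noteq> 0"
  shows "Fbar d (2 * \<beta>) ((1 / cosh u)\<^sup>2) = 2 powr (2 * \<beta>) * \<beta> / Gamma (1 - \<beta>) * ((2 * cosh u) powr (h + \<beta>) * rjump u)"
proof -
  define s where "s = h + \<beta>"
  have s: "s > 0" using h \<beta> by (simp add: s_def)
  have Gs: "Gamma s > 0" and Gh: "Gamma h > 0" using s h by (auto intro: Gamma_real_pos)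
  have ni: "x \<notin> \<int>\<^sub>\<le>\<^sub>0" if "x > 0" for x :: real using that by (auto simp: nonpos_Ints_def)
  have trm: "pochhammer (s / 2) k * pochhammer (s / 2 + 1 / 2) k / (pochhammer h k * fact k) * ((1 / cosh u)\<^sup>2) ^ k =
      Gamma h / (2 * Gamma s) * (2 * cosh u) powr s * (coef k * (Gamma (s + 2 * real k) * (2 * cosh u) powr (- (s + 2 * real k))))" for k
  proof -
    have "pochhammer s (2 * k) = 4 ^ k * (pochhammer (s / 2) k * pochhammer (s / 2 + 1 / 2) k)"
      using pochhammer_double[of "s / 2" k] by (simp add: power_mult mult.assoc)
    moreover have "pochhammer s (2 * k) = Gamma (s + 2 * real k) / Gamma s"
      using pochhammer_Gamma[OF ni[OF s], of "2 * k"] by simp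
    ultimately have "4 ^ k * (pochhammer (s / 2) k * pochhammer (s / 2 + 1 / 2) k) / 4 ^ k = Gamma (s + 2 * real k) / Gamma s / 4 ^ k"
      by (simp only:)
    then have 1: "pochhammer (s / 2) k * pochhammer (s / 2 + 1 / 2) k = Gamma (s + 2 * real k) / Gamma s / 4 ^ k"
      by simp
    have 2: "pochhammer h k = Gamma (h + real k) / Gamma h"
      using pochhammer_Gamma[OF ni[OF h], of k] by simp
    have "(2 * cosh u) powr s * (2 * cosh u) powr (- (s + 2 * real k)) = (2 * cosh u) powr (- real (2 * k))"
      by (simp add: powr_add[symmetric])
    also have "\<dots> = 1 / (2 * cosh u) ^ (2 * k)"
      by (subst powr_minus_divide, subst powr_realpow) auto
    also have "\<dots> = ((1 / cosh u)\<^sup>2) ^ k / 4 ^ k"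
      by (simp add: power_mult power_mult_distrib power_divide)
    finally have 3: "(2 * cosh u) powr s * (2 * cosh u) powr (- (s + 2 * real k)) = ((1 / cosh u)\<^sup>2) ^ k / 4 ^ k" .
    have "Gamma h / (2 * Gamma s) * (2 * cosh u) powr s * (coef k * (Gamma (s + 2 * real k) * (2 * cosh u) powr (- (s + 2 * real k)))) =
        Gamma h / (2 * Gamma s) * coef k * Gamma (s + 2 * real k) * ((2 * cosh u) powr s * (2 * cosh u) powr (- (s + 2 * real k)))"
      by (simp only: mult_ac)
    also have "\<dots> = Gamma (s + 2 * real k) / Gamma s / 4 ^ k / (Gamma (h + real k) / Gamma h * fact k) * ((1 / cosh u)\<^sup>2) ^ k"
      unfolding 3 coef_def by (simp add: mult_ac)
    finally show ?thesis unfolding 1 2 by simp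
  qed
  have sums: "(\<lambda>k. pochhammer (s / 2) k * pochhammer (s / 2 + 1 / 2) k / (pochhammer h k * fact k) * ((1 / cosh u)\<^sup>2) ^ k) sums
      (Gamma h / (2 * Gamma s) * (2 * cosh u) powr s * rjump u)"
    unfolding trm using rjump_sums[OF u] unfolding s_def[symmetric] by (rule sums_mult)
  have e1: "(2 * \<beta> + real d) / 4 = s / 2" and e2: "real d / 2 = h" and e3: "2 * \<beta> / 2 = \<beta>"
    using d by (simp_all add: s_def)
  have "hyp2F1 (s / 2) (s / 2 + 1 / 2) h ((1 / cosh u)\<^sup>2) = Gamma h / (2 * Gamma s) * (2 * cosh u) powr s * rjump u"
    unfolding hyp2F1_def using sums by (simp only: sums_iff)
  then show ?thesis
    unfolding Fbar_def e1 e2 e3 gen_pochhammer_def s_def[symmetric] using Gs Gh by simp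
qed

lemma density_eq_jker:
  assumes d: "real d = 2 * h" "d \<ge> 1" and u: "u \<noteq> 0"
  shows "exp u ^ (d - 1) / (1 + (exp u)\<^sup>2) powr ((2 * \<beta> + real d) / 2) * Fbar d (2 * \<beta>) ((2 * exp u / (1 + (exp u)\<^sup>2))\<^sup>2) * exp u =
    2 powr (2 * \<beta>) * \<beta> / Gamma (1 - \<beta>) * jker u"
proof -
  have c: "1 + (exp u)\<^sup>2 = exp u * (2 * cosh u)"
    by (simp add: cosh_def power2_eq_square distrib_left mult_exp_exp)
  have z: "2 * exp u / (1 + (exp u)\<^sup>2) = 1 / cosh u"
    unfolding c by simp
  have e: "(2 * \<beta> + real d) / 2 = h + \<beta>" using d by simp
  have p: "(1 + (exp u)\<^sup>2) powr (h + \<beta>) = exp ((h + \<beta>) * u) * (2 * cosh u) powr (h + \<beta>)"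
    unfolding c by (simp add: powr_mult) (simp add: powr_def)
  have "exp u ^ (d - 1) * exp u = exp u ^ d" using d(2) power_minus_mult[of d "exp u"] by simp
  also have "\<dots> = exp (2 * h * u)" by (simp add: exp_of_nat_mult[symmetric] d(1))
  finally have q: "exp u ^ (d - 1) * exp u = exp (2 * h * u)" .
  have r: "exp (2 * h * u) / exp ((h + \<beta>) * u) = exp ((h - \<beta>) * u)"
    by (simp add: exp_diff[symmetric] algebra_simps)
  have "exp u ^ (d - 1) / (exp ((h + \<beta>) * u) * (2 * cosh u) powr (h + \<beta>)) * (2 powr (2 * \<beta>) * \<beta> / Gamma (1 - \<beta>) * ((2 * cosh u) powr (h + \<beta>) * rjump u)) * exp u =
      2 powr (2 * \<beta>) * \<beta> / Gamma (1 - \<beta>) * ((exp u ^ (d - 1) * exp u) / exp ((h + \<beta>) * u) * rjump u)"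
    by (simp add: mult_ac)
  then show ?thesis
    unfolding z e p Fbar_eq_rjump[OF d(1) u] q r jker_def by simp
qed

text \<open>The weight \<open>exp ((h - \<beta>) * u)\<close> makes the compensator an odd function.\<close>

lemma exp_ell:
  assumes d: "real d = 2 * h"
  shows "exp ((h - \<beta>) * u) * ell d (2 * \<beta>) u = u / (1 + u\<^sup>2) * (2 * cosh u) powr (h + \<beta> - 1) * indicator {u. \<bar>u\<bar> < 1} u"
proof -
  have c: "1 + exp (2 * u) = exp u * (2 * cosh u)"
    by (simp add: cosh_def distrib_left mult_exp_exp)
  have e: "(2 * \<beta> + real d) / 2 - 1 = h + \<beta> - 1" using d by simp
  have p: "(1 + exp (2 * u)) powr (h + \<beta> - 1) = exp ((h + \<beta> - 1) * u) * (2 * cosh u) powr (h + \<beta> - 1)"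
    unfolding c by (simp add: powr_mult) (simp add: powr_def)
  have "(h - \<beta>) * u + (1 - real d) * u + (h + \<beta> - 1) * u = 0" unfolding d by (simp add: algebra_simps)
  then have x: "exp ((h - \<beta>) * u) * exp ((1 - real d) * u) * exp ((h + \<beta> - 1) * u) = 1"
    by (simp only: mult_exp_exp exp_zero)
  have "exp ((h - \<beta>) * u) * ell d (2 * \<beta>) u =
      (exp ((h - \<beta>) * u) * exp ((1 - real d) * u) * exp ((h + \<beta> - 1) * u)) * (u / (1 + u\<^sup>2) * (2 * cosh u) powr (h + \<beta> - 1) * indicator {u. \<bar>u\<bar> < 1} u)"
    unfolding ell_def e p by (simp only: mult_ac)
  then show ?thesis unfolding x by simp
qed

lemma symm_ell:
  assumes d: "real d = 2 * h"
  shows "symm (ell d (2 * \<beta>)) u = 0"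
proof -
  have "exp (- ((h - \<beta>) * u)) * ell d (2 * \<beta>) (- u) = - (exp ((h - \<beta>) * u) * ell d (2 * \<beta>) u)"
    using exp_ell[OF d, of "- u"] unfolding exp_ell[OF d, of u] by (simp add: indicator_def)
  then show ?thesis by (simp add: symm_def)
qed

lemma ell_measurable [measurable]: "ell d \<alpha> \<in> borel_measurable borel"
  unfolding ell_def[abs_def] by measurable

lemma ell_le_gdev: "\<exists>C\<ge>0. \<forall>u. \<bar>ell d \<alpha> u\<bar> \<le> C * \<bar>gdev u\<bar>"
proof -
  define f where "f u = exp ((1 - real d) * u) * (1 + exp (2 * u)) powr ((\<alpha> + real d) / 2 - 1) / (1 + u\<^sup>2)" for u
  have nz: "1 + exp (2 * u) \<noteq> 0" "1 + u\<^sup>2 \<noteq> 0" for u :: real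
    by (smt (verit) exp_gt_zero zero_le_power2)+
  have "continuous_on {-1..1} f"
    unfolding f_def by (intro continuous_intros) (auto simp: nz)
  then have "bounded (f ` {-1..1})" by (intro compact_imp_bounded compact_continuous_image) auto
  then obtain M where "\<forall>y\<in>f ` {-1..1}. norm y \<le> M" unfolding bounded_iff by blast
  then have M: "\<bar>f u\<bar> \<le> M" if "\<bar>u\<bar> \<le> 1" for u using that by (auto simp: abs_le_iff)
  obtain Cg where Cg: "Cg > 0" "\<And>u. min 1 \<bar>u\<bar> \<le> Cg * \<bar>gdev u\<bar>"
    using gdev_bounds by blast
  have M0: "M \<ge> 0" using M[of 0] by simp
  have "\<bar>ell d \<alpha> u\<bar> \<le> (M * Cg) * \<bar>gdev u\<bar>" for u
  proof (cases "\<bar>u\<bar> < 1")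
    case True
    then have "\<bar>ell d \<alpha> u\<bar> = \<bar>f u\<bar> * \<bar>u\<bar>" by (simp add: ell_def f_def abs_mult mult_ac)
    also have "\<dots> \<le> M * (Cg * \<bar>gdev u\<bar>)"
      using M[of u] Cg(2)[of u] True M0 by (intro mult_mono) (auto simp: min_def split: if_splits)
    finally show ?thesis by (simp add: mult_ac)
  qed (use M0 Cg in \<open>simp add: ell_def\<close>)
  then show ?thesis using M0 Cg(1) by (intro exI[of _ "M * Cg"]) auto
qed

end

section \<open>Second-order decomposition of the test function\<close>

lemma second_order_quotient:
  fixes \<psi> \<psi>1 :: "real \<Rightarrow> real"
  assumes d1: "\<forall>\<^sub>F x in nhds c. (\<psi> has_real_derivative \<psi>1 x) (at x)"
    and d2: "(\<psi>1 has_real_derivative D) (at c)"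
  shows "((\<lambda>x. (\<psi> x - \<psi> c - \<psi>1 c * (x - c)) / (x - c)\<^sup>2) \<longlongrightarrow> D / 2) (at c)"
proof (rule lhopital[where f'="\<lambda>x. \<psi>1 x - \<psi>1 c" and g'="\<lambda>x. 2 * (x - c)"])
  have "(\<psi> has_real_derivative \<psi>1 c) (at c)" using d1 by (rule eventually_nhds_x_imp_x)
  then have "\<psi> \<midarrow>c\<rightarrow> \<psi> c" using DERIV_isCont isCont_def by blast
  then have "((\<lambda>x. \<psi> x - \<psi> c - \<psi>1 c * (x - c)) \<longlongrightarrow> \<psi> c - \<psi> c - \<psi>1 c * (c - c)) (at c)"
    by (intro tendsto_intros)
  then show "((\<lambda>x. \<psi> x - \<psi> c - \<psi>1 c * (x - c)) \<longlongrightarrow> 0) (at c)" by simp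
  have "((\<lambda>x. (x - c)\<^sup>2) \<longlongrightarrow> (c - c)\<^sup>2) (at c)" by (intro tendsto_intros)
  then show "((\<lambda>x. (x - c)\<^sup>2) \<longlongrightarrow> 0) (at c)" by simp
  show "\<forall>\<^sub>F x in at c. (x - c)\<^sup>2 \<noteq> 0" "\<forall>\<^sub>F x in at c. 2 * (x - c) \<noteq> 0"
    by (auto simp: eventually_at_filter)
  have "\<forall>\<^sub>F x in at c. (\<psi> has_real_derivative \<psi>1 x) (at x)"
    using d1 by (auto simp: eventually_at_filter elim: eventually_mono)
  then show "\<forall>\<^sub>F x in at c. ((\<lambda>x. \<psi> x - \<psi> c - \<psi>1 c * (x - c)) has_real_derivative \<psi>1 x - \<psi>1 c) (at x)"
  proof eventually_elim
    case (elim x)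
    show ?case
      by (rule DERIV_cong[OF DERIV_diff[OF DERIV_diff[OF elim DERIV_const]
          DERIV_cmult[OF DERIV_diff[OF DERIV_ident DERIV_const]]]]) simp
  qed
  show "\<forall>\<^sub>F x in at c. ((\<lambda>x. (x - c)\<^sup>2) has_real_derivative 2 * (x - c)) (at x)"
  proof (intro always_eventually allI)
    fix x
    show "((\<lambda>x. (x - c)\<^sup>2) has_real_derivative 2 * (x - c)) (at x)"
      by (rule DERIV_cong[OF DERIV_power[OF DERIV_diff[OF DERIV_ident DERIV_const]]]) simp
  qed
  have "((\<lambda>x. (\<psi>1 x - \<psi>1 c) / (x - c)) \<longlongrightarrow> D) (at c)"
    using d2 unfolding has_field_derivative_iff .
  then have "((\<lambda>x. (\<psi>1 x - \<psi>1 c) / (x - c) / 2) \<longlongrightarrow> D / 2) (at c)" by (intro tendsto_intros) auto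
  then show "((\<lambda>x. (\<psi>1 x - \<psi>1 c) / (2 * (x - c))) \<longlongrightarrow> D / 2) (at c)"
    by (simp add: mult.commute)
qed

lemma C2_0_continuous:
  assumes "C2_0 g"
  shows "continuous_on {0..} g"
proof -
  obtain g' where "\<forall>x\<ge>0. (g has_real_derivative g' x) (at x within {0..})"
    using assms unfolding C2_0_def by blast
  then show ?thesis
    by (auto simp: continuous_on_eq_continuous_within intro: DERIV_continuous)
qed

lemma C2_0_interior_deriv:
  assumes "C2_0 g"
  obtains g' g'' where "\<And>x. x > 0 \<Longrightarrow> (g has_real_derivative g' x) (at x)"
    "\<And>x. x > 0 \<Longrightarrow> (g' has_real_derivative g'' x) (at x)"
proof -
  obtain g' g'' where d: "\<forall>x\<ge>0. (g has_real_derivative g' x) (at x within {0..})"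
      "\<forall>x\<ge>0. (g' has_real_derivative g'' x) (at x within {0..})"
    using assms unfolding C2_0_def by blast
  have at: "at x within {0..} = at x" if "x > 0" for x :: real
    using that by (intro at_within_open_subset[where S="{0<..}"]) auto
  show ?thesis
    using d at by (intro that[of g' g'']) (metis less_imp_le)+
qed

text \<open>In the variable \<open>x = exp (- r\<^sup>2)\<close>, \<open>g\<close> becomes a continuous function \<open>\<psi>\<close> on \<open>[0, 1]\<close>, with value \<open>0\<close> at \<open>x = 0\<close> as \<open>g\<close> vanishes
  at infinity, and \<open>\<eta>\<close> is its second-order Taylor quotient at \<open>exp (- a\<^sup>2)\<close>. Nothing beyond continuity is needed at
  \<open>x = 1\<close>, that is at \<open>r = 0\<close>.\<close>

lemma exp_square_decomposition:
  assumes g: "C2_0 g" and a: "a > 0"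
  shows "\<exists>b \<eta>. continuous_on {0..1} \<eta> \<and>
    (\<forall>r\<ge>0. g r - g a = b * (exp (- r\<^sup>2) - exp (- a\<^sup>2)) + (exp (- r\<^sup>2) - exp (- a\<^sup>2))\<^sup>2 * \<eta> (exp (- r\<^sup>2)))"
proof -
  define c where "c = exp (- a\<^sup>2)"
  have c: "0 < c" "c < 1" using a by (auto simp: c_def)
  define \<rho> where "\<rho> x = sqrt (- ln x)" for x
  have \<rho>_exp: "\<rho> (exp (- r\<^sup>2)) = r" if "r \<ge> 0" for r using that by (simp add: \<rho>_def)
  have \<rho>c: "\<rho> c = a" using \<rho>_exp a by (simp add: c_def)
  define \<psi> where "\<psi> x = (if x \<le> 0 then 0 else g (\<rho> x))" for x
  obtain g' g'' where g': "\<And>x. x > 0 \<Longrightarrow> (g has_real_derivative g' x) (at x)"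
      and g'': "\<And>x. x > 0 \<Longrightarrow> (g' has_real_derivative g'' x) (at x)"
    using C2_0_interior_deriv[OF g] by blast
  have \<rho>pos: "\<rho> x > 0" if "0 < x" "x < 1" for x using that by (simp add: \<rho>_def)
  have \<rho>deriv: "(\<rho> has_real_derivative - 1 / (2 * x * \<rho> x)) (at x)" if "0 < x" "x < 1" for x
    using that unfolding \<rho>_def by (auto intro!: derivative_eq_intros simp: field_simps)
  define \<psi>1 where "\<psi>1 x = g' (\<rho> x) * (- 1 / (2 * x * \<rho> x))" for x
  have ev: "\<forall>\<^sub>F x in nhds c. x \<in> {0<..<1}" using c by (intro eventually_nhds_in_open) auto
  then have d1: "\<forall>\<^sub>F x in nhds c. (\<psi> has_real_derivative \<psi>1 x) (at x)"
  proof eventually_elim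
    case (elim x)
    then have x: "0 < x" "x < 1" by auto
    have "((\<lambda>x. g (\<rho> x)) has_real_derivative \<psi>1 x) (at x)"
      unfolding \<psi>1_def by (rule DERIV_chain2[OF g'[OF \<rho>pos[OF x]] \<rho>deriv[OF x]])
    moreover have "\<forall>\<^sub>F y in nhds x. \<psi> y = g (\<rho> y)"
      using eventually_nhds_in_open[of "{0<..}" x] x by (auto simp: \<psi>_def elim!: eventually_mono)
    ultimately show ?case by (subst DERIV_cong_ev[OF refl _ refl])
  qed
  have "\<exists>D. (\<psi>1 has_real_derivative D) (at c)"
  proof -
    have p: "2 * c * \<rho> c \<noteq> 0" using c \<rho>pos[OF c] by simp
    have q: "((\<lambda>x. 2 * x * \<rho> x) has_real_derivative 2 * 1 * \<rho> c + (- 1 / (2 * c * \<rho> c)) * (2 * c)) (at c)"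
      by (rule DERIV_mult[OF _ \<rho>deriv[OF c]]) (auto intro!: derivative_eq_intros)
    have "((\<lambda>x. g' (\<rho> x)) has_real_derivative g'' (\<rho> c) * (- 1 / (2 * c * \<rho> c))) (at c)"
      by (rule DERIV_chain2[OF g''[OF \<rho>pos[OF c]] \<rho>deriv[OF c]])
    from DERIV_mult[OF this DERIV_divide[OF DERIV_const[of "- 1"] q p]]
    show ?thesis unfolding \<psi>1_def[abs_def] by blast
  qed
  then obtain D where d2: "(\<psi>1 has_real_derivative D) (at c)" by blast
  define \<eta> where "\<eta> x = (if x = c then D / 2 else (\<psi> x - \<psi> c - \<psi>1 c * (x - c)) / (x - c)\<^sup>2)" for x
  have \<psi>cont: "((\<lambda>x. \<psi> x) \<longlongrightarrow> \<psi> x) (at x within {0..1})" if x: "x \<in> {0..1}" for x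
  proof (cases "x = 0")
    case True
    have "filterlim (\<lambda>x. - ln x) at_top (at_right (0::real))"
      using ln_at_0 by (simp add: filterlim_uminus_at_top)
    then have "filterlim \<rho> at_top (at_right 0)"
      unfolding \<rho>_def by (rule filterlim_compose[OF sqrt_at_top])
    moreover have "(g \<longlongrightarrow> 0) at_top" using g by (simp add: C2_0_def)
    ultimately have "((\<lambda>x. g (\<rho> x)) \<longlongrightarrow> 0) (at_right 0)" by (rule filterlim_compose[rotated])
    moreover have "\<forall>\<^sub>F x in at_right 0. g (\<rho> x) = \<psi> x"
      using eventually_at_right_less[of "0::real"] by eventually_elim (simp add: \<psi>_def)
    ultimately have "(\<psi> \<longlongrightarrow> 0) (at_right 0)" by (rule Lim_transform_eventually)
    moreover have "\<psi> 0 = 0" by (simp add: \<psi>_def)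
    ultimately show ?thesis using True by (simp add: at_within_Icc_at_right)
  next
    case False
    have "continuous_on {0<..1} (\<lambda>x. g (\<rho> x))"
    proof (rule continuous_on_compose2[OF C2_0_continuous[OF g]])
      show "continuous_on {0<..1} \<rho>" unfolding \<rho>_def by (intro continuous_intros) auto
    qed (auto simp: \<rho>_def)
    then have "continuous_on {0<..1} \<psi>"
      by (rule continuous_on_eq) (auto simp: \<psi>_def)
    then have "(\<psi> \<longlongrightarrow> \<psi> x) (at x within {0<..1})"
      using x False by (auto simp: continuous_on_def)
    moreover have "at x within {0<..1} = at x within {0..1}"
      by (rule at_within_nhd[of x "{0<..}"]) (use x False in auto)
    ultimately show ?thesis by simp
  qed
  have "continuous_on {0..1} \<eta>"
    unfolding continuous_on_def
  proof
    fix x :: real assume x: "x \<in> {0..1}"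
    show "(\<eta> \<longlongrightarrow> \<eta> x) (at x within {0..1})"
    proof (cases "x = c")
      case True
      have "((\<lambda>x. (\<psi> x - \<psi> c - \<psi>1 c * (x - c)) / (x - c)\<^sup>2) \<longlongrightarrow> D / 2) (at c)"
        by (rule second_order_quotient[OF d1 d2])
      moreover have "\<forall>\<^sub>F x in at c. (\<psi> x - \<psi> c - \<psi>1 c * (x - c)) / (x - c)\<^sup>2 = \<eta> x"
        by (auto simp: eventually_at_filter \<eta>_def)
      ultimately have "(\<eta> \<longlongrightarrow> D / 2) (at c)" by (rule Lim_transform_eventually)
      moreover have "\<eta> c = D / 2" by (simp add: \<eta>_def)
      ultimately show ?thesis unfolding True by (auto intro: tendsto_within_subset)
    next
      case False
      have "((\<lambda>x. (\<psi> x - \<psi> c - \<psi>1 c * (x - c)) / (x - c)\<^sup>2) \<longlongrightarrow> (\<psi> x - \<psi> c - \<psi>1 c * (x - c)) / (x - c)\<^sup>2) (at x within {0..1})"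
        using False by (intro tendsto_intros \<psi>cont[OF x]) auto
      moreover have "\<forall>\<^sub>F y in nhds x. y \<in> - {c}" using False by (intro eventually_nhds_in_open) auto
      then have "\<forall>\<^sub>F y in at x within {0..1}. (\<psi> y - \<psi> c - \<psi>1 c * (y - c)) / (y - c)\<^sup>2 = \<eta> y"
        unfolding eventually_at_filter by (rule eventually_mono) (auto simp: \<eta>_def)
      ultimately have "(\<eta> \<longlongrightarrow> (\<psi> x - \<psi> c - \<psi>1 c * (x - c)) / (x - c)\<^sup>2) (at x within {0..1})"
        by (rule Lim_transform_eventually)
      moreover have "\<eta> x = (\<psi> x - \<psi> c - \<psi>1 c * (x - c)) / (x - c)\<^sup>2"
        using False by (simp add: \<eta>_def)
      ultimately show ?thesis by (simp only:)
    qed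
  qed
  moreover have "g r - g a = \<psi>1 c * (exp (- r\<^sup>2) - c) + (exp (- r\<^sup>2) - c)\<^sup>2 * \<eta> (exp (- r\<^sup>2))" if "r \<ge> 0" for r
  proof -
    have "\<not> exp (- r\<^sup>2) \<le> 0" "\<not> c \<le> 0" using c by (simp_all add: not_le)
    then have \<psi>: "\<psi> (exp (- r\<^sup>2)) = g r" "\<psi> c = g a"
      unfolding \<psi>_def by (simp_all only: if_False \<rho>_exp[OF that] \<rho>c)
    show ?thesis
    proof (cases "exp (- r\<^sup>2) = c")
      case True
      then have "r = a" using \<rho>_exp[OF that] \<rho>c by (simp only:)
      then show ?thesis using True by (simp only:) simp
    next
      case False
      then show ?thesis unfolding \<eta>_def \<psi> by simp
    qed
  qed
  ultimately show ?thesis unfolding c_def[symmetric] by blast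
qed

section \<open>The generator of the radial part\<close>

lemma tendsto_approximation:
  fixes X V :: "'b \<Rightarrow> real"
  assumes K: "K \<ge> 0" and V: "(V \<longlongrightarrow> K) F"
    and approx: "\<And>e. e > 0 \<Longrightarrow> \<exists>R m. (R \<longlongrightarrow> m) F \<and> (\<forall>\<^sub>F t in F. \<bar>X t - R t\<bar> \<le> e * V t) \<and> \<bar>m - l\<bar> \<le> e * K"
  shows "(X \<longlongrightarrow> l) F"
proof (rule tendstoI)
  fix \<epsilon> :: real assume \<epsilon>: "\<epsilon> > 0"
  define e where "e = \<epsilon> / (3 * (K + 1))"
  have e: "e > 0" "e * (K + 1) = \<epsilon> / 3" using \<epsilon> K by (auto simp: e_def field_simps)
  obtain R m where R: "(R \<longlongrightarrow> m) F" "\<forall>\<^sub>F t in F. \<bar>X t - R t\<bar> \<le> e * V t" "\<bar>m - l\<bar> \<le> e * K"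
    using approx[OF e(1)] by blast
  have "\<forall>\<^sub>F t in F. V t < K + 1" using V by (rule order_tendstoD) simp
  moreover have "\<forall>\<^sub>F t in F. dist (R t) m < \<epsilon> / 3" using R(1) \<epsilon> by (intro tendstoD) auto
  ultimately show "\<forall>\<^sub>F t in F. dist (X t) l < \<epsilon>"
    using R(2)
  proof eventually_elim
    case (elim t)
    have "e * V t \<le> e * (K + 1)" using elim(1) e(1) by (intro mult_left_mono) auto
    moreover have "e * K \<le> e * (K + 1)" using e(1) by (intro mult_left_mono) auto
    ultimately show ?case using elim(2,3) R(3) e(2) unfolding dist_real_def by linarith
  qed
qed

lemma stable_generator_polynomial:
  fixes P :: "'a::euclidean_space \<Rightarrow> 'w measure" and c :: "nat \<Rightarrow> real"
  assumes stable: "symmetric_stable_process \<alpha> P Z" and \<alpha>: "0 < \<alpha>" "\<alpha> < 2"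
    and z: "norm z = a" "a > 0" and p: "\<And>x. p x = (\<Sum>i\<le>n. c i * x ^ i)"
  shows "((\<lambda>t. ((LINT \<omega>|P z. p (exp (- (norm (Z t \<omega>))\<^sup>2))) - p (exp (- a\<^sup>2))) / t) \<longlongrightarrow>
    a powr (- \<alpha>) * (2 powr \<alpha> * (\<alpha> / 2) / Gamma (1 - \<alpha> / 2)) *
      (\<Sum>i\<le>n. c i * (LINT \<tau>|lborel. gauss_diff (real DIM('a) / 2) (real i * a\<^sup>2) \<tau> * exp (- (\<alpha> / 2) * \<tau>)))) (at_right 0)"
proof -
  interpret prob_space "P z" by (rule stable_prob_space[OF stable])
  define A where "A = a powr (- \<alpha>) * (2 powr \<alpha> * (\<alpha> / 2) / Gamma (1 - \<alpha> / 2))"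
  define L where "L i = (LINT \<tau>|lborel. gauss_diff (real DIM('a) / 2) (real i * a\<^sup>2) \<tau> * exp (- (\<alpha> / 2) * \<tau>))" for i
  define T where "T i t = ((LINT \<omega>|P z. exp (- real i * (norm (Z t \<omega>))\<^sup>2)) - exp (- real i * a\<^sup>2)) / t" for i t
  have pw: "exp (- x) ^ i = exp (- real i * x)" for x :: real and i
    by (simp add: exp_of_nat_mult[symmetric])
  have T: "((\<lambda>t. T i t) \<longlongrightarrow> A * L i) (at_right 0)" for i
    unfolding T_def A_def L_def by (rule stable_generator_gaussian[OF stable \<alpha> _ z]) simp
  have "((\<lambda>t. \<Sum>i\<le>n. c i * T i t) \<longlongrightarrow> (\<Sum>i\<le>n. c i * (A * L i))) (at_right 0)"
    by (intro tendsto_sum tendsto_mult_left T)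
  moreover have "\<forall>\<^sub>F t in at_right 0. (\<Sum>i\<le>n. c i * T i t) =
      ((LINT \<omega>|P z. p (exp (- (norm (Z t \<omega>))\<^sup>2))) - p (exp (- a\<^sup>2))) / t"
    using eventually_at_right_less[of "0::real"]
  proof eventually_elim
    case (elim t)
    have [measurable]: "Z t \<in> borel_measurable (P z)" using elim by (intro stable_measurable[OF stable]) simp
    have int: "integrable (P z) (\<lambda>\<omega>. c i * exp (- real i * (norm (Z t \<omega>))\<^sup>2))" for i
      by (intro integrable_mult_right integrable_const_bound[where B=1]) auto
    have "(LINT \<omega>|P z. p (exp (- (norm (Z t \<omega>))\<^sup>2))) = (\<Sum>i\<le>n. c i * (LINT \<omega>|P z. exp (- real i * (norm (Z t \<omega>))\<^sup>2)))"
      unfolding p pw by (subst Bochner_Integration.integral_sum[OF int]) simp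
    moreover have "p (exp (- a\<^sup>2)) = (\<Sum>i\<le>n. c i * exp (- real i * a\<^sup>2))"
      unfolding p pw ..
    ultimately show ?case
      by (simp only: T_def sum_subtractf[symmetric] sum_divide_distrib right_diff_distrib[symmetric] times_divide_eq_right)
  qed
  ultimately have "((\<lambda>t. ((LINT \<omega>|P z. p (exp (- (norm (Z t \<omega>))\<^sup>2))) - p (exp (- a\<^sup>2))) / t) \<longlongrightarrow>
      (\<Sum>i\<le>n. c i * (A * L i))) (at_right 0)"
    by (rule Lim_transform_eventually)
  moreover have "(\<Sum>i\<le>n. c i * (A * L i)) = A * (\<Sum>i\<le>n. c i * L i)"
    by (simp add: sum_distrib_left mult_ac)
  ultimately show ?thesis unfolding A_def L_def by (simp only:)
qed

context bessel_start
begin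

text \<open>Identifies the limit in \<open>stable_generator_polynomial\<close> when the polynomial vanishes to second order at \<open>x0\<close>.\<close>

lemma polynomial_quadratic:
  fixes c :: "nat \<Rightarrow> real"
  assumes p: "\<And>x. p x = (\<Sum>i\<le>n. c i * x ^ i)" and q: "\<And>x. p x = (x - x0)\<^sup>2 * r x"
    and r: "continuous_on UNIV r"
  shows "(\<Sum>i\<le>n. c i * (LINT \<tau>|lborel. gauss_diff h (real i * a\<^sup>2) \<tau> * exp (- \<beta> * \<tau>))) =
    (LINT u|lborel. jker u * ((gdev u)\<^sup>2 * r (gexp u)))"
proof -
  have [measurable]: "r \<in> borel_measurable borel" using r by (rule borel_measurable_continuous_onI)
  have "bounded (r ` {0..1})" using r by (intro compact_imp_bounded compact_continuous_image) (auto intro: continuous_on_subset)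
  then obtain M where "\<forall>y\<in>r ` {0..1}. norm y \<le> M" unfolding bounded_iff by blast
  then have M: "\<bar>r (gexp u)\<bar> \<le> M" for u using gexp_bounds[of u] by (auto simp: less_imp_le)
  have bd: "\<bar>(gdev u)\<^sup>2 * r (gexp u)\<bar> \<le> M * (gdev u)\<^sup>2" for u
    using mult_left_mono[OF M[of u], of "(gdev u)\<^sup>2"] by (simp add: abs_mult mult.commute)
  have p0: "p x0 = 0" by (simp add: q)
  have pg: "p (gexp u) = (gdev u)\<^sup>2 * r (gexp u)" for u by (simp add: q gdev_def)
  have "(\<Sum>i\<le>n. c i * (LINT \<tau>|lborel. gauss_diff h (real i * a\<^sup>2) \<tau> * exp (- \<beta> * \<tau>))) =
      (LINT \<tau>|lborel. (\<Sum>i\<le>n. c i * gauss_diff h (real i * a\<^sup>2) \<tau>) * exp (- \<beta> * \<tau>))"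
    by (rule integral_poly_diff[OF p, symmetric])
  also have "\<dots> = (LINT \<tau>|lborel. LINT u|lborel. kern \<tau> u * p (gexp u))"
    unfolding integral_kern_poly[OF p] p0 by simp
  also have "\<dots> = (LINT u|lborel. jker u * ((gdev u)\<^sup>2 * r (gexp u)))"
    unfolding pg by (rule integral_jker_quadratic[OF _ bd]) measurable
  finally show ?thesis .
qed

end

theorem theorem2:
  fixes \<alpha> a :: real
    and P :: "real ^ 'd \<Rightarrow> 'w measure"
    and Z :: "real \<Rightarrow> 'w \<Rightarrow> real ^ 'd"
    and Q :: "real \<Rightarrow> 'w measure"
    and g :: "real \<Rightarrow> real"
  assumes "0 < \<alpha>" and "\<alpha> < 2" and "\<alpha> \<le> real CARD('d)"
    and "symmetric_stable_process \<alpha> P Z"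
    and "radial_laws P Q"
    and "C2_0 g"
    and "0 < a"
  shows "\<exists>I. has_pv_integral (radial_integrand CARD('d) \<alpha> g a) 1 {0<..} I \<and>
             (\<alpha> < 1 \<longrightarrow>
                set_integrable lborel {0<..} (radial_integrand CARD('d) \<alpha> g a) \<and>
                (LINT y:{0<..}|lborel. radial_integrand CARD('d) \<alpha> g a y) = I) \<and>
             has_generator_at Q (radial_part Z) g a (a powr (- \<alpha>) * I)"
proof -
  define d where "d = CARD('d)"
  have d1: "d \<ge> 1" by (simp add: d_def Suc_le_eq)
  interpret bessel_start "real d / 2" "\<alpha> / 2" a
    using assms d1 by unfold_locales auto
  have h2: "real d = 2 * (real d / 2)" by simp
  have a2: "2 * (\<alpha> / 2) = \<alpha>" by simp
  define c0 where "c0 = 2 powr \<alpha> * (\<alpha> / 2) / Gamma (1 - \<alpha> / 2)"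
  define f where "f = radial_integrand d \<alpha> g a"
  obtain b \<eta> where \<eta>: "continuous_on {0..1} \<eta>"
    and dec: "\<And>r. r \<ge> 0 \<Longrightarrow> g r - g a = b * (exp (- r\<^sup>2) - exp (- a\<^sup>2)) + (exp (- r\<^sup>2) - exp (- a\<^sup>2))\<^sup>2 * \<eta> (exp (- r\<^sup>2))"
    using exp_square_decomposition[OF assms(6,7)] by blast
  have "bounded (\<eta> ` {0..1})" using \<eta> by (intro compact_imp_bounded compact_continuous_image) auto
  then obtain M where "\<forall>y\<in>\<eta> ` {0..1}. norm y \<le> M" unfolding bounded_iff by blast
  then have M: "\<bar>\<eta> x\<bar> \<le> M" if "0 \<le> x" "x \<le> 1" for x using that by auto
  have M0: "M \<ge> 0" using M[of 0] by auto
  define q where "q u = (gdev u)\<^sup>2 * \<eta> (gexp u)" for u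
  have "continuous_on UNIV (\<lambda>u. \<eta> (gexp u))"
    by (rule continuous_on_compose2[OF \<eta>]) (use gexp_bounds in \<open>auto simp: gexp_def intro!: continuous_intros\<close>)
  then have "(\<lambda>u. \<eta> (gexp u)) \<in> borel_measurable borel" by (rule borel_measurable_continuous_onI)
  then have qm [measurable]: "q \<in> borel_measurable borel" unfolding q_def by measurable
  have q: "\<bar>q u\<bar> \<le> M * (gdev u)\<^sup>2" for u
    using mult_left_mono[OF M[of "gexp u"], of "(gdev u)\<^sup>2"] gexp_bounds[of u]
    by (simp add: q_def abs_mult mult.commute)
  have jq: "integrable lborel (\<lambda>u. jker u * q u)" by (rule integrable_jker_quadratic[OF qm q])
  define G where "G u = b * gdev u + q u - deriv g a * ell d \<alpha> u" for u
  have Gm [measurable]: "G \<in> borel_measurable borel" unfolding G_def by measurable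
  have G_eq: "G u = g (exp u * a) - g a - deriv g a * ell d \<alpha> u" for u
  proof -
    have "(exp u * a)\<^sup>2 = a\<^sup>2 * exp (2 * u)" by (simp add: power_mult_distrib power2_eq_square mult_exp_exp)
    then have "exp (- (exp u * a)\<^sup>2) = gexp u" by (simp add: gexp_def)
    then show ?thesis using dec[of "exp u * a"] assms(7) by (simp add: G_def q_def gdev_def x0_def)
  qed
  obtain Ce where Ce: "Ce \<ge> 0" "\<And>u. \<bar>ell d \<alpha> u\<bar> \<le> Ce * \<bar>gdev u\<bar>" using ell_le_gdev by blast
  define C where "C = \<bar>b\<bar> + M + \<bar>deriv g a\<bar> * Ce"
  have C0: "C \<ge> 0" using M0 Ce by (simp add: C_def)
  have G_le: "\<bar>G u\<bar> \<le> C * \<bar>gdev u\<bar>" for u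
  proof -
    have "(gdev u)\<^sup>2 \<le> 1 * \<bar>gdev u\<bar>"
      using abs_gdev_le_1[of u] by (subst power2_abs[symmetric]) (simp only: power2_eq_square, intro mult_right_mono, auto)
    then have "M * (gdev u)\<^sup>2 \<le> M * \<bar>gdev u\<bar>" using M0 by (intro mult_left_mono) auto
    then have 1: "\<bar>q u\<bar> \<le> M * \<bar>gdev u\<bar>" using q[of u] by linarith
    have 2: "\<bar>deriv g a * ell d \<alpha> u\<bar> \<le> \<bar>deriv g a\<bar> * (Ce * \<bar>gdev u\<bar>)"
      unfolding abs_mult using Ce(2)[of u] by (intro mult_left_mono) auto
    have 3: "\<bar>b * gdev u\<bar> = \<bar>b\<bar> * \<bar>gdev u\<bar>" by (rule abs_mult)
    have "\<bar>G u\<bar> \<le> \<bar>b * gdev u\<bar> + \<bar>q u\<bar> + \<bar>deriv g a * ell d \<alpha> u\<bar>" unfolding G_def by linarith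
    also have "\<dots> \<le> \<bar>b\<bar> * \<bar>gdev u\<bar> + M * \<bar>gdev u\<bar> + \<bar>deriv g a\<bar> * (Ce * \<bar>gdev u\<bar>)" using 1 2 3 by linarith
    finally show ?thesis by (simp add: C_def algebra_simps)
  qed
  \<comment> \<open>The compensator drops out of the symmetrized integrand.\<close>
  have symmG: "symm G u = b * symm gdev u + symm q u" for u
  proof -
    have "symm G u = b * symm gdev u + symm q u - deriv g a * symm (ell d \<alpha>) u"
      by (simp add: symm_def G_def algebra_simps)
    then show ?thesis using symm_ell[OF h2, of u] unfolding a2 by simp
  qed
  have split: "indicator {0<..} u * (rjump u * symm G u) =
      b * (indicator {0<..} u * (rjump u * symm gdev u)) + indicator {0<..} u * (rjump u * symm q u)" for u :: real
    unfolding symmG by (simp add: algebra_simps)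
  have intG: "integrable lborel (\<lambda>u. indicator {0<..} u * (rjump u * symm G u))"
    unfolding split by (intro Bochner_Integration.integrable_add integrable_mult_right integrable_symm_gdev integrable_jker_symm[OF jq])
  have pvG: "pvint G = b * pvint gdev + (LINT u|lborel. jker u * q u)"
    unfolding pvint_eq[OF jq, symmetric] unfolding pvint_def split
    by (subst Bochner_Integration.integral_add) (auto intro!: integrable_mult_right integrable_symm_gdev integrable_jker_symm[OF jq])
  define I where "I = c0 * pvint G"
  \<comment> \<open>The point \<open>u = 0\<close> is left out because the hypergeometric series diverges there.\<close>
  have f_exp: "f (exp u) * exp u = c0 * (jker u * G u)" if "u \<noteq> 0" for u
  proof -
    have "f (exp u) * exp u = G u * (exp u ^ (d - 1) / (1 + (exp u)\<^sup>2) powr ((\<alpha> + real d) / 2) *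
        Fbar d \<alpha> ((2 * exp u / (1 + (exp u)\<^sup>2))\<^sup>2) * exp u)"
      unfolding f_def radial_integrand_def ln_exp G_eq by (simp only: mult_ac)
    also have "\<dots> = G u * (c0 * jker u)"
      using density_eq_jker[OF h2 d1 that] unfolding a2 c0_def by (simp only:)
    finally show ?thesis by (simp only: mult_ac)
  qed
  have fm: "(\<lambda>y. indicator {0<..} y * f y) \<in> borel_measurable borel"
  proof -
    have "continuous_on {0<..} (\<lambda>y. g (y * a))"
      by (rule continuous_on_compose2[OF C2_0_continuous[OF assms(6)]]) (use assms(7) in \<open>auto intro!: continuous_intros\<close>)
    then have [measurable]: "(\<lambda>y. indicator {0<..} y *\<^sub>R g (y * a)) \<in> borel_measurable borel"
      by (intro borel_measurable_continuous_on_indicator) auto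
    have "(\<lambda>y. (indicator {0<..} y *\<^sub>R g (y * a) - indicator {0<..} y * (g a + deriv g a * ell d \<alpha> (ln y))) *
     (y ^ (d - 1) / (1 + y\<^sup>2) powr ((\<alpha> + real d) / 2)) *
     Fbar d \<alpha> ((2 * y / (1 + y\<^sup>2))\<^sup>2)) \<in> borel_measurable borel"
      unfolding Fbar_def hyp2F1_def by measurable
    also have "(\<lambda>y. (indicator {0<..} y *\<^sub>R g (y * a) - indicator {0<..} y * (g a + deriv g a * ell d \<alpha> (ln y))) *
     (y ^ (d - 1) / (1 + y\<^sup>2) powr ((\<alpha> + real d) / 2)) *
     Fbar d \<alpha> ((2 * y / (1 + y\<^sup>2))\<^sup>2)) = (\<lambda>y. indicator {0<..} y * f y)"
      by (auto simp: f_def radial_integrand_def indicator_def fun_eq_iff)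
    finally show ?thesis .
  qed
  have pv: "has_pv_integral f 1 {0<..} I"
  proof -
    have ind: "indicat_real ({0<..} - cball 1 \<epsilon>) y * f y = indicator {0<..} y * (indicator (- cball 1 \<epsilon>) y * (indicator {0<..} y * f y))" for y \<epsilon>
      by (simp add: indicator_def)
    have m: "(\<lambda>y. indicator (- cball 1 \<epsilon>) y * (indicator {0<..} y * f y)) \<in> borel_measurable borel" for \<epsilon> :: real
      using fm by measurable
    have sub: "(indicator (- cball 1 \<epsilon>) (exp u) * (indicator {0<..} (exp u) * f (exp u))) * exp u =
        c0 * (indicator {u. \<bar>exp u - 1\<bar> > \<epsilon>} u * (jker u * G u))" if "\<epsilon> > 0" for u \<epsilon>
    proof (cases "u = 0")
      case False
      have "indicat_real (- cball 1 \<epsilon>) (exp u) = indicator {u. \<bar>exp u - 1\<bar> > \<epsilon>} u"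
        by (auto simp: indicator_def dist_real_def abs_minus_commute)
      then show ?thesis using f_exp[OF False] by (simp add: mult_ac)
    qed (use that in simp)
    have si: "set_integrable lborel ({0<..} - cball 1 \<epsilon>) f" if "\<epsilon> > 0" for \<epsilon>
    proof -
      have "integrable lborel (\<lambda>u. c0 * (indicator {u. \<bar>exp u - 1\<bar> > \<epsilon>} u * (jker u * G u)))"
        by (intro integrable_mult_right integrable_truncated[OF Gm C0 G_le that])
      then have "set_integrable lborel {0<..} (\<lambda>y. indicator (- cball 1 \<epsilon>) y * (indicator {0<..} y * f y))"
        unfolding set_integrable_exp_substitution[OF m] sub[OF that] .
      then show ?thesis unfolding set_integrable_def by (simp only: real_scaleR_def ind)
    qed
    have sv: "(LINT y:{0<..} - cball 1 \<epsilon>|lborel. f y) = c0 * (LINT u|lborel. indicator {u. \<bar>exp u - 1\<bar> > \<epsilon>} u * (jker u * G u))"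
      if "\<epsilon> > 0" for \<epsilon>
    proof -
      have "(LINT y:{0<..} - cball 1 \<epsilon>|lborel. f y) = (LINT y:{0<..}|lborel. indicator (- cball 1 \<epsilon>) y * (indicator {0<..} y * f y))"
        unfolding set_lebesgue_integral_def by (simp only: real_scaleR_def ind)
      also have "\<dots> = (LINT u|lborel. c0 * (indicator {u. \<bar>exp u - 1\<bar> > \<epsilon>} u * (jker u * G u)))"
        unfolding set_integral_exp_substitution[OF m] sub[OF that] ..
      finally show ?thesis by (simp only: integral_mult_right_zero)
    qed
    have "((\<lambda>\<epsilon>. c0 * (LINT u|lborel. indicator {u. \<bar>exp u - 1\<bar> > \<epsilon>} u * (jker u * G u))) \<longlongrightarrow> I) (at_right 0)"
      unfolding I_def by (intro tendsto_mult_left truncated_tendsto_pvint[OF Gm C0 G_le intG])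
    moreover have "\<forall>\<^sub>F \<epsilon> in at_right 0. c0 * (LINT u|lborel. indicator {u. \<bar>exp u - 1\<bar> > \<epsilon>} u * (jker u * G u)) =
        (LINT y:{0<..} - cball 1 \<epsilon>|lborel. f y)"
      using eventually_at_right_less[of "0::real"] by eventually_elim (simp only: sv)
    ultimately have "((\<lambda>\<epsilon>. LINT y:{0<..} - cball 1 \<epsilon>|lborel. f y) \<longlongrightarrow> I) (at_right 0)"
      by (rule Lim_transform_eventually)
    then show ?thesis using si unfolding has_pv_integral_def by blast
  qed
  have abs: "set_integrable lborel {0<..} f \<and> (LINT y:{0<..}|lborel. f y) = I" if "\<alpha> < 1"
  proof -
    have jg: "integrable lborel (\<lambda>u. C * (jker u * gdev u))"
      using that by (intro integrable_mult_right integrable_jker_gdev) simp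
    have jG: "integrable lborel (\<lambda>u. jker u * G u)"
    proof (rule Bochner_Integration.integrable_bound[OF jg])
      show "AE u in lborel. norm (jker u * G u) \<le> norm (C * (jker u * gdev u))"
      proof (intro AE_I2)
        fix u
        show "norm (jker u * G u) \<le> norm (C * (jker u * gdev u))"
          using mult_left_mono[OF G_le[of u] jker_nonneg[of u]] C0 jker_nonneg[of u]
          by (simp add: abs_mult mult_ac)
      qed
    qed measurable
    have sub: "AE u in lborel. c0 * (jker u * G u) = (indicator {0<..} (exp u) * f (exp u)) * exp u"
      using AE_lborel_singleton[of "0::real"] by eventually_elim (simp add: f_exp)
    have mm: "(\<lambda>u. (indicator {0<..} (exp u) * f (exp u)) * exp u) \<in> borel_measurable borel"
      using measurable_compose[OF _ fm, of exp borel] by measurable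
    have ind: "indicat_real {0<..} y * f y = indicator {0<..} y * (indicator {0<..} y * f y)" for y
      by (simp add: indicator_def)
    have "integrable lborel (\<lambda>u. (indicator {0<..} (exp u) * f (exp u)) * exp u)"
      by (rule integrable_cong_AE_imp[OF integrable_mult_right[OF jG, of c0] _ sub]) (use mm in simp)
    then have "set_integrable lborel {0<..} (\<lambda>y. indicator {0<..} y * f y)"
      unfolding set_integrable_exp_substitution[OF fm] .
    then have 1: "set_integrable lborel {0<..} f"
      unfolding set_integrable_def by (simp only: real_scaleR_def ind[symmetric])
    have "(LINT y:{0<..}|lborel. f y) = (LINT y:{0<..}|lborel. indicator {0<..} y * f y)"
      unfolding set_lebesgue_integral_def by (simp only: real_scaleR_def ind[symmetric])
    also have "\<dots> = (LINT u|lborel. c0 * (jker u * G u))"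
      unfolding set_integral_exp_substitution[OF fm]
      using sub mm by (intro integral_cong_AE) (auto elim: eventually_mono)
    also have "\<dots> = I" unfolding I_def pvint_eq[OF jG] by (rule integral_mult_right_zero)
    finally show ?thesis using 1 by simp
  qed
  obtain z where z: "norm z = a" "Q a = P z"
    using assms(5,7) unfolding radial_laws_def by (metis less_imp_le)
  interpret prob_space "P z" by (rule stable_prob_space[OF assms(4)])
  define A where "A = a powr (- \<alpha>) * c0"
  define \<phi> where "\<phi> t \<omega> = exp (- (norm (Z t \<omega>))\<^sup>2)" for t \<omega>
  have \<phi>01: "0 \<le> \<phi> t \<omega>" "\<phi> t \<omega> \<le> 1" for t \<omega> by (auto simp: \<phi>_def)
  have \<phi>m [measurable]: "\<phi> t \<in> borel_measurable (P z)" if "t \<ge> 0" for t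
    using stable_measurable[OF assms(4) that, of z] unfolding \<phi>_def[abs_def] by measurable
  have g\<phi>: "g (norm (Z t \<omega>)) = g a + b * (\<phi> t \<omega> - x0) + (\<phi> t \<omega> - x0)\<^sup>2 * \<eta> (\<phi> t \<omega>)" for t \<omega>
    using dec[of "norm (Z t \<omega>)"] by (simp add: \<phi>_def x0_def)
  have dim: "real DIM(real ^ 'd) / 2 = real d / 2" by (simp add: d_def)
  have gc: "continuous_on UNIV (\<lambda>w::real^'d. g (norm w))"
    by (rule continuous_on_compose2[OF C2_0_continuous[OF assms(6)]]) (auto intro!: continuous_intros)
  have gm: "(\<lambda>\<omega>. g (norm (Z t \<omega>))) \<in> borel_measurable (P z)" if "t \<ge> 0" for t
    using measurable_compose[OF stable_measurable[OF assms(4) that] borel_measurable_continuous_onI[OF gc]] .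
  have sq1: "(\<phi> t \<omega> - x0)\<^sup>2 \<le> 1" "\<bar>\<phi> t \<omega> - x0\<bar> \<le> 1" for t \<omega>
  proof -
    show "\<bar>\<phi> t \<omega> - x0\<bar> \<le> 1" using \<phi>01[of t \<omega>] x0_bounds by (simp add: abs_le_iff)
    then show "(\<phi> t \<omega> - x0)\<^sup>2 \<le> 1" by (simp add: abs_square_le_1)
  qed
  have gint: "integrable (P z) (\<lambda>\<omega>. g (norm (Z t \<omega>)))" if "t \<ge> 0" for t
  proof (rule integrable_const_bound[where B="\<bar>g a\<bar> + \<bar>b\<bar> + M"])
    show "AE \<omega> in P z. norm (g (norm (Z t \<omega>))) \<le> \<bar>g a\<bar> + \<bar>b\<bar> + M"
    proof (intro AE_I2)
      fix \<omega>
      have "\<bar>b * (\<phi> t \<omega> - x0)\<bar> \<le> \<bar>b\<bar> * 1" unfolding abs_mult using sq1(1)[of t \<omega>] sq1(2)[of t \<omega>] by (intro mult_left_mono) auto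
      moreover have "\<bar>(\<phi> t \<omega> - x0)\<^sup>2 * \<eta> (\<phi> t \<omega>)\<bar> \<le> 1 * M"
        unfolding abs_mult using sq1(1)[of t \<omega>] sq1(2)[of t \<omega>] M[OF \<phi>01[of t \<omega>]] by (intro mult_mono) auto
      ultimately show "norm (g (norm (Z t \<omega>))) \<le> \<bar>g a\<bar> + \<bar>b\<bar> + M" unfolding g\<phi> real_norm_def by linarith
    qed
  qed (rule gm[OF that])
  have poly: "((\<lambda>t. (LINT \<omega>|P z. (\<phi> t \<omega> - x0)\<^sup>2 * r (\<phi> t \<omega>)) / t) \<longlongrightarrow> A * (LINT u|lborel. jker u * ((gdev u)\<^sup>2 * r (gexp u)))) (at_right 0)"
    if r: "real_polynomial_function r" for r
  proof -
    have "real_polynomial_function (\<lambda>x. x - x0)"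
      by (intro real_polynomial_function_diff real_polynomial_function.intros(2)
          real_polynomial_function.intros(1) bounded_linear_ident)
    then have "real_polynomial_function (\<lambda>x. (x - x0)\<^sup>2 * r x)"
      unfolding power2_eq_square using r by (intro real_polynomial_function.intros(4))
    then obtain c n where c: "(\<lambda>x. (x - x0)\<^sup>2 * r x) = (\<lambda>x. \<Sum>i\<le>n. c i * x ^ i)"
      unfolding real_polynomial_function_iff_sum by blast
    define p where "p x = (x - x0)\<^sup>2 * r x" for x
    have p: "p x = (\<Sum>i\<le>n. c i * x ^ i)" for x using fun_cong[OF c, of x] by (simp add: p_def)
    have rc: "continuous_on UNIV r"
      using r by (intro continuous_on_polymonial_function) (simp add: real_polynomial_function_eq)
    have "((\<lambda>t. ((LINT \<omega>|P z. p (exp (- (norm (Z t \<omega>))\<^sup>2))) - p (exp (- a\<^sup>2))) / t) \<longlongrightarrow> A *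
        (\<Sum>i\<le>n. c i * (LINT \<tau>|lborel. gauss_diff (real d / 2) (real i * a\<^sup>2) \<tau> * exp (- (\<alpha> / 2) * \<tau>)))) (at_right 0)"
      using stable_generator_polynomial[OF assms(4,1,2) z(1) assms(7) p] unfolding dim A_def c0_def .
    then show ?thesis
      unfolding polynomial_quadratic[OF p p_def rc] by (simp add: p_def \<phi>_def x0_def)
  qed
  have lin: "((\<lambda>t. (LINT \<omega>|P z. \<phi> t \<omega> - x0) / t) \<longlongrightarrow> A * pvint gdev) (at_right 0)"
  proof -
    have "((\<lambda>t. ((LINT \<omega>|P z. exp (- 1 * (norm (Z t \<omega>))\<^sup>2)) - exp (- 1 * a\<^sup>2)) / t) \<longlongrightarrow> A * pvint gdev) (at_right 0)"
      using stable_generator_gaussian[OF assms(4,1,2) _ z(1) assms(7), of 1] unfolding pvint_gdev dim A_def c0_def by simp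
    moreover have "\<forall>\<^sub>F t in at_right 0. ((LINT \<omega>|P z. exp (- 1 * (norm (Z t \<omega>))\<^sup>2)) - exp (- 1 * a\<^sup>2)) / t = (LINT \<omega>|P z. \<phi> t \<omega> - x0) / t"
      using eventually_at_right_less[of "0::real"]
    proof eventually_elim
      case (elim t)
      have "integrable (P z) (\<phi> t)"
        by (rule integrable_const_bound[where B=1]) (use \<phi>01 \<phi>m[of t] elim in auto)
      then have "(LINT \<omega>|P z. \<phi> t \<omega> - x0) = (LINT \<omega>|P z. \<phi> t \<omega>) - x0"
        using prob_space by simp
      then show ?case by (simp add: \<phi>_def x0_def)
    qed
    ultimately show ?thesis by (rule Lim_transform_eventually)
  qed
  define v where "v = (LINT u|lborel. jker u * (gdev u)\<^sup>2)"
  have v0: "v \<ge> 0" unfolding v_def by (intro Bochner_Integration.integral_nonneg) (simp add: jker_nonneg)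
  have A0: "A \<ge> 0" unfolding A_def c0_def using assms by (intro mult_nonneg_nonneg divide_nonneg_nonneg) (auto intro!: less_imp_le Gamma_real_pos)
  \<comment> \<open>A polynomial \<open>r\<close> within \<open>e\<close> of \<open>\<eta>\<close> changes the difference quotient by at most \<open>e\<close> times that of \<open>(\<phi> - x0)\<^sup>2\<close>.\<close>
  have gen: "((\<lambda>t. ((LINT \<omega>|P z. g (norm (Z t \<omega>))) - g a) / t) \<longlongrightarrow> A * pvint G) (at_right 0)"
  proof (rule tendsto_approximation)
    show "A * v \<ge> 0" using A0 v0 by simp
    show "((\<lambda>t. (LINT \<omega>|P z. (\<phi> t \<omega> - x0)\<^sup>2) / t) \<longlongrightarrow> A * v) (at_right 0)"
      using poly[OF real_polynomial_function.intros(2)[of 1]] by (simp add: v_def)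
    fix e :: real assume e: "e > 0"
    obtain r where r: "real_polynomial_function r" "\<And>x. x \<in> {0..1} \<Longrightarrow> \<bar>\<eta> x - r x\<bar> < e"
      using Stone_Weierstrass_real_polynomial_function[OF compact_Icc \<eta> e] by blast
    have rc: "continuous_on UNIV r"
      using r(1) by (intro continuous_on_polymonial_function) (simp add: real_polynomial_function_eq)
    then have rm [measurable]: "r \<in> borel_measurable borel" by (rule borel_measurable_continuous_onI)
    define R where "R t = b * ((LINT \<omega>|P z. \<phi> t \<omega> - x0) / t) + (LINT \<omega>|P z. (\<phi> t \<omega> - x0)\<^sup>2 * r (\<phi> t \<omega>)) / t" for t
    define m where "m = b * (A * pvint gdev) + A * (LINT u|lborel. jker u * ((gdev u)\<^sup>2 * r (gexp u)))"
    have "(R \<longlongrightarrow> m) (at_right 0)"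
      unfolding R_def m_def by (intro tendsto_add tendsto_mult_left lin poly r(1))
    moreover have "\<forall>\<^sub>F t in at_right 0. \<bar>((LINT \<omega>|P z. g (norm (Z t \<omega>))) - g a) / t - R t\<bar> \<le> e * ((LINT \<omega>|P z. (\<phi> t \<omega> - x0)\<^sup>2) / t)"
      using eventually_at_right_less[of "0::real"]
    proof eventually_elim
      case (elim t)
      have [measurable]: "\<phi> t \<in> borel_measurable (P z)" using \<phi>m[of t] elim by simp
      have i1: "integrable (P z) (\<phi> t)"
        by (rule integrable_const_bound[where B=1]) (use \<phi>01 elim in auto)
      have i2: "integrable (P z) (\<lambda>\<omega>. (\<phi> t \<omega> - x0)\<^sup>2)"
        by (rule integrable_const_bound[where B=1]) (use sq1 elim in auto)
      have rb: "\<bar>r (\<phi> t \<omega>)\<bar> \<le> M + e" for \<omega>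
        using r(2)[of "\<phi> t \<omega>"] M[OF \<phi>01[of t \<omega>]] \<phi>01[of t \<omega>] by auto
      have i3: "integrable (P z) (\<lambda>\<omega>. (\<phi> t \<omega> - x0)\<^sup>2 * r (\<phi> t \<omega>))"
      proof (rule integrable_const_bound[where B="1 * (M + e)"])
        show "AE \<omega> in P z. norm ((\<phi> t \<omega> - x0)\<^sup>2 * r (\<phi> t \<omega>)) \<le> 1 * (M + e)"
          unfolding real_norm_def abs_mult using sq1 rb by (intro AE_I2 mult_mono) auto
      qed measurable
      have i4: "integrable (P z) (\<lambda>\<omega>. (\<phi> t \<omega> - x0)\<^sup>2 * \<eta> (\<phi> t \<omega>))"
      proof -
        have "integrable (P z) (\<lambda>\<omega>. g (norm (Z t \<omega>)) - g a - b * (\<phi> t \<omega> - x0))"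
          using gint[of t] i1 elim by auto
        then show ?thesis by (simp add: g\<phi>)
      qed
      have "(LINT \<omega>|P z. g (norm (Z t \<omega>))) = g a + b * (LINT \<omega>|P z. \<phi> t \<omega> - x0) + (LINT \<omega>|P z. (\<phi> t \<omega> - x0)\<^sup>2 * \<eta> (\<phi> t \<omega>))"
        unfolding g\<phi> using i1 i4 prob_space by simp
      then have "((LINT \<omega>|P z. g (norm (Z t \<omega>))) - g a) / t - R t =
          ((LINT \<omega>|P z. (\<phi> t \<omega> - x0)\<^sup>2 * \<eta> (\<phi> t \<omega>)) - (LINT \<omega>|P z. (\<phi> t \<omega> - x0)\<^sup>2 * r (\<phi> t \<omega>))) / t"
        by (simp add: R_def add_divide_distrib diff_divide_distrib)
      also have "\<dots> = (LINT \<omega>|P z. (\<phi> t \<omega> - x0)\<^sup>2 * (\<eta> (\<phi> t \<omega>) - r (\<phi> t \<omega>))) / t"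
        using i3 i4 by (simp add: right_diff_distrib)
      finally have eq: "((LINT \<omega>|P z. g (norm (Z t \<omega>))) - g a) / t - R t = \<dots>" .
      have "\<bar>LINT \<omega>|P z. (\<phi> t \<omega> - x0)\<^sup>2 * (\<eta> (\<phi> t \<omega>) - r (\<phi> t \<omega>))\<bar> \<le> (LINT \<omega>|P z. e * (\<phi> t \<omega> - x0)\<^sup>2)"
      proof (rule order_trans[OF integral_abs_bound integral_mono])
        have "integrable (P z) (\<lambda>\<omega>. (\<phi> t \<omega> - x0)\<^sup>2 * (\<eta> (\<phi> t \<omega>) - r (\<phi> t \<omega>)))"
          using Bochner_Integration.integrable_diff[OF i4 i3] by (simp add: right_diff_distrib)
        then show "integrable (P z) (\<lambda>\<omega>. \<bar>(\<phi> t \<omega> - x0)\<^sup>2 * (\<eta> (\<phi> t \<omega>) - r (\<phi> t \<omega>))\<bar>)"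
          by (rule integrable_abs)
        show "integrable (P z) (\<lambda>\<omega>. e * (\<phi> t \<omega> - x0)\<^sup>2)" using i2 by simp
        fix \<omega>
        have "(\<phi> t \<omega> - x0)\<^sup>2 * \<bar>\<eta> (\<phi> t \<omega>) - r (\<phi> t \<omega>)\<bar> \<le> (\<phi> t \<omega> - x0)\<^sup>2 * e"
          using r(2)[of "\<phi> t \<omega>"] \<phi>01[of t \<omega>] by (intro mult_left_mono) auto
        then show "\<bar>(\<phi> t \<omega> - x0)\<^sup>2 * (\<eta> (\<phi> t \<omega>) - r (\<phi> t \<omega>))\<bar> \<le> e * (\<phi> t \<omega> - x0)\<^sup>2"
          by (simp add: abs_mult mult.commute)
      qed
      also have "\<dots> = e * (LINT \<omega>|P z. (\<phi> t \<omega> - x0)\<^sup>2)" by simp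
      finally have "\<bar>LINT \<omega>|P z. (\<phi> t \<omega> - x0)\<^sup>2 * (\<eta> (\<phi> t \<omega>) - r (\<phi> t \<omega>))\<bar> / t \<le> e * (LINT \<omega>|P z. (\<phi> t \<omega> - x0)\<^sup>2) / t"
        using elim by (intro divide_right_mono) auto
      then show ?case unfolding eq using elim by (simp add: abs_divide)
    qed
    moreover have "\<bar>m - A * pvint G\<bar> \<le> e * (A * v)"
    proof -
      have bd: "\<bar>(gdev u)\<^sup>2 * r (gexp u)\<bar> \<le> (M + e) * (gdev u)\<^sup>2" for u
      proof -
        have "\<bar>r (gexp u)\<bar> \<le> M + e"
          using r(2)[of "gexp u"] M[of "gexp u"] gexp_bounds[of u] by auto
        then show ?thesis using mult_left_mono[of "\<bar>r (gexp u)\<bar>" "M + e" "(gdev u)\<^sup>2"] by (simp add: abs_mult mult.commute)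
      qed
      have ir: "integrable lborel (\<lambda>u. jker u * ((gdev u)\<^sup>2 * r (gexp u)))"
        by (rule integrable_jker_quadratic[OF _ bd]) measurable
      have iv: "integrable lborel (\<lambda>u. jker u * (gdev u)\<^sup>2)"
        by (rule integrable_jker_quadratic[where C=1]) auto
      have "m - A * pvint G = A * ((LINT u|lborel. jker u * ((gdev u)\<^sup>2 * r (gexp u))) - (LINT u|lborel. jker u * q u))"
        unfolding m_def pvG by (simp add: algebra_simps)
      also have "\<dots> = A * (LINT u|lborel. jker u * ((gdev u)\<^sup>2 * r (gexp u)) - jker u * q u)"
        using ir jq by simp
      finally have eq: "m - A * pvint G = \<dots>" .
      have "\<bar>LINT u|lborel. jker u * ((gdev u)\<^sup>2 * r (gexp u)) - jker u * q u\<bar> \<le> (LINT u|lborel. e * (jker u * (gdev u)\<^sup>2))"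
      proof (rule integral_abs_bound_integral)
        fix u
        have "jker u * ((gdev u)\<^sup>2 * r (gexp u)) - jker u * q u = - (jker u * (gdev u)\<^sup>2 * (\<eta> (gexp u) - r (gexp u)))"
          by (simp add: q_def algebra_simps)
        moreover have "jker u * (gdev u)\<^sup>2 * \<bar>\<eta> (gexp u) - r (gexp u)\<bar> \<le> jker u * (gdev u)\<^sup>2 * e"
          using r(2)[of "gexp u"] gexp_bounds[of u] jker_nonneg[of u] by (intro mult_left_mono) auto
        ultimately show "\<bar>jker u * ((gdev u)\<^sup>2 * r (gexp u)) - jker u * q u\<bar> \<le> e * (jker u * (gdev u)\<^sup>2)"
          by (simp add: abs_mult jker_nonneg mult_ac)
      qed (use ir jq iv in auto)
      also have "\<dots> = e * v" by (simp add: v_def)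
      finally show ?thesis unfolding eq abs_mult using A0 mult_left_mono by (simp add: mult.left_commute[of e A] mult_left_mono)
    qed
    ultimately show "\<exists>R m. (R \<longlongrightarrow> m) (at_right 0) \<and>
        (\<forall>\<^sub>F t in at_right 0. \<bar>((LINT \<omega>|P z. g (norm (Z t \<omega>))) - g a) / t - R t\<bar> \<le> e * ((LINT \<omega>|P z. (\<phi> t \<omega> - x0)\<^sup>2) / t)) \<and>
        \<bar>m - A * pvint G\<bar> \<le> e * (A * v)"
      by blast
  qed
  have "has_generator_at Q (radial_part Z) g a (a powr (- \<alpha>) * I)"
    unfolding has_generator_at_def radial_part_def z(2) using gint gen by (simp add: I_def A_def mult.assoc)
  then show ?thesis using pv abs unfolding f_def d_def by blast
qed

end
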